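(* Let $X$ be a Riemann surface and let $\varphi\colon X\to \mathbb{CP}^3$ be a transverse $J$-holomorphic curve in nearly Kähler $\mathbb{CP}^3$ with angle functions $\alpha_-,\alpha_+\colon X\to\mathbb{R}^{>0}$. Put $\gamma=(\alpha_-\alpha_+)^{-1/4}$, so that the metric $\gamma^{-2}g_{\mathcal H}$ on $X$ is flat, and let $\Delta_0$ be the Laplace operator on functions with respect to $\gamma^{-2}g_{\mathcal H}$. Then the functions $\alpha_-,\alpha_+$ satisfy $$\Delta_0\log(\alpha_-^2)=-4(3\alpha_-^2+\alpha_+^2-2)\gamma^2,\qquad \Delta_0\log(\alpha_+^2)=-4(3\alpha_+^2+\alpha_-^2-2)\gamma^2 .$$ These equations are equivalent to the affine 2D Toda lattice equations for $\mathfrak{sp}(2)$. The induced Gauss curvature on $X$ is $$\frac{2}{\sqrt{\alpha_-\alpha_+}}\,(1-\alpha_-^2-\alpha_+^2).$$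
   Context: Nearly Kähler $\mathbb{CP}^3$: identify $\mathbb{H}=\mathbb{C}\oplus j\mathbb{C}$ and $\mathbb{H}^2\cong\mathbb{C}^4$ via $(z_0+jz_1,z_2+jz_3)\leftrightarrow(z_0,z_1,z_2,z_3)$. $\mathrm{Sp}(2)$ acts transitively on $\mathbb{CP}^3$, and the stabiliser of $[1,0,0,0]$ is $\{\mathrm{diag}(z,q): z\in S^1\subset\mathbb{C},\ q\in S^3\subset\mathbb{H}\}=S^1\times S^3$, so $\mathbb{CP}^3=\mathrm{Sp}(2)/(S^1\times S^3)$. Write the left-invariant Maurer–Cartan form as $$\Omega_{MC}=\begin{pmatrix} i\rho_1+j\overline{\omega_3} & -\frac{\overline{\omega_1}}{\sqrt2}+j\frac{\omega_2}{\sqrt2}\\ \frac{\omega_1}{\sqrt2}+j\frac{\omega_2}{\sqrt2} & i\rho_2+j\tau\end{pmatrix}$$ with complex-valued 1-forms $\omega_1,\omega_2,\omega_3,\tau$ and real 1-forms $\rho_1,\rho_2$. The nearly Kähler almost complex structure $J$ and metric $g$ are determined by requiring that $s^*\omega_1,s^*\omega_2,s^*\omega_3$ be unitary $(1,0)$-forms for every local section $s$ of $\mathrm{Sp}(2)\to\mathbb{CP}^3$. The twistor fibration is $\mathbb{CP}^3\to\mathbb{HP}^1\cong S^4$, $[z_0,z_1,z_2,z_3]\mapsto[z_0+jz_1:z_2+jz_3]$; $\mathcal V$ is its vertical bundle (where $\omega_1=\omega_2=0$) and $\mathcal H=\mathcal V^\perp$ (where $\omega_3=0$). The metric splits as $g=g_{\mathcal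 H}+g_{\mathcal V}$ with $g_{\mathcal H}=|\omega_1|^2+|\omega_2|^2$, $g_{\mathcal V}=|\omega_3|^2$; the same symbols denote the pullbacks to a curve $\varphi\colon X\to\mathbb{CP}^3$. The Gauss curvature in the claim is that of the induced metric $g_{\mathcal H}$ on $X$. For a nowhere vertical $J$-holomorphic curve $\varphi$, the bundle $\varphi^*\mathrm{Sp}(2)$ reduces to the $S^1\times S^1$-bundle cut out by $\omega_2=0$; on it the form $\tau$ is of type $(1,0)$ and $|\tau|$, $|\omega_1|$ descend to $X$. The curve is called transverse if it is nowhere tangent to $\mathcal H$, nowhere tangent to $\mathcal V$, and $\tau$ vanishes at no point. For a transverse curve the angle functions are $\alpha_-(x)=\|\xi\|_{\mathcal V}/\|\xi\|_{\mathcal H}$ and $\alpha_+(x)=|\tau(\xi)|/|\omega_1(\xi)|$ for any $0\neq\xi\in T_xX$. Laplacian convention: $\Delta$ denotes the positive definite Laplace operator $\Omega^0(X)\to\Omega^2(X)$, and $\Delta_0$ is the Laplace operator on functions for the flat metric $\gamma^{-2}g_{\mathcal H}$. The equivalence with the affine 2D Toda lattice equations for $\mathfrak{sp}(2)$ is as follows: with $\hat\alpha_\pm=\gamma\alpha_\pm$ the system becomes $$\Delta_0\log(\hat\alpha_-^2)=-4(2\hat\alpha_-^2-\hat\alpha_-^{-1}\hat\alpha_+^{-1}),\qquad \Delta_0\log(\hat\alpha_+^2)=-4(2\hat\alpha_+^2-\hat\alpha_-^{-1}\hat\alpha_+^{-1}),$$ and putting $\hat\alpha_-^2=\frac1{\sqrt2}e^{\Omega_1}$,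 $\hat\alpha_+^2=\frac1{\sqrt2}e^{-\Omega_2}$ gives the affine 2D Toda equations for $\mathfrak{sp}(2)$ in the unknowns $\Omega_1,\Omega_2$, that is, $$\Delta_0\Omega_1=-4\sqrt2\,(e^{\Omega_1}-e^{(\Omega_2-\Omega_1)/2}),\qquad \Delta_0\Omega_2=4\sqrt2\,(e^{-\Omega_2}-e^{(\Omega_2-\Omega_1)/2}).$$
   Formalization: The Gauss curvature of g_H is shown to be 2(1−α₋²−α₊²); the displayed expression, false in general as a Gauss curvature, is its curvature 2-form relative to the area form of γ⁻²g_H. Δ₀ is div grad, not the positive definite Laplacian, since the equations need that sign. *)

theory Defs
  imports "HOL-Analysis.Analysis"
begin

section \<open>Smooth functions and Riemannian metrics on open subsets of the plane\<close>

definition pderiv_dir :: "complex \<Rightarrow> (complex \<Rightarrow> 'b::real_normed_vector) \<Rightarrow> complex \<Rightarrow> 'b" where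
  "pderiv_dir u f p = frechet_derivative f (at p) u"

primrec Ck_on :: "nat \<Rightarrow> complex set \<Rightarrow> (complex \<Rightarrow> 'b::real_normed_vector) \<Rightarrow> bool" where
  "Ck_on 0 S f \<longleftrightarrow> continuous_on S f"
| "Ck_on (Suc k) S f \<longleftrightarrow>
     f differentiable_on S \<and> Ck_on k S (pderiv_dir 1 f) \<and> Ck_on k S (pderiv_dir \<i> f)"

text \<open>Only used for open \<open>S\<close>, where the derivatives at \<open>p\<close> depend on \<open>f\<close> near \<open>p\<close> only.\<close>

definition smooth_on :: "complex set \<Rightarrow> (complex \<Rightarrow> 'b::real_normed_vector) \<Rightarrow> bool" where
  "smooth_on S f \<longleftrightarrow> (\<forall>k. Ck_on k S f)"

text \<open>\<open>g p u v\<close> is the inner product of the tangent vectors \<open>u\<close> and \<open>v\<close> at \<open>p\<close>.\<close>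

type_synonym plane_metric = "complex \<Rightarrow> complex \<Rightarrow> complex \<Rightarrow> real"

definition riemannian_metric_on :: "complex set \<Rightarrow> plane_metric \<Rightarrow> bool" where
  "riemannian_metric_on S g \<longleftrightarrow>
     (\<forall>p\<in>S. bilinear (g p) \<and> (\<forall>u v. g p u v = g p v u) \<and> (\<forall>u. u \<noteq> 0 \<longrightarrow> g p u u > 0)) \<and>
     (\<forall>u v. smooth_on S (\<lambda>p. g p u v))"

definition metric_det :: "plane_metric \<Rightarrow> complex \<Rightarrow> real" where
  "metric_det g p = g p 1 1 * g p \<i> \<i> - (g p 1 \<i>)\<^sup>2"

definition area_density :: "plane_metric \<Rightarrow> complex \<Rightarrow> real" where
  "area_density g p = sqrt (metric_det g p)"

text \<open>The entries of the inverse Gram matrix, for \<open>a, b \<in> Basis = {1, \<i>}\<close>: the cofactor matrix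
  of a symmetric bilinear form on the plane is the form composed with the rotation by \<open>\<i>\<close>.\<close>

definition metric_inv :: "plane_metric \<Rightarrow> complex \<Rightarrow> complex \<Rightarrow> complex \<Rightarrow> real" where
  "metric_inv g p a b = g p (\<i> * a) (\<i> * b) / metric_det g p"

text \<open>The Laplace-Beltrami operator \<open>div grad\<close>; it is \<open>\<partial>\<^sub>x\<^sup>2 + \<partial>\<^sub>y\<^sup>2\<close> for the
  Euclidean metric.\<close>

definition laplacian :: "plane_metric \<Rightarrow> (complex \<Rightarrow> real) \<Rightarrow> complex \<Rightarrow> real" where
  "laplacian g f p =
     (\<Sum>a\<in>Basis. pderiv_dir a
        (\<lambda>q. \<Sum>b\<in>Basis. area_density g q * metric_inv g q a b * pderiv_dir b f q) p)
     / area_density g p"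

text \<open>Christoffel symbols of the first kind \<open>\<Gamma>\<^sub>k\<^sub>,\<^sub>i\<^sub>j\<close>.\<close>

definition christoffel ::
  "plane_metric \<Rightarrow> complex \<Rightarrow> complex \<Rightarrow> complex \<Rightarrow> complex \<Rightarrow> real" where
  "christoffel g p k i j =
     (pderiv_dir i (\<lambda>q. g q j k) p + pderiv_dir j (\<lambda>q. g q i k) p
      - pderiv_dir k (\<lambda>q. g q i j) p) / 2"

text \<open>The component \<open>R\<^sub>1\<^sub>2\<^sub>1\<^sub>2\<close> of the Riemann curvature tensor, with the sign for which it is
  positive on round spheres.\<close>

definition riemann_1212 :: "plane_metric \<Rightarrow> complex \<Rightarrow> real" where
  "riemann_1212 g p =
     (2 * pderiv_dir 1 (pderiv_dir \<i> (\<lambda>q. g q 1 \<i>)) p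
      - pderiv_dir \<i> (pderiv_dir \<i> (\<lambda>q. g q 1 1)) p
      - pderiv_dir 1 (pderiv_dir 1 (\<lambda>q. g q \<i> \<i>)) p) / 2
     + (\<Sum>m\<in>Basis. \<Sum>n\<in>Basis. metric_inv g p m n *
          (christoffel g p m 1 \<i> * christoffel g p n 1 \<i>
           - christoffel g p m 1 1 * christoffel g p n \<i> \<i>))"

definition gauss_curvature :: "plane_metric \<Rightarrow> complex \<Rightarrow> real" where
  "gauss_curvature g p = riemann_1212 g p / metric_det g p"

text \<open>The function \<open>k\<close> with \<open>K\<^sub>g dA\<^sub>g = k dA\<^sub>h\<close>: the curvature 2-form of \<open>g\<close> measured against
  the area form of \<open>h\<close>.\<close>

definition curvature_density :: "plane_metric \<Rightarrow> plane_metric \<Rightarrow> complex \<Rightarrow> real" where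
  "curvature_density h g p = gauss_curvature g p * area_density g p / area_density h p"

definition flat_metric_on :: "complex set \<Rightarrow> plane_metric \<Rightarrow> bool" where
  "flat_metric_on S g \<longleftrightarrow> riemannian_metric_on S g \<and> (\<forall>p\<in>S. gauss_curvature g p = 0)"


section \<open>Riemann surfaces\<close>

type_synonym 'a chart = "'a set \<times> ('a \<Rightarrow> complex)"

definition riemann_surface :: "'a topology \<Rightarrow> 'a chart set \<Rightarrow> bool" where
  "riemann_surface X \<A> \<longleftrightarrow>
     Hausdorff_space X \<and> connected_space X \<and>
     (\<Union>(U, z)\<in>\<A>. U) = topspace X \<and>
     (\<forall>(U, z)\<in>\<A>. openin X U \<and> open (z ` U) \<and>
        homeomorphic_map (subtopology X U) (top_of_set (z ` U)) z) \<and>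
     (\<forall>(U, z)\<in>\<A>. \<forall>(V, w)\<in>\<A>. (w \<circ> inv_into U z) holomorphic_on (z ` (U \<inter> V)))"

definition chart_range :: "'a chart \<Rightarrow> complex set" where
  "chart_range c = snd c ` fst c"

definition coord_rep :: "'a chart \<Rightarrow> ('a \<Rightarrow> 'b) \<Rightarrow> complex \<Rightarrow> 'b" where
  "coord_rep c f p = f (inv_into (fst c) (snd c) p)"

definition smooth_fun :: "'a chart set \<Rightarrow> ('a \<Rightarrow> 'b::real_normed_vector) \<Rightarrow> bool" where
  "smooth_fun \<A> f \<longleftrightarrow> (\<forall>c\<in>\<A>. smooth_on (chart_range c) (coord_rep c f))"

text \<open>A metric on the surface is given by its expressions in the charts.  The value of
  \<open>laplacian_at g c f x\<close> is that of the Laplace operator at \<open>x\<close>, computed in the chart \<open>c\<close>.\<close>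

type_synonym 'a surface_metric = "'a chart \<Rightarrow> plane_metric"

definition laplacian_at :: "'a surface_metric \<Rightarrow> 'a chart \<Rightarrow> ('a \<Rightarrow> real) \<Rightarrow> 'a \<Rightarrow> real" where
  "laplacian_at g c f x = laplacian (g c) (coord_rep c f) (snd c x)"


section \<open>Quaternions and \<open>Sp(2)\<close>\<close>

text \<open>The pair \<open>(a, b)\<close> stands for \<open>a + j b\<close>.  The product follows from \<open>z j = j (cnj z)\<close>.\<close>

type_synonym quat = "complex \<times> complex"

definition qmult :: "quat \<Rightarrow> quat \<Rightarrow> quat" where
  "qmult x y = (fst x * fst y - cnj (snd x) * snd y, cnj (fst x) * snd y + snd x * fst y)"

definition qcnj :: "quat \<Rightarrow> quat" where
  "qcnj x = (cnj (fst x), - snd x)"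

type_synonym qmat = "quat^2^2"

definition qmat_mult :: "qmat \<Rightarrow> qmat \<Rightarrow> qmat" where
  "qmat_mult A B = (\<chi> r s. \<Sum>k\<in>UNIV. qmult (A $ r $ k) (B $ k $ s))"

definition qmat_adj :: "qmat \<Rightarrow> qmat" where
  "qmat_adj A = (\<chi> r s. qcnj (A $ s $ r))"

definition Sp2 :: "qmat set" where
  "Sp2 = {A. qmat_mult (qmat_adj A) A = (\<chi> r s. if r = s then (1, 0) else 0)}"

text \<open>\<open>maurer_cartan A B\<close> is \<open>A\<^sup>-\<^sup>1 B\<close>, the value of the left-invariant Maurer-Cartan form on the
  tangent vector \<open>B\<close> of \<open>Sp(2)\<close> at \<open>A\<close>; recall \<open>A\<^sup>-\<^sup>1 = A\<^sup>*\<close>.\<close>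

definition maurer_cartan :: "qmat \<Rightarrow> qmat \<Rightarrow> qmat" where
  "maurer_cartan A B = qmat_mult (qmat_adj A) B"

definition sp2_algebra :: "qmat set" where
  "sp2_algebra = {M. qmat_adj M = - M}"

definition Sp2_tangent :: "qmat \<Rightarrow> qmat set" where
  "Sp2_tangent A = {B. maurer_cartan A B \<in> sp2_algebra}"

definition \<omega>1 :: "qmat \<Rightarrow> complex" where "\<omega>1 M = sqrt 2 * fst (M $ 2 $ 1)"
definition \<omega>2 :: "qmat \<Rightarrow> complex" where "\<omega>2 M = sqrt 2 * snd (M $ 2 $ 1)"
definition \<omega>3 :: "qmat \<Rightarrow> complex" where "\<omega>3 M = cnj (snd (M $ 1 $ 1))"
definition \<tau>_form :: "qmat \<Rightarrow> complex" where "\<tau>_form M = snd (M $ 2 $ 2)"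
definition \<rho>1 :: "qmat \<Rightarrow> real" where "\<rho>1 M = Im (fst (M $ 1 $ 1))"
definition \<rho>2 :: "qmat \<Rightarrow> real" where "\<rho>2 M = Im (fst (M $ 2 $ 2))"

lemma sp2_algebra_components:
  assumes "M \<in> sp2_algebra"
  shows "M $ 1 $ 1 = (\<i> * \<rho>1 M, cnj (\<omega>3 M))"
    and "M $ 1 $ 2 = (- cnj (\<omega>1 M) / sqrt 2, \<omega>2 M / sqrt 2)"
    and "M $ 2 $ 1 = (\<omega>1 M / sqrt 2, \<omega>2 M / sqrt 2)"
    and "M $ 2 $ 2 = (\<i> * \<rho>2 M, \<tau>_form M)"
proof -
  have *: "qcnj (M $ s $ r) = - (M $ r $ s)" for r s
    using assms unfolding sp2_algebra_def qmat_adj_def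
    by (metis (mono_tags, lifting) mem_Collect_eq vec_lambda_beta vector_uminus_component)
  have r2: "complex_of_real (sqrt 2) \<noteq> 0" by simp
  show "M $ 1 $ 1 = (\<i> * \<rho>1 M, cnj (\<omega>3 M))" "M $ 2 $ 2 = (\<i> * \<rho>2 M, \<tau>_form M)"
    using *[of 1 1] *[of 2 2]
    by (auto simp: qcnj_def \<rho>1_def \<rho>2_def \<omega>3_def \<tau>_form_def prod_eq_iff complex_eq_iff)
  show "M $ 2 $ 1 = (\<omega>1 M / sqrt 2, \<omega>2 M / sqrt 2)"
    by (simp add: \<omega>1_def \<omega>2_def)
  show "M $ 1 $ 2 = (- cnj (\<omega>1 M) / sqrt 2, \<omega>2 M / sqrt 2)"
    using *[of 1 2] *[of 2 1] by (auto simp: qcnj_def \<omega>1_def \<omega>2_def prod_eq_iff)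
qed


section \<open>Nearly Kaehler complex projective 3-space\<close>

text \<open>The point \<open>[v]\<close> is represented by the orthogonal projection of \<open>\<complex>\<^sup>4\<close> onto the line
  spanned by \<open>v\<close>.  This embeds projective space as a submanifold of the vector space of matrices,
  so that smoothness and tangent vectors are those of the ambient space.\<close>

definition proj_point :: "complex^4 \<Rightarrow> complex^4^4" where
  "proj_point v = (\<chi> r s. v $ r * cnj (v $ s) / (norm v)\<^sup>2)"

definition CP3 :: "(complex^4^4) set" where
  "CP3 = proj_point ` {v. v \<noteq> 0}"

lemma proj_point_eq_iff:
  assumes "v \<noteq> 0" "w \<noteq> 0"
  shows "proj_point v = proj_point w \<longleftrightarrow> (\<exists>c. c \<noteq> 0 \<and> w = c *s v)"
proof
  assume eq: "proj_point v = proj_point w"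
  from assms(2) obtain s where s: "w $ s \<noteq> 0" by (auto simp: vec_eq_iff)
  have e: "v $ r * cnj (v $ s) / (norm v)\<^sup>2 = w $ r * cnj (w $ s) / (norm w)\<^sup>2" for r
    using arg_cong[OF eq, of "\<lambda>P. P $ r $ s"] by (simp add: proj_point_def)
  define c where "c = cnj (v $ s) * (norm w)\<^sup>2 / ((norm v)\<^sup>2 * cnj (w $ s))"
  have w: "w $ r = c * v $ r" for r
  proof -
    have "w $ r = (w $ r * cnj (w $ s) / (norm w)\<^sup>2) * ((norm w)\<^sup>2 / cnj (w $ s))"
      using s assms by simp
    also have "\<dots> = (v $ r * cnj (v $ s) / (norm v)\<^sup>2) * ((norm w)\<^sup>2 / cnj (w $ s))"
      by (simp only: e)
    also have "\<dots> = c * v $ r"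
      by (simp add: c_def)
    finally show ?thesis .
  qed
  then have "c \<noteq> 0" using s by force
  then show "\<exists>c. c \<noteq> 0 \<and> w = c *s v" using w by (auto simp: vec_eq_iff)
next
  assume "\<exists>c. c \<noteq> 0 \<and> w = c *s v"
  then obtain c where c: "c \<noteq> 0" "w = c *s v" by blast
  have n: "norm w = cmod c * norm v"
    unfolding c(2) by (simp add: norm_vec_def norm_mult L2_set_right_distrib)
  have "w $ r * cnj (w $ s) / (norm w)\<^sup>2 = v $ r * cnj (v $ s) / (norm v)\<^sup>2" for r s
  proof -
    have "w $ r * cnj (w $ s) / (norm w)\<^sup>2
        = ((c * cnj c) * (v $ r * cnj (v $ s))) / ((c * cnj c) * (norm v)\<^sup>2)"
      using complex_norm_square[of c] unfolding n
      by (simp only: c(2) vector_smult_component complex_cnj_mult of_real_mult of_real_power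
          power_mult_distrib ac_simps)
    also have "\<dots> = v $ r * cnj (v $ s) / (norm v)\<^sup>2"
      using c(1) by simp
    finally show ?thesis .
  qed
  then show "proj_point v = proj_point w"
    by (simp add: proj_point_def vec_eq_iff)
qed

text \<open>The orbit map \<open>A \<mapsto> A\<cdot>[1,0,0,0]\<close>, where \<open>\<complex>\<^sup>4\<close> is identified with the column vectors
  \<open>(z\<^sub>0 + j z\<^sub>1, z\<^sub>2 + j z\<^sub>3)\<close>.\<close>

definition Sp2_proj :: "qmat \<Rightarrow> complex^4^4" where
  "Sp2_proj A = proj_point (vector [fst (A$1$1), snd (A$1$1), fst (A$2$1), snd (A$2$1)])"

text \<open>\<open>tangent_lift P V A M\<close>: some tangent vector \<open>B\<close> of \<open>Sp(2)\<close> at \<open>A\<close> lies over the tangent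
  vector \<open>V\<close> of projective space at \<open>P\<close>, and its Maurer-Cartan value is \<open>M\<close>.  Equivalently
  \<open>A = s(P)\<close> and \<open>M = s\<^sup>*\<Omega>(V)\<close> for some local section \<open>s\<close> of the orbit map.\<close>

definition tangent_lift :: "complex^4^4 \<Rightarrow> complex^4^4 \<Rightarrow> qmat \<Rightarrow> qmat \<Rightarrow> bool" where
  "tangent_lift P V A M \<longleftrightarrow>
     A \<in> Sp2 \<and> Sp2_proj A = P \<and>
     (\<exists>B\<in>Sp2_tangent A. frechet_derivative Sp2_proj (at A) B = V \<and> M = maurer_cartan A B)"

text \<open>The almost complex structure for which \<open>s\<^sup>*\<omega>1, s\<^sup>*\<omega>2, s\<^sup>*\<omega>3\<close> are of type (1,0).\<close>

definition J_nk :: "complex^4^4 \<Rightarrow> complex^4^4 \<Rightarrow> complex^4^4" where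
  "J_nk P V = (THE W. \<exists>A M N. tangent_lift P V A M \<and> tangent_lift P W A N \<and>
      \<omega>1 N = \<i> * \<omega>1 M \<and> \<omega>2 N = \<i> * \<omega>2 M \<and> \<omega>3 N = \<i> * \<omega>3 M)"

definition g_hor :: "complex^4^4 \<Rightarrow> complex^4^4 \<Rightarrow> complex^4^4 \<Rightarrow> real" where
  "g_hor P V W = (THE r. \<exists>A M N. tangent_lift P V A M \<and> tangent_lift P W A N \<and>
      r = Re (\<omega>1 M * cnj (\<omega>1 N)) + Re (\<omega>2 M * cnj (\<omega>2 N)))"

definition g_ver :: "complex^4^4 \<Rightarrow> complex^4^4 \<Rightarrow> complex^4^4 \<Rightarrow> real" where
  "g_ver P V W = (THE r. \<exists>A M N. tangent_lift P V A M \<and> tangent_lift P W A N \<and>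
      r = Re (\<omega>3 M * cnj (\<omega>3 N)))"

definition vertical_space :: "complex^4^4 \<Rightarrow> (complex^4^4) set" where
  "vertical_space P = {V. \<exists>A M. tangent_lift P V A M \<and> \<omega>1 M = 0 \<and> \<omega>2 M = 0}"

definition horizontal_space :: "complex^4^4 \<Rightarrow> (complex^4^4) set" where
  "horizontal_space P = {V. \<exists>A M. tangent_lift P V A M \<and> \<omega>3 M = 0}"


section \<open>J-holomorphic curves\<close>

definition curve_deriv ::
  "'a chart \<Rightarrow> ('a \<Rightarrow> complex^4^4) \<Rightarrow> complex \<Rightarrow> complex \<Rightarrow> complex^4^4" where
  "curve_deriv c \<phi> p \<xi> = frechet_derivative (coord_rep c \<phi>) (at p) \<xi>"

definition J_holomorphic_curve ::
  "'a topology \<Rightarrow> 'a chart set \<Rightarrow> ('a \<Rightarrow> complex^4^4) \<Rightarrow> bool" where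
  "J_holomorphic_curve X \<A> \<phi> \<longleftrightarrow>
     \<phi> ` topspace X \<subseteq> CP3 \<and> smooth_fun \<A> \<phi> \<and>
     (\<forall>c\<in>\<A>. \<forall>p\<in>chart_range c. \<forall>\<xi>.
        curve_deriv c \<phi> p (\<i> * \<xi>) = J_nk (coord_rep c \<phi> p) (curve_deriv c \<phi> p \<xi>))"

definition pullback_mc :: "(complex \<Rightarrow> qmat) \<Rightarrow> complex \<Rightarrow> complex \<Rightarrow> qmat" where
  "pullback_mc F p \<xi> = maurer_cartan (F p) (frechet_derivative F (at p) \<xi>)"

text \<open>A local section, near the point with coordinate \<open>p\<close>, of the reduction of \<open>\<phi>\<^sup>*Sp(2)\<close> cut out
  by \<open>\<omega>2 = 0\<close>.\<close>

definition adapted_frame ::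
  "'a chart \<Rightarrow> ('a \<Rightarrow> complex^4^4) \<Rightarrow> complex \<Rightarrow> (complex \<Rightarrow> qmat) \<Rightarrow> bool" where
  "adapted_frame c \<phi> p F \<longleftrightarrow>
     (\<exists>D. open D \<and> p \<in> D \<and> D \<subseteq> chart_range c \<and> smooth_on D F \<and>
        (\<forall>q\<in>D. F q \<in> Sp2 \<and> Sp2_proj (F q) = coord_rep c \<phi> q \<and>
           (\<forall>\<xi>. \<omega>2 (pullback_mc F q \<xi>) = 0)))"

definition transverse_curve :: "'a chart set \<Rightarrow> ('a \<Rightarrow> complex^4^4) \<Rightarrow> bool" where
  "transverse_curve \<A> \<phi> \<longleftrightarrow>
     (\<forall>c\<in>\<A>. \<forall>p\<in>chart_range c.
        \<not> range (curve_deriv c \<phi> p) \<subseteq> horizontal_space (coord_rep c \<phi> p) \<and>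
        \<not> range (curve_deriv c \<phi> p) \<subseteq> vertical_space (coord_rep c \<phi> p) \<and>
        (\<forall>F. adapted_frame c \<phi> p F \<longrightarrow> (\<exists>\<xi>. \<tau>_form (pullback_mc F p \<xi>) \<noteq> 0)))"

definition pullback_g_hor :: "('a \<Rightarrow> complex^4^4) \<Rightarrow> 'a surface_metric" where
  "pullback_g_hor \<phi> c p \<xi> \<eta> =
     g_hor (coord_rep c \<phi> p) (curve_deriv c \<phi> p \<xi>) (curve_deriv c \<phi> p \<eta>)"

definition pullback_g_ver :: "('a \<Rightarrow> complex^4^4) \<Rightarrow> 'a surface_metric" where
  "pullback_g_ver \<phi> c p \<xi> \<eta> =
     g_ver (coord_rep c \<phi> p) (curve_deriv c \<phi> p \<xi>) (curve_deriv c \<phi> p \<eta>)"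

definition alpha_minus :: "'a chart set \<Rightarrow> ('a \<Rightarrow> complex^4^4) \<Rightarrow> 'a \<Rightarrow> real" where
  "alpha_minus \<A> \<phi> x = (THE r. \<forall>c\<in>\<A>. x \<in> fst c \<longrightarrow> (\<forall>\<xi>. \<xi> \<noteq> 0 \<longrightarrow>
      r = sqrt (pullback_g_ver \<phi> c (snd c x) \<xi> \<xi>) / sqrt (pullback_g_hor \<phi> c (snd c x) \<xi> \<xi>)))"

definition alpha_plus :: "'a chart set \<Rightarrow> ('a \<Rightarrow> complex^4^4) \<Rightarrow> 'a \<Rightarrow> real" where
  "alpha_plus \<A> \<phi> x = (THE r. \<forall>c\<in>\<A>. x \<in> fst c \<longrightarrow>
      (\<forall>F. adapted_frame c \<phi> (snd c x) F \<longrightarrow> (\<forall>\<xi>. \<xi> \<noteq> 0 \<longrightarrow>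
         r = cmod (\<tau>_form (pullback_mc F (snd c x) \<xi>)) / cmod (\<omega>1 (pullback_mc F (snd c x) \<xi>)))))"

definition gamma_factor :: "real \<Rightarrow> real \<Rightarrow> real" where
  "gamma_factor a b = (a * b) powr (- 1 / 4)"

text \<open>The metric \<open>\<gamma>\<^sup>-\<^sup>2 g\<^sub>\<H>\<close>.\<close>

definition rescaled_metric :: "'a chart set \<Rightarrow> ('a \<Rightarrow> complex^4^4) \<Rightarrow> 'a surface_metric" where
  "rescaled_metric \<A> \<phi> c p \<xi> \<eta> =
     pullback_g_hor \<phi> c p \<xi> \<eta> /
       (gamma_factor (coord_rep c (alpha_minus \<A> \<phi>) p) (coord_rep c (alpha_plus \<A> \<phi>) p))\<^sup>2"


section \<open>The systems of equations\<close>

definition angle_system ::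
  "'a chart set \<Rightarrow> 'a surface_metric \<Rightarrow> ('a \<Rightarrow> real) \<Rightarrow> ('a \<Rightarrow> real) \<Rightarrow> bool" where
  "angle_system \<A> g a b \<longleftrightarrow> (\<forall>c\<in>\<A>. \<forall>x\<in>fst c.
     laplacian_at g c (\<lambda>y. ln ((a y)\<^sup>2)) x
       = - 4 * (3 * (a x)\<^sup>2 + (b x)\<^sup>2 - 2) * (gamma_factor (a x) (b x))\<^sup>2 \<and>
     laplacian_at g c (\<lambda>y. ln ((b y)\<^sup>2)) x
       = - 4 * (3 * (b x)\<^sup>2 + (a x)\<^sup>2 - 2) * (gamma_factor (a x) (b x))\<^sup>2)"

text \<open>The system satisfied by \<open>\<gamma>\<alpha>\<^sub>-\<close> and \<open>\<gamma>\<alpha>\<^sub>+\<close>.\<close>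

definition rescaled_angle_system ::
  "'a chart set \<Rightarrow> 'a surface_metric \<Rightarrow> ('a \<Rightarrow> real) \<Rightarrow> ('a \<Rightarrow> real) \<Rightarrow> bool" where
  "rescaled_angle_system \<A> g a b \<longleftrightarrow> (\<forall>c\<in>\<A>. \<forall>x\<in>fst c.
     laplacian_at g c (\<lambda>y. ln ((a y)\<^sup>2)) x = - 4 * (2 * (a x)\<^sup>2 - inverse (a x) * inverse (b x)) \<and>
     laplacian_at g c (\<lambda>y. ln ((b y)\<^sup>2)) x = - 4 * (2 * (b x)\<^sup>2 - inverse (a x) * inverse (b x)))"

definition toda_system ::
  "'a chart set \<Rightarrow> 'a surface_metric \<Rightarrow> ('a \<Rightarrow> real) \<Rightarrow> ('a \<Rightarrow> real) \<Rightarrow> bool" where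
  "toda_system \<A> g \<Omega>1 \<Omega>2 \<longleftrightarrow> (\<forall>c\<in>\<A>. \<forall>x\<in>fst c.
     laplacian_at g c \<Omega>1 x = - 4 * sqrt 2 * (exp (\<Omega>1 x) - exp ((\<Omega>2 x - \<Omega>1 x) / 2)) \<and>
     laplacian_at g c \<Omega>2 x = 4 * sqrt 2 * (exp (- \<Omega>2 x) - exp ((\<Omega>2 x - \<Omega>1 x) / 2)))"

text \<open>The change of unknowns \<open>(\<gamma>a)\<^sup>2 = e\<^bsup>\<Omega>\<^sub>1\<^esup>/\<surd>2\<close>, \<open>(\<gamma>b)\<^sup>2 = e\<^bsup>-\<Omega>\<^sub>2\<^esup>/\<surd>2\<close>.\<close>

definition toda_unknowns :: "real \<Rightarrow> real \<Rightarrow> real \<times> real" where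
  "toda_unknowns a b =
     (ln (sqrt 2 * (gamma_factor a b * a)\<^sup>2), - ln (sqrt 2 * (gamma_factor a b * b)\<^sup>2))"

definition smooth_positive :: "'a topology \<Rightarrow> 'a chart set \<Rightarrow> ('a \<Rightarrow> real) \<Rightarrow> bool" where
  "smooth_positive X \<A> f \<longleftrightarrow> smooth_fun \<A> f \<and> (\<forall>x\<in>topspace X. f x > 0)"

end

theory Submission
  imports Defs
begin

text \<open>On a frame with \<open>\<omega>2 = 0\<close> the equation \<open>d\<Omega> + \<Omega> \<and> \<Omega> = 0\<close> gives \<open>\<tau> \<and> \<omega>1 = 0\<close>, so that in a
  holomorphic coordinate \<open>\<omega>1 = a dz\<close>, \<open>\<omega>3 = b dz\<close>, \<open>\<tau> = t dz\<close>, together with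
  \<open>d\<omega>1 = \<i>(\<rho>1 - \<rho>2) \<and> \<omega>1\<close>, \<open>d\<omega>3 = -2\<i>\<rho>1 \<and> \<omega>3\<close>, \<open>d\<tau> = 2\<i>\<rho>2 \<and> \<tau>\<close>.  Such an equation determines
  the Laplacian of the logarithm of the modulus, and inserting \<open>d\<rho>1\<close> and \<open>d\<rho>2\<close> yields
  \<open>\<Delta> log \<bar>a\<bar>\<^sup>2 = 4(\<bar>b\<bar>\<^sup>2 + \<bar>t\<bar>\<^sup>2 - \<bar>a\<bar>\<^sup>2)\<close>, \<open>\<Delta> log \<bar>b\<bar>\<^sup>2 = 4(\<bar>a\<bar>\<^sup>2 - 2\<bar>b\<bar>\<^sup>2)\<close> and
  \<open>\<Delta> log \<bar>t\<bar>\<^sup>2 = 4(\<bar>a\<bar>\<^sup>2 - 2\<bar>t\<bar>\<^sup>2)\<close> for the Laplacian of the coordinate.  The angle functions are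
  \<open>\<bar>b\<bar> / \<bar>a\<bar>\<close> and \<open>\<bar>t\<bar> / \<bar>a\<bar>\<close>, and \<open>g\<^sub>\<H> = \<bar>a\<bar>\<^sup>2 \<bar>dz\<bar>\<^sup>2\<close>; all claims are linear combinations of these
  three equations.\<close>

section \<open>Calculus of smooth functions on open subsets of the plane\<close>

text \<open>The equations live on a frame, but \<open>J_nk\<close>, the two metrics and the angle
  functions are definite descriptions over all lifts, frames and charts. Much of the work is
  therefore independence of choices: two lifts of a point differ by diag(c, q) with c in U(1) and q
  in Sp(1), and two adapted frames differ by a map into U(1) x U(1), under which |\<omega>1|,
  |\<omega>3| and |\<tau>| do not change. Adapted frames exist only locally. They come from
  Gram-Schmidt applied to a lift of the curve and its x-derivative, which can degenerate only where
  the curve is vertical. The constants: for l = |a|^2 the function ln l + (ln \<alpha>_-^2 + ln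
  \<alpha>_+^2) / 4 is harmonic, which fixes the exponent -1/4 of \<gamma>; and the relation
  \<gamma>^4 \<alpha>_- \<alpha>_+ = 1 turns the constant term of the system into the exponential
  coupling of the Toda equations.\<close>

lemma pderiv_dir_cong:
  assumes "open S" "p \<in> S" "\<And>x. x \<in> S \<Longrightarrow> f x = g x"
  shows "pderiv_dir u f p = pderiv_dir u g p"
proof -
  \<comment> \<open>\<open>frechet_derivative\<close> is a choice among all derivatives, so equality
    of the sets of derivatives suffices, even at a point where neither function is
    differentiable.\<close>
  have "(f has_derivative f') (at p) \<longleftrightarrow> (g has_derivative f') (at p)" for f'
    using assms has_derivative_transform_within_open[of f f' p UNIV S g]
      has_derivative_transform_within_open[of g f' p UNIV S f] by auto
  then show ?thesis by (simp add: pderiv_dir_def frechet_derivative_def)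
qed

lemma pderiv_dir_eqI: "(f has_derivative f') (at p) \<Longrightarrow> pderiv_dir u f p = f' u"
  by (simp add: pderiv_dir_def frechet_derivative_at[symmetric])

lemma Ck_on_cong:
  assumes "open S" "\<And>x. x \<in> S \<Longrightarrow> f x = g x" "Ck_on k S f"
  shows "Ck_on k S g"
  using assms(2,3)
proof (induction k arbitrary: f g)
  case 0
  then show ?case by (simp cong: continuous_on_cong)
next
  case (Suc k)
  have "g differentiable_on S"
    unfolding differentiable_on_def
  proof
    fix p assume p: "p \<in> S"
    have "f differentiable (at p within S)" using Suc.prems p by (simp add: differentiable_on_def)
    then show "g differentiable (at p within S)"
      by (rule differentiable_transform_within[OF _ zero_less_one p]) (simp add: Suc.prems)
  qed
  moreover have "Ck_on k S (pderiv_dir u g)" if "Ck_on k S (pderiv_dir u f)" for u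
    by (rule Suc.IH[OF pderiv_dir_cong[OF assms(1)] that]) (auto simp: Suc.prems(1))
  ultimately show ?case using Suc.prems by auto
qed

lemma Ck_on_subset: "Ck_on k S f \<Longrightarrow> T \<subseteq> S \<Longrightarrow> Ck_on k T f"
proof (induction k arbitrary: f)
  case 0
  then show ?case using continuous_on_subset by auto
next
  case (Suc k)
  then show ?case using differentiable_on_subset by auto
qed

lemma Ck_on_SucD: "Ck_on (Suc k) S f \<Longrightarrow> Ck_on k S f"
proof (induction k arbitrary: f)
  case 0
  then show ?case by (simp add: differentiable_imp_continuous_on)
next
  case (Suc k)
  have "Ck_on k S (pderiv_dir 1 f)" "Ck_on k S (pderiv_dir \<i> f)"
    by (rule Suc.IH, use Suc.prems in simp)+
  then show ?case using Suc.prems by simp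
qed

text \<open>Needed because the angle functions are expressed through adapted frames, which exist
  only near each point.\<close>

lemma Ck_on_local:
  assumes "open S" "\<And>p. p \<in> S \<Longrightarrow> \<exists>D. open D \<and> p \<in> D \<and> D \<subseteq> S \<and> Ck_on k D f"
  shows "Ck_on k S f"
  using assms(2)
proof (induction k arbitrary: f)
  case 0
  then show ?case
  proof -
    have "isCont f p" if p: "p \<in> S" for p
    proof -
      from 0[OF p] obtain D where "open D \<and> p \<in> D \<and> D \<subseteq> S \<and> Ck_on 0 D f" ..
      then show ?thesis using continuous_on_eq_continuous_at[of D f] by simp
    qed
    then show ?thesis by (simp add: continuous_at_imp_continuous_on)
  qed
next
  case (Suc k)
  have "f differentiable_on S"
    unfolding differentiable_on_def
  proof
    fix p assume "p \<in> S"
    from Suc.prems[OF this] obtain D where D: "open D \<and> p \<in> D \<and> D \<subseteq> S \<and> Ck_on (Suc k) D f" ..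
    then have "f differentiable_on D" by simp
    then have "f differentiable (at p)" using D differentiable_on_eq_differentiable_at by blast
    then show "f differentiable (at p within S)" by (rule differentiable_at_withinI)
  qed
  note df = this
  have pd: "Ck_on k S (pderiv_dir u f)" if u: "u = 1 \<or> u = \<i>" for u
  proof (rule Suc.IH)
    fix p assume "p \<in> S"
    from Suc.prems[OF this] obtain D where "open D \<and> p \<in> D \<and> D \<subseteq> S \<and> Ck_on (Suc k) D f" ..
    then show "\<exists>D. open D \<and> p \<in> D \<and> D \<subseteq> S \<and> Ck_on k D (pderiv_dir u f)"
      using u by (intro exI[of _ D]) (elim disjE; simp)
  qed
  from pd[of 1] pd[of \<i>] df show ?case by simp
qed

lemma smooth_on_cong:
  "\<lbrakk>open S; \<And>x. x \<in> S \<Longrightarrow> f x = g x; smooth_on S f\<rbrakk> \<Longrightarrow> smooth_on S g"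
  unfolding smooth_on_def using Ck_on_cong by blast

lemma smooth_on_subset: "smooth_on S f \<Longrightarrow> T \<subseteq> S \<Longrightarrow> smooth_on T f"
  unfolding smooth_on_def using Ck_on_subset by blast

lemma smooth_on_local:
  assumes "open S" "\<And>p. p \<in> S \<Longrightarrow> \<exists>D. open D \<and> p \<in> D \<and> D \<subseteq> S \<and> smooth_on D f"
  shows "smooth_on S f"
  unfolding smooth_on_def
proof (intro allI Ck_on_local assms(1))
  fix k p assume "p \<in> S"
  from assms(2)[OF this] obtain D where "open D \<and> p \<in> D \<and> D \<subseteq> S \<and> smooth_on D f" ..
  then show "\<exists>D. open D \<and> p \<in> D \<and> D \<subseteq> S \<and> Ck_on k D f"
    by (intro exI[of _ D]) (simp add: smooth_on_def)
qed

lemma smooth_on_differentiable: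
  assumes "open S" "smooth_on S f" "p \<in> S"
  shows "f differentiable (at p)"
proof -
  have "Ck_on (Suc 0) S f" using assms(2) unfolding smooth_on_def by blast
  then show ?thesis using assms by (simp add: differentiable_on_eq_differentiable_at)
qed

lemma smooth_on_has_derivative:
  assumes "open S" "smooth_on S f" "p \<in> S"
  shows "(f has_derivative (\<lambda>u. pderiv_dir u f p)) (at p)"
  using smooth_on_differentiable[OF assms] by (simp add: pderiv_dir_def frechet_derivative_works)

lemma smooth_on_continuous: "smooth_on S f \<Longrightarrow> continuous_on S f"
  using smooth_on_def Ck_on.simps(1) by blast

lemma pderiv_dir_Re_Im:
  assumes "f differentiable (at p)"
  shows "pderiv_dir u f p = Re u *\<^sub>R pderiv_dir 1 f p + Im u *\<^sub>R pderiv_dir \<i> f p"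
proof -
  have l: "linear (\<lambda>u. pderiv_dir u f p)"
    using linear_frechet_derivative[OF assms] by (simp add: pderiv_dir_def[abs_def])
  have e: "Re u *\<^sub>R 1 + Im u *\<^sub>R \<i> = u" by (simp add: complex_eq_iff)
  show ?thesis
    using linear_add[OF l, of "Re u *\<^sub>R 1" "Im u *\<^sub>R \<i>"]
    by (simp only: e linear_scale[OF l])
qed

section \<open>Closure of finite and infinite differentiability under algebra and elementary
  functions\<close>

lemma Ck_on_const [simp]: "Ck_on k S (\<lambda>p. c)"
proof (induction k arbitrary: c)
  case (Suc k)
  have "pderiv_dir u (\<lambda>p. c) = (\<lambda>p. 0)" for u :: complex by (auto simp: pderiv_dir_def)
  then show ?case using Suc by simp
qed simp

lemma Ck_on_bounded_linear:
  assumes "open S" "bounded_linear T"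
  shows "Ck_on k S f \<Longrightarrow> Ck_on k S (\<lambda>p. T (f p))"
proof (induction k arbitrary: f)
  case 0
  then show ?case using bounded_linear.continuous_on[OF assms(2)] by simp
next
  case (Suc k)
  have d: "f differentiable (at p)" if "p \<in> S" for p
    using Suc.prems that assms(1) by (simp add: differentiable_on_eq_differentiable_at)
  have e: "((\<lambda>p. T (f p)) has_derivative (\<lambda>u. T (pderiv_dir u f p))) (at p)" if "p \<in> S" for p
    using bounded_linear.has_derivative[OF assms(2)] d[OF that]
    by (simp add: pderiv_dir_def[abs_def] frechet_derivative_works)
  have pd: "Ck_on k S (pderiv_dir u (\<lambda>p. T (f p)))" if "u = 1 \<or> u = \<i>" for u
    by (rule Ck_on_cong[OF assms(1) _ Suc.IH[of "pderiv_dir u f"]])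
      (use Suc.prems that pderiv_dir_eqI[OF e] in auto)
  have df: "(\<lambda>p. T (f p)) differentiable_on S"
    using e by (auto simp: differentiable_on_eq_differentiable_at[OF assms(1)] differentiable_def)
  show ?case using df pd[of 1] pd[of \<i>] by simp
qed

lemma Ck_on_add:
  assumes "open S"
  shows "Ck_on k S f \<Longrightarrow> Ck_on k S g \<Longrightarrow> Ck_on k S (\<lambda>p. f p + g p)"
proof (induction k arbitrary: f g)
  case 0
  then show ?case by (auto intro: continuous_intros)
next
  case (Suc k)
  have d: "f differentiable (at p)" "g differentiable (at p)" if "p \<in> S" for p
    using Suc.prems that assms(1) by (simp_all add: differentiable_on_eq_differentiable_at)
  have e: "((\<lambda>p. f p + g p) has_derivative (\<lambda>u. pderiv_dir u f p + pderiv_dir u g p)) (at p)"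
    if "p \<in> S" for p
    using d[OF that] by (auto simp: pderiv_dir_def[abs_def] frechet_derivative_works intro: has_derivative_add)
  have pd: "Ck_on k S (pderiv_dir u (\<lambda>p. f p + g p))" if "u = 1 \<or> u = \<i>" for u
    by (rule Ck_on_cong[OF assms(1) _ Suc.IH[of "pderiv_dir u f" "pderiv_dir u g"]])
      (use Suc.prems that pderiv_dir_eqI[OF e] in auto)
  have df: "(\<lambda>p. f p + g p) differentiable_on S"
    using e by (auto simp: differentiable_on_eq_differentiable_at[OF assms(1)] differentiable_def)
  show ?case using df pd[of 1] pd[of \<i>] by simp
qed

text \<open>Leibniz rule: the derivative is a sum of two terms of the same shape with one factor
  differentiated. Hence the induction runs over all pairs, and \<open>Ck_on_SucD\<close> lowers the
  order of the other factor.\<close>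

lemma Ck_on_bounded_bilinear:
  assumes "open S" "bounded_bilinear B"
  shows "Ck_on k S f \<Longrightarrow> Ck_on k S g \<Longrightarrow> Ck_on k S (\<lambda>p. B (f p) (g p))"
proof (induction k arbitrary: f g)
  case 0
  then show ?case using bounded_bilinear.continuous_on[OF assms(2)] by simp
next
  case (Suc k)
  have d: "f differentiable (at p)" "g differentiable (at p)" if "p \<in> S" for p
    using Suc.prems that assms(1) by (simp_all add: differentiable_on_eq_differentiable_at)
  have e: "((\<lambda>p. B (f p) (g p)) has_derivative
      (\<lambda>u. B (f p) (pderiv_dir u g p) + B (pderiv_dir u f p) (g p))) (at p)"
    if "p \<in> S" for p
    using d[OF that] unfolding pderiv_dir_def[abs_def]
    by (auto simp: frechet_derivative_works intro: bounded_bilinear.FDERIV[OF assms(2)])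
  have pd: "Ck_on k S (pderiv_dir u (\<lambda>p. B (f p) (g p)))" if u: "u = 1 \<or> u = \<i>" for u
  proof (rule Ck_on_cong[OF assms(1) pderiv_dir_eqI[OF e, symmetric]])
    have "Ck_on k S (pderiv_dir u f)" "Ck_on k S (pderiv_dir u g)"
      using u Suc.prems by (elim disjE; simp)+
    then show "Ck_on k S (\<lambda>p. B (f p) (pderiv_dir u g p) + B (pderiv_dir u f p) (g p))"
      by (intro Ck_on_add assms(1) Suc.IH Suc.prems[THEN Ck_on_SucD])
  qed
  have df: "(\<lambda>p. B (f p) (g p)) differentiable_on S"
    using e by (auto simp: differentiable_on_eq_differentiable_at[OF assms(1)] differentiable_def)
  show ?case using df pd[of 1] pd[of \<i>] by simp
qed

text \<open>Only order \<open>k\<close> is required of \<open>h' \<circ> f\<close>; since \<open>h'\<close> is expressed through \<open>h\<close> for \<open>exp\<close> and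
  \<open>inverse\<close>, and through \<open>inverse\<close> for \<open>ln\<close>, these follow by induction on the order.\<close>

lemma Ck_on_SucI:
  fixes f :: "complex \<Rightarrow> real"
  assumes "open S" "Ck_on (Suc k) S f" "Ck_on k S (\<lambda>p. h' (f p))"
    "\<And>p. p \<in> S \<Longrightarrow> (h has_real_derivative h' (f p)) (at (f p))"
  shows "Ck_on (Suc k) S (\<lambda>p. h (f p))"
proof -
  have d: "(f has_derivative (\<lambda>u. pderiv_dir u f p)) (at p)" if "p \<in> S" for p
    using assms that unfolding pderiv_dir_def
    by (simp add: differentiable_on_eq_differentiable_at frechet_derivative_works[symmetric])
  have e: "((\<lambda>p. h (f p)) has_derivative (\<lambda>u. h' (f p) * pderiv_dir u f p)) (at p)" if "p \<in> S" for p
    using has_derivative_compose[OF d[OF that], of h "\<lambda>x. h' (f p) * x"] assms(4)[OF that]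
    by (simp add: has_field_derivative_def)
  have pd: "Ck_on k S (pderiv_dir u (\<lambda>p. h (f p)))" if "u = 1 \<or> u = \<i>" for u
  proof (rule Ck_on_cong[OF assms(1) pderiv_dir_eqI[OF e, symmetric]])
    have "Ck_on k S (pderiv_dir u f)" using that assms(2) by (elim disjE) simp_all
    then show "Ck_on k S (\<lambda>p. h' (f p) * pderiv_dir u f p)"
      by (rule Ck_on_bounded_bilinear[OF assms(1) bounded_bilinear_mult assms(3)])
  qed
  have df: "(\<lambda>p. h (f p)) differentiable_on S"
    using e by (auto simp: differentiable_on_eq_differentiable_at[OF assms(1)] differentiable_def)
  show ?thesis using df pd[of 1] pd[of \<i>] by simp
qed

lemma Ck_on_exp:
  fixes f :: "complex \<Rightarrow> real"
  assumes "open S"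
  shows "Ck_on k S f \<Longrightarrow> Ck_on k S (\<lambda>p. exp (f p))"
proof (induction k)
  case 0
  then show ?case by (auto intro: continuous_intros)
next
  case (Suc k)
  show ?case
    by (rule Ck_on_SucI[OF assms Suc.prems Suc.IH[OF Ck_on_SucD[OF Suc.prems]]]) (rule DERIV_exp)
qed

lemma Ck_on_inverse:
  fixes f :: "complex \<Rightarrow> real"
  assumes "open S" "\<And>p. p \<in> S \<Longrightarrow> f p \<noteq> 0"
  shows "Ck_on k S f \<Longrightarrow> Ck_on k S (\<lambda>p. inverse (f p))"
proof (induction k)
  case 0
  then show ?case using assms by (auto intro: continuous_intros)
next
  case (Suc k)
  have *: "Ck_on k S (\<lambda>p. inverse (f p))" by (rule Suc.IH[OF Ck_on_SucD[OF Suc.prems]])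
  have **: "Ck_on k S (\<lambda>p. - (inverse (f p) * inverse (f p)))"
    by (intro Ck_on_bounded_linear[OF assms(1) bounded_linear_minus[OF bounded_linear_ident]]
        Ck_on_bounded_bilinear[OF assms(1) bounded_bilinear_mult] *)
  show ?case
  proof (rule Ck_on_SucI[OF assms(1) Suc.prems **])
    show "(inverse has_real_derivative - (inverse (f p) * inverse (f p))) (at (f p))" if "p \<in> S" for p
      using DERIV_inverse[OF assms(2)[OF that], of UNIV] by simp
  qed
qed

lemma Ck_on_ln:
  fixes f :: "complex \<Rightarrow> real"
  assumes "open S" "\<And>p. p \<in> S \<Longrightarrow> f p > 0" "Ck_on k S f"
  shows "Ck_on k S (\<lambda>p. ln (f p))"
proof (cases k)
  case 0
  then show ?thesis using assms by (force intro!: continuous_intros)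
next
  case (Suc j)
  have *: "Ck_on j S (\<lambda>p. inverse (f p))"
  proof (rule Ck_on_inverse[OF assms(1)])
    show "f p \<noteq> 0" if "p \<in> S" for p using assms(2)[OF that] by simp
    show "Ck_on j S f" using Ck_on_SucD assms(3) Suc by blast
  qed
  show ?thesis unfolding Suc
    by (rule Ck_on_SucI[OF assms(1) assms(3)[unfolded Suc] *]) (use assms(2) in \<open>simp add: DERIV_ln\<close>)
qed

lemma smooth_on_const [simp]: "smooth_on S (\<lambda>p. c)"
  by (simp add: smooth_on_def)

lemma smooth_on_linear:
  fixes T :: "'b::euclidean_space \<Rightarrow> 'c::real_normed_vector"
  shows "open S \<Longrightarrow> linear T \<Longrightarrow> smooth_on S f \<Longrightarrow> smooth_on S (\<lambda>p. T (f p))"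
  by (simp add: smooth_on_def Ck_on_bounded_linear linear_conv_bounded_linear)

lemma smooth_on_bilinear:
  fixes B :: "'b::euclidean_space \<Rightarrow> 'c::euclidean_space \<Rightarrow> 'd::real_normed_vector"
  shows "open S \<Longrightarrow> bilinear B \<Longrightarrow> smooth_on S f \<Longrightarrow> smooth_on S g \<Longrightarrow> smooth_on S (\<lambda>p. B (f p) (g p))"
  by (simp add: smooth_on_def Ck_on_bounded_bilinear bilinear_conv_bounded_bilinear)

lemma smooth_on_add:
  "open S \<Longrightarrow> smooth_on S f \<Longrightarrow> smooth_on S g \<Longrightarrow> smooth_on S (\<lambda>p. f p + g p)"
  by (simp add: smooth_on_def Ck_on_add)

lemma smooth_on_mult:
  fixes f g :: "complex \<Rightarrow> 'b::real_normed_algebra"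
  shows "open S \<Longrightarrow> smooth_on S f \<Longrightarrow> smooth_on S g \<Longrightarrow> smooth_on S (\<lambda>p. f p * g p)"
  by (simp add: smooth_on_def Ck_on_bounded_bilinear bounded_bilinear_mult)

lemma smooth_on_scaleR:
  "open S \<Longrightarrow> smooth_on S f \<Longrightarrow> smooth_on S g \<Longrightarrow> smooth_on S (\<lambda>p. f p *\<^sub>R g p)"
  by (simp add: smooth_on_def Ck_on_bounded_bilinear bounded_bilinear_scaleR)

lemma smooth_on_minus: "open S \<Longrightarrow> smooth_on S f \<Longrightarrow> smooth_on S (\<lambda>p. - f p)"
  by (simp add: smooth_on_def Ck_on_bounded_linear bounded_linear_minus bounded_linear_ident)

lemma smooth_on_diff:
  "open S \<Longrightarrow> smooth_on S f \<Longrightarrow> smooth_on S g \<Longrightarrow> smooth_on S (\<lambda>p. f p - g p)"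
  using smooth_on_add[of S f "\<lambda>p. - g p"] smooth_on_minus by auto

lemma smooth_on_exp:
  fixes f :: "complex \<Rightarrow> real"
  shows "open S \<Longrightarrow> smooth_on S f \<Longrightarrow> smooth_on S (\<lambda>p. exp (f p))"
  by (simp add: smooth_on_def Ck_on_exp)

lemma smooth_on_inverse:
  fixes f :: "complex \<Rightarrow> real"
  shows "open S \<Longrightarrow> (\<And>p. p \<in> S \<Longrightarrow> f p \<noteq> 0) \<Longrightarrow> smooth_on S f \<Longrightarrow> smooth_on S (\<lambda>p. inverse (f p))"
  by (simp add: smooth_on_def Ck_on_inverse)

lemma smooth_on_ln:
  fixes f :: "complex \<Rightarrow> real"
  shows "open S \<Longrightarrow> (\<And>p. p \<in> S \<Longrightarrow> f p > 0) \<Longrightarrow> smooth_on S f \<Longrightarrow> smooth_on S (\<lambda>p. ln (f p))"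
  by (simp add: smooth_on_def Ck_on_ln)

lemma smooth_on_sqrt:
  fixes f :: "complex \<Rightarrow> real"
  assumes "open S" "\<And>p. p \<in> S \<Longrightarrow> f p > 0" "smooth_on S f"
  shows "smooth_on S (\<lambda>p. sqrt (f p))"
proof (rule smooth_on_cong[OF assms(1)])
  show "smooth_on S (\<lambda>p. exp (1/2 * ln (f p)))"
    by (intro smooth_on_exp smooth_on_mult smooth_on_ln smooth_on_const assms)
  show "exp (1/2 * ln (f p)) = sqrt (f p)" if "p \<in> S" for p
    using assms(2)[OF that] by (simp add: powr_half_sqrt[symmetric] powr_def)
qed

lemma smooth_on_pderiv_dir:
  assumes "open S" "smooth_on S f"
  shows "smooth_on S (pderiv_dir u f)"
proof (rule smooth_on_cong[OF assms(1)])
  have *: "Ck_on k S (pderiv_dir 1 f)" "Ck_on k S (pderiv_dir \<i> f)" for k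
    using assms(2) unfolding smooth_on_def by (metis Ck_on.simps(2))+
  then show "smooth_on S (\<lambda>p. Re u *\<^sub>R pderiv_dir 1 f p + Im u *\<^sub>R pderiv_dir \<i> f p)"
    by (intro smooth_on_add smooth_on_scaleR smooth_on_const assms) (auto simp: smooth_on_def)
  show "Re u *\<^sub>R pderiv_dir 1 f p + Im u *\<^sub>R pderiv_dir \<i> f p = pderiv_dir u f p" if "p \<in> S" for p
    using pderiv_dir_Re_Im[OF smooth_on_differentiable[OF assms that], of u] by simp
qed

lemma pderiv_dir_linear:
  fixes T :: "'b::euclidean_space \<Rightarrow> 'c::real_normed_vector"
  assumes "linear T" "f differentiable (at p)"
  shows "pderiv_dir u (\<lambda>q. T (f q)) p = T (pderiv_dir u f p)"
  using bounded_linear.has_derivative[of T f "frechet_derivative f (at p)" "at p"] assms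
  by (intro pderiv_dir_eqI) (simp add: pderiv_dir_def linear_conv_bounded_linear frechet_derivative_works)

lemma pderiv_dir_bilinear:
  fixes B :: "'b::euclidean_space \<Rightarrow> 'c::euclidean_space \<Rightarrow> 'd::real_normed_vector"
  assumes "bilinear B" "f differentiable (at p)" "g differentiable (at p)"
  shows "pderiv_dir u (\<lambda>q. B (f q) (g q)) p = B (f p) (pderiv_dir u g p) + B (pderiv_dir u f p) (g p)"
  using bounded_bilinear.FDERIV[of B f "frechet_derivative f (at p)" p UNIV g "frechet_derivative g (at p)"] assms
  by (intro pderiv_dir_eqI) (simp add: pderiv_dir_def bilinear_conv_bounded_bilinear frechet_derivative_works)

lemma pderiv_dir_const [simp]: "pderiv_dir u (\<lambda>q. c) p = 0"
  by (simp add: pderiv_dir_def)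

lemma pderiv_dir_cmult:
  fixes f :: "complex \<Rightarrow> 'b::real_normed_algebra"
  assumes "f differentiable (at p)"
  shows "pderiv_dir u (\<lambda>q. c * f q) p = c * pderiv_dir u f p"
  using assms by (intro pderiv_dir_eqI) (auto simp: pderiv_dir_def frechet_derivative_works intro: has_derivative_mult_right)

text \<open>The second difference over the parallelogram with sides h u and h v is symmetric in u
  and v, so two estimates of this kind, with the roles exchanged, compare the two mixed
  derivatives.\<close>

lemma second_pderiv_mean_value:
  fixes f :: "complex \<Rightarrow> real"
  assumes S: "open S" "p \<in> S" and f: "\<And>q. q \<in> S \<Longrightarrow> f differentiable (at q)"
    and fu: "pderiv_dir u f differentiable (at p)" and uv: "norm u = 1" "norm v = 1" and "e > 0"
  shows "\<exists>d>0. \<forall>h. 0 < h \<and> h < d \<longrightarrow>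
    \<bar>f (p + h *\<^sub>R u + h *\<^sub>R v) - f (p + h *\<^sub>R u) - f (p + h *\<^sub>R v) + f p
      - h\<^sup>2 * pderiv_dir v (pderiv_dir u f) p\<bar> \<le> 3 * e * h\<^sup>2"
proof -
  define L where "L = (\<lambda>w. pderiv_dir w (pderiv_dir u f) p)"
  have hL: "(pderiv_dir u f has_derivative L) (at p)"
    using fu by (simp add: L_def pderiv_dir_def[abs_def] frechet_derivative_works)
  obtain d1 where d1: "d1 > 0" "\<And>y. norm (y - p) < d1 \<Longrightarrow>
      \<bar>pderiv_dir u f y - pderiv_dir u f p - L (y - p)\<bar> \<le> e * norm (y - p)"
    using hL \<open>e > 0\<close> unfolding has_derivative_at_alt by auto
  obtain d2 where d2: "d2 > 0" "ball p d2 \<subseteq> S"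
    using S open_contains_ball by blast
  \<comment> \<open>Halved because the points used below lie at distance up to 2 h from p.\<close>
  define d where "d = min d1 d2 / 2"
  have lL: "linear L" using hL by (rule has_derivative_linear)
  show ?thesis
  proof (intro exI conjI allI impI)
    show "d > 0" using d1(1) d2(1) by (simp add: d_def)
    fix h assume h: "0 < h \<and> h < d"
    \<comment> \<open>The second difference is \<open>\<psi> h - \<psi> 0\<close>. The mean value
      theorem in the direction u turns it into h times a difference of two values of
      \<open>pderiv_dir u f\<close>, each of which is then expanded to first order at p.\<close>
    define \<psi> where "\<psi> = (\<lambda>s. f (p + s *\<^sub>R u + h *\<^sub>R v) - f (p + s *\<^sub>R u))"
    define \<psi>' where "\<psi>' = (\<lambda>s. pderiv_dir u f (p + s *\<^sub>R u + h *\<^sub>R v) - pderiv_dir u f (p + s *\<^sub>R u))"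
    have n: "norm (s *\<^sub>R u + h *\<^sub>R v) \<le> 2 * h" "norm (s *\<^sub>R u) \<le> h" if "0 \<le> s" "s \<le> h" for s
      using that uv h norm_triangle_ineq[of "s *\<^sub>R u" "h *\<^sub>R v"] by auto
    have m: "p + s *\<^sub>R u + h *\<^sub>R v \<in> S" "p + s *\<^sub>R u \<in> S" if "0 \<le> s" "s \<le> h" for s
    proof -
      have "2 * h < d2" using h by (simp add: d_def)
      then have "norm (s *\<^sub>R u + h *\<^sub>R v) < d2" "norm (s *\<^sub>R u) < d2"
        using n[OF that] h by linarith+
      then have "dist p (p + (s *\<^sub>R u + h *\<^sub>R v)) < d2" "dist p (p + s *\<^sub>R u) < d2"
        unfolding dist_norm norm_minus_commute[of p] by (simp_all del: norm_scaleR)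
      then show "p + s *\<^sub>R u + h *\<^sub>R v \<in> S" "p + s *\<^sub>R u \<in> S"
        using d2(2) by (auto simp: add.assoc)
    qed
    have D: "(\<psi> has_real_derivative \<psi>' s) (at s)" if s: "0 \<le> s" "s \<le> h" for s
    proof -
      have c: "((\<lambda>s. f (p + s *\<^sub>R u + w)) has_real_derivative pderiv_dir u f (p + s *\<^sub>R u + w)) (at s)"
        if w: "p + s *\<^sub>R u + w \<in> S" for w
      proof -
        have "((\<lambda>s. p + s *\<^sub>R u + w) has_derivative (\<lambda>t. t *\<^sub>R u)) (at s)"
          by (auto intro!: derivative_eq_intros)
        from has_derivative_compose[OF this, of f "frechet_derivative f (at (p + s *\<^sub>R u + w))"] f[OF w]
        have "((\<lambda>s. f (p + s *\<^sub>R u + w)) has_derivative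
            (\<lambda>t. frechet_derivative f (at (p + s *\<^sub>R u + w)) (t *\<^sub>R u))) (at s)"
          by (simp add: frechet_derivative_works)
        moreover have "(\<lambda>t. frechet_derivative f (at (p + s *\<^sub>R u + w)) (t *\<^sub>R u))
            = (*) (pderiv_dir u f (p + s *\<^sub>R u + w))"
          using linear_scale[OF linear_frechet_derivative[OF f[OF w]]] by (auto simp: pderiv_dir_def)
        ultimately show ?thesis by (simp add: has_field_derivative_def)
      qed
      show ?thesis
        unfolding \<psi>_def \<psi>'_def using c[of "h *\<^sub>R v"] c[of 0] m[OF s] by (auto intro: DERIV_diff)
    qed
    obtain s where s: "0 < s" "s < h" "\<psi> h - \<psi> 0 = (h - 0) * \<psi>' s"
      using MVT2[of 0 h \<psi> \<psi>'] h D by auto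
    have n': "norm (s *\<^sub>R u + h *\<^sub>R v) \<le> 2 * h" "norm (s *\<^sub>R u) \<le> h" "2 * h < d1"
      using n[of s] s h by (simp_all add: d_def)
    have a: "\<bar>pderiv_dir u f (p + s *\<^sub>R u + h *\<^sub>R v) - pderiv_dir u f p - L (s *\<^sub>R u + h *\<^sub>R v)\<bar> \<le> e * (2 * h)"
    proof -
      have "norm ((p + s *\<^sub>R u + h *\<^sub>R v) - p) < d1" using n' by (simp add: add.assoc)
      from d1(2)[OF this] have "\<bar>pderiv_dir u f (p + s *\<^sub>R u + h *\<^sub>R v) - pderiv_dir u f p
          - L (s *\<^sub>R u + h *\<^sub>R v)\<bar> \<le> e * norm (s *\<^sub>R u + h *\<^sub>R v)"
        by (simp add: add.assoc)
      also have "\<dots> \<le> e * (2 * h)" using n' \<open>e > 0\<close> by (intro mult_left_mono) auto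
      finally show ?thesis .
    qed
    have b: "\<bar>pderiv_dir u f (p + s *\<^sub>R u) - pderiv_dir u f p - L (s *\<^sub>R u)\<bar> \<le> e * h"
    proof -
      have "norm ((p + s *\<^sub>R u) - p) < d1" using n' h by (simp del: norm_scaleR)
      from d1(2)[OF this] have "\<bar>pderiv_dir u f (p + s *\<^sub>R u) - pderiv_dir u f p - L (s *\<^sub>R u)\<bar>
          \<le> e * norm (s *\<^sub>R u)"
        by (simp del: norm_scaleR)
      also have "\<dots> \<le> e * h" using n' \<open>e > 0\<close> by (intro mult_left_mono) auto
      finally show ?thesis .
    qed
    have "L (s *\<^sub>R u + h *\<^sub>R v) = L (s *\<^sub>R u) + h * L v"
      using lL by (simp add: linear_add linear_scale)
    \<comment> \<open>The first order errors 2 e h and e h of the two expansions add up.\<close>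
    then have "\<bar>\<psi>' s - h * L v\<bar> \<le> 3 * e * h"
      using a b unfolding \<psi>'_def by linarith
    then have "h * \<bar>\<psi>' s - h * L v\<bar> \<le> h * (3 * e * h)"
      using h by (intro mult_left_mono) auto
    moreover have "h * \<bar>\<psi>' s - h * L v\<bar> = \<bar>\<psi> h - \<psi> 0 - h\<^sup>2 * L v\<bar>"
    proof -
      have "h * \<bar>\<psi>' s - h * L v\<bar> = \<bar>h * (\<psi>' s - h * L v)\<bar>" using h by (simp add: abs_mult)
      then show ?thesis by (simp add: s(3) right_diff_distrib power2_eq_square mult.assoc)
    qed
    ultimately show "\<bar>f (p + h *\<^sub>R u + h *\<^sub>R v) - f (p + h *\<^sub>R u) - f (p + h *\<^sub>R v) + f p
      - h\<^sup>2 * pderiv_dir v (pderiv_dir u f) p\<bar> \<le> 3 * e * h\<^sup>2"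
      by (simp add: \<psi>_def L_def power2_eq_square algebra_simps)
  qed
qed

lemma pderiv_dir_commute_real:
  fixes f :: "complex \<Rightarrow> real"
  assumes S: "open S" "p \<in> S" and f: "\<And>q. q \<in> S \<Longrightarrow> f differentiable (at q)"
    and "pderiv_dir u f differentiable (at p)" "pderiv_dir v f differentiable (at p)"
    and "norm u = 1" "norm v = 1"
  shows "pderiv_dir u (pderiv_dir v f) p = pderiv_dir v (pderiv_dir u f) p"
proof (rule ccontr)
  assume ne: "\<not> ?thesis"
  \<comment> \<open>The two estimates together allow an error of 6 e h^2; the divisor 7 makes the
    supposed difference exceed it.\<close>
  define e where "e = \<bar>pderiv_dir u (pderiv_dir v f) p - pderiv_dir v (pderiv_dir u f) p\<bar> / 7"
  have e: "e > 0" using ne by (simp add: e_def)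
  obtain d1 where d1: "d1 > 0" "\<And>h. 0 < h \<and> h < d1 \<Longrightarrow>
    \<bar>f (p + h *\<^sub>R u + h *\<^sub>R v) - f (p + h *\<^sub>R u) - f (p + h *\<^sub>R v) + f p
      - h\<^sup>2 * pderiv_dir v (pderiv_dir u f) p\<bar> \<le> 3 * e * h\<^sup>2"
    using second_pderiv_mean_value[OF S f assms(4) assms(6,7) e] by blast
  obtain d2 where d2: "d2 > 0" "\<And>h. 0 < h \<and> h < d2 \<Longrightarrow>
    \<bar>f (p + h *\<^sub>R v + h *\<^sub>R u) - f (p + h *\<^sub>R v) - f (p + h *\<^sub>R u) + f p
      - h\<^sup>2 * pderiv_dir u (pderiv_dir v f) p\<bar> \<le> 3 * e * h\<^sup>2"
    using second_pderiv_mean_value[OF S f assms(5) assms(7,6) e] by blast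
  define h where "h = min d1 d2 / 2"
  have h: "0 < h" "h < d1" "h < d2" using d1 d2 by (auto simp: h_def)
  have "\<bar>h\<^sup>2 * pderiv_dir u (pderiv_dir v f) p - h\<^sup>2 * pderiv_dir v (pderiv_dir u f) p\<bar> \<le> 6 * e * h\<^sup>2"
    using d1(2)[of h] d2(2)[of h] h by (simp add: add.commute add.left_commute)
  moreover have "\<bar>h\<^sup>2 * pderiv_dir u (pderiv_dir v f) p - h\<^sup>2 * pderiv_dir v (pderiv_dir u f) p\<bar> = h\<^sup>2 * (7 * e)"
    by (simp add: e_def abs_mult flip: right_diff_distrib)
  ultimately show False using h e by simp
qed

text \<open>The mean value argument is for real functions, so it is applied to each component
  \<open>f q \<bullet> b\<close>.\<close>

lemma smooth_on_pderiv_dir_commute: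
  fixes f :: "complex \<Rightarrow> 'b::euclidean_space"
  assumes S: "open S" "p \<in> S" and f: "smooth_on S f"
  shows "pderiv_dir 1 (pderiv_dir \<i> f) p = pderiv_dir \<i> (pderiv_dir 1 f) p"
proof (rule euclidean_eqI)
  fix b :: 'b
  define g where "g = (\<lambda>q. f q \<bullet> b)"
  have lin: "linear (\<lambda>x. x \<bullet> b)" by (simp add: bounded_linear.linear bounded_linear_inner_left)
  have g: "smooth_on S g" unfolding g_def by (rule smooth_on_linear[OF S(1) lin f])
  have e: "pderiv_dir u g q = pderiv_dir u f q \<bullet> b" if "q \<in> S" for u q
    unfolding g_def using pderiv_dir_linear[OF lin smooth_on_differentiable[OF S(1) f that]] .
  have e2: "pderiv_dir v (pderiv_dir u g) p = pderiv_dir v (pderiv_dir u f) p \<bullet> b" for u v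
  proof -
    have "pderiv_dir v (pderiv_dir u g) p = pderiv_dir v (\<lambda>q. pderiv_dir u f q \<bullet> b) p"
      by (rule pderiv_dir_cong[OF S e])
    also have "\<dots> = pderiv_dir v (pderiv_dir u f) p \<bullet> b"
      by (rule pderiv_dir_linear[OF lin smooth_on_differentiable[OF S(1) smooth_on_pderiv_dir[OF S(1) f] S(2)]])
    finally show ?thesis .
  qed
  show "pderiv_dir 1 (pderiv_dir \<i> f) p \<bullet> b = pderiv_dir \<i> (pderiv_dir 1 f) p \<bullet> b"
    unfolding e2[symmetric]
    by (rule pderiv_dir_commute_real[OF S]) 
      (use smooth_on_differentiable[OF S(1)] g S smooth_on_pderiv_dir[OF S(1) g] in auto)
qed

section \<open>Conformal metrics on open subsets of the plane\<close>

definition plane_lap :: "(complex \<Rightarrow> real) \<Rightarrow> complex \<Rightarrow> real" where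
  "plane_lap f p = pderiv_dir 1 (pderiv_dir 1 f) p + pderiv_dir \<i> (pderiv_dir \<i> f) p"

text \<open>\<open>Re (u * cnj v)\<close> is the Euclidean inner product. The factor l scales the
  metric itself, not lengths, so that it can be the squared modulus of the coefficient of a
  (1,0)-form.\<close>

definition conformal_on :: "complex set \<Rightarrow> (complex \<Rightarrow> real) \<Rightarrow> plane_metric \<Rightarrow> bool" where
  "conformal_on S l g \<longleftrightarrow> smooth_on S l \<and> (\<forall>p\<in>S. l p > 0 \<and> (\<forall>u v. g p u v = l p * Re (u * cnj v)))"

lemma pderiv_dir2_cong:
  assumes "open S" "p \<in> S" "\<And>x. x \<in> S \<Longrightarrow> f x = g x"
  shows "pderiv_dir v (pderiv_dir u f) p = pderiv_dir v (pderiv_dir u g) p"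
  by (rule pderiv_dir_cong[OF assms(1,2)]) (rule pderiv_dir_cong[OF assms(1) _ assms(3)])

lemma plane_lap_cong:
  assumes "open S" "p \<in> S" "\<And>x. x \<in> S \<Longrightarrow> f x = g x"
  shows "plane_lap f p = plane_lap g p"
  by (simp only: plane_lap_def pderiv_dir2_cong[OF assms])

lemma plane_lap_lincomb:
  assumes S: "open S" "p \<in> S" and f: "smooth_on S f" and g: "smooth_on S g"
  shows "plane_lap (\<lambda>q. k + c * f q + d * g q) p = c * plane_lap f p + d * plane_lap g p"
proof -
  have lc: "pderiv_dir u (\<lambda>q. k' + c * f' q + d * g' q) q = c * pderiv_dir u f' q + d * pderiv_dir u g' q"
    if "q \<in> S" "smooth_on S f'" "smooth_on S g'" for u q k' and f' g' :: "complex \<Rightarrow> real"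
  proof -
    have "(f' has_derivative (\<lambda>u. pderiv_dir u f' q)) (at q)"
      "(g' has_derivative (\<lambda>u. pderiv_dir u g' q)) (at q)"
      using that S(1) smooth_on_has_derivative by blast+
    then have "((\<lambda>q. k' + c * f' q + d * g' q) has_derivative
        (\<lambda>u. c * pderiv_dir u f' q + d * pderiv_dir u g' q)) (at q)"
      by (auto intro!: derivative_eq_intros)
    then show ?thesis by (rule pderiv_dir_eqI)
  qed
  have "pderiv_dir u (pderiv_dir u (\<lambda>q. k + c * f q + d * g q)) p
      = c * pderiv_dir u (pderiv_dir u f) p + d * pderiv_dir u (pderiv_dir u g) p" for u
  proof -
    have "pderiv_dir u (pderiv_dir u (\<lambda>q. k + c * f q + d * g q)) p
        = pderiv_dir u (\<lambda>q. 0 + c * pderiv_dir u f q + d * pderiv_dir u g q) p"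
      by (rule pderiv_dir_cong[OF S]) (simp add: lc[OF _ f g])
    also have "\<dots> = c * pderiv_dir u (pderiv_dir u f) p + d * pderiv_dir u (pderiv_dir u g) p"
      by (rule lc[OF S(2)]) (simp_all add: smooth_on_pderiv_dir S(1) f g)
    finally show ?thesis .
  qed
  then show ?thesis by (simp add: plane_lap_def algebra_simps)
qed

lemma pderiv_dir_ln:
  fixes l :: "complex \<Rightarrow> real"
  assumes "open S" "p \<in> S" "smooth_on S l" "l p > 0"
  shows "pderiv_dir u (\<lambda>q. ln (l q)) p = pderiv_dir u l p / l p"
proof -
  have "(l has_derivative (\<lambda>u. pderiv_dir u l p)) (at p)"
    by (rule smooth_on_has_derivative[OF assms(1,3,2)])
  from DERIV_compose_FDERIV[OF DERIV_ln_divide[OF assms(4)] this]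
  have "((\<lambda>q. ln (l q)) has_derivative (\<lambda>u. pderiv_dir u l p / l p)) (at p)" by simp
  then show ?thesis by (rule pderiv_dir_eqI)
qed

lemma plane_lap_ln:
  assumes S: "open S" "p \<in> S" and l: "smooth_on S l" "\<And>q. q \<in> S \<Longrightarrow> l q > 0"
  shows "plane_lap (\<lambda>q. ln (l q)) p
    = plane_lap l p / l p - ((pderiv_dir 1 l p)\<^sup>2 + (pderiv_dir \<i> l p)\<^sup>2) / (l p)\<^sup>2"
proof -
  have "pderiv_dir u (pderiv_dir u (\<lambda>q. ln (l q))) p
    = pderiv_dir u (pderiv_dir u l) p / l p - (pderiv_dir u l p)\<^sup>2 / (l p)\<^sup>2" for u
  proof -
    have d: "(l has_derivative (\<lambda>v. pderiv_dir v l p)) (at p)"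
      "(pderiv_dir u l has_derivative (\<lambda>v. pderiv_dir v (pderiv_dir u l) p)) (at p)"
      using smooth_on_has_derivative S l smooth_on_pderiv_dir by blast+
    have "pderiv_dir u (pderiv_dir u (\<lambda>q. ln (l q))) p = pderiv_dir u (\<lambda>q. pderiv_dir u l q / l q) p"
      by (rule pderiv_dir_cong[OF S]) (simp add: pderiv_dir_ln[OF S(1) _ l(1)] l(2))
    also have "((\<lambda>q. pderiv_dir u l q / l q) has_derivative
      (\<lambda>v. pderiv_dir v (pderiv_dir u l) p / l p - pderiv_dir v l p * pderiv_dir u l p / (l p)\<^sup>2)) (at p)"
      using d l(2)[OF S(2)]
      by (auto intro!: derivative_eq_intros simp: field_simps power2_eq_square)
    from pderiv_dir_eqI[OF this] have "pderiv_dir u (\<lambda>q. pderiv_dir u l q / l q) p =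
      pderiv_dir u (pderiv_dir u l) p / l p - (pderiv_dir u l p)\<^sup>2 / (l p)\<^sup>2"
      by (simp add: power2_eq_square)
    finally show ?thesis .
  qed
  then show ?thesis by (simp add: plane_lap_def add_divide_distrib)
qed

lemma conformal_on_metric_det:
  assumes "conformal_on S l g" "p \<in> S"
  shows "metric_det g p = (l p)\<^sup>2" "area_density g p = l p"
    "metric_inv g p a b = Re (a * cnj b) / l p"
proof -
  have e: "g p u v = l p * Re (u * cnj v)" and pos: "l p > 0" for u v
    using assms by (auto simp: conformal_on_def)
  show det: "metric_det g p = (l p)\<^sup>2" by (simp add: metric_det_def e power2_eq_square)
  then show "area_density g p = l p" using pos by (simp add: area_density_def)
  show "metric_inv g p a b = Re (a * cnj b) / l p"
    using pos by (simp add: metric_inv_def det e power2_eq_square field_simps)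
qed

text \<open>In dimension two the area density times the inverse metric is the identity matrix for
  every conformal factor, so l enters only through the final division.\<close>

lemma laplacian_conformal:
  assumes S: "open S" "p \<in> S" and g: "conformal_on S l g"
  shows "laplacian g f p = plane_lap f p / l p"
proof -
  have e: "(\<Sum>b\<in>Basis. area_density g q * metric_inv g q a b * pderiv_dir b f q) = pderiv_dir a f q"
    if "q \<in> S" "a \<in> Basis" for q a
  proof -
    have "l q \<noteq> 0" using g that(1) by (auto simp: conformal_on_def)
    then show ?thesis
      using that(2) by (auto simp: conformal_on_metric_det[OF g that(1)] Basis_complex_def)
  qed
  have "pderiv_dir a (\<lambda>q. \<Sum>b\<in>Basis. area_density g q * metric_inv g q a b * pderiv_dir b f q) p
      = pderiv_dir a (pderiv_dir a f) p" if "a \<in> Basis" for a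
    by (rule pderiv_dir_cong[OF S e[OF _ that]])
  then show ?thesis
    by (simp add: laplacian_def plane_lap_def conformal_on_metric_det[OF g S(2)] Basis_complex_def)
qed

text \<open>The quadratic Christoffel terms contribute |grad l|^2 / (2 l), which is exactly the
  gradient term by which the Laplacian of ln l differs from that of l, up to the factor
  -l/2.\<close>

lemma gauss_curvature_conformal:
  assumes S: "open S" "p \<in> S" and g: "conformal_on S l g"
  shows "gauss_curvature g p = - plane_lap (\<lambda>q. ln (l q)) p / (2 * l p)"
proof -
  have l: "smooth_on S l" "\<And>q. q \<in> S \<Longrightarrow> l q > 0" using g by (auto simp: conformal_on_def)
  have e: "g q 1 1 = l q" "g q \<i> \<i> = l q" "g q 1 \<i> = 0" "g q \<i> 1 = 0" if "q \<in> S" for q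
    using g that by (auto simp: conformal_on_def)
  have d1: "pderiv_dir u (\<lambda>q. g q 1 1) p = pderiv_dir u l p"
    "pderiv_dir u (\<lambda>q. g q \<i> \<i>) p = pderiv_dir u l p"
    "pderiv_dir u (\<lambda>q. g q 1 \<i>) p = 0" "pderiv_dir u (\<lambda>q. g q \<i> 1) p = 0" for u
    using pderiv_dir_cong[OF S e(1)] pderiv_dir_cong[OF S e(2)] pderiv_dir_cong[OF S e(3)]
      pderiv_dir_cong[OF S e(4)] by simp_all
  have d2: "pderiv_dir u (pderiv_dir u (\<lambda>q. g q 1 1)) p = pderiv_dir u (pderiv_dir u l) p"
    "pderiv_dir u (pderiv_dir u (\<lambda>q. g q \<i> \<i>)) p = pderiv_dir u (pderiv_dir u l) p" for u
    using pderiv_dir2_cong[OF S e(1)] pderiv_dir2_cong[OF S e(2)] by simp_all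
  have "pderiv_dir \<i> (\<lambda>q. g q 1 \<i>) q = 0" if "q \<in> S" for q
    using pderiv_dir_cong[OF S(1) that e(3)] by simp
  then have d3: "pderiv_dir 1 (pderiv_dir \<i> (\<lambda>q. g q 1 \<i>)) p = 0"
    using pderiv_dir_cong[OF S, of "pderiv_dir \<i> (\<lambda>q. g q 1 \<i>)" "\<lambda>q. 0"] by simp
  have R: "riemann_1212 g p = - plane_lap l p / 2
      + ((pderiv_dir 1 l p)\<^sup>2 + (pderiv_dir \<i> l p)\<^sup>2) / (2 * l p)"
    using l(2)[OF S(2)]
    by (simp add: riemann_1212_def christoffel_def d1 d2 d3 Basis_complex_def plane_lap_def
        conformal_on_metric_det[OF g S(2)] field_simps power2_eq_square)
  show ?thesis
    using l(2)[OF S(2)]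
    by (subst plane_lap_ln[OF S l]) (simp_all add: gauss_curvature_def R conformal_on_metric_det[OF g S(2)] field_simps power2_eq_square)
qed

lemma riemannian_metric_on_conformal:
  assumes S: "open S" and g: "conformal_on S l g"
  shows "riemannian_metric_on S g"
  unfolding riemannian_metric_on_def
proof (intro conjI ballI allI impI)
  fix p assume p: "p \<in> S"
  then have e: "g p u v = l p * Re (u * cnj v)" and pos: "l p > 0" for u v
    using g by (auto simp: conformal_on_def)
  show "bilinear (g p)"
    unfolding bilinear_def by (auto intro!: linearI simp: e algebra_simps)
  show "g p u v = g p v u" for u v by (simp add: e)
  show "g p u u > 0" if "u \<noteq> 0" for u
    using pos that by (simp add: e complex_neq_0 power2_eq_square)
next
  show "smooth_on S (\<lambda>p. g p u v)" for u v
    by (rule smooth_on_cong[OF S, of "\<lambda>p. l p * Re (u * cnj v)"])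
      (use g S in \<open>auto simp: conformal_on_def intro: smooth_on_mult\<close>)
qed

section \<open>The algebra of the Toda system\<close>

lemma gamma_factor_exp:
  assumes "a > 0" "b > 0"
  shows "gamma_factor a b = exp (- (ln a + ln b) / 4)"
  using assms by (simp add: gamma_factor_def powr_def ln_mult add_divide_distrib)

lemma gamma_factor_pos: "a > 0 \<Longrightarrow> b > 0 \<Longrightarrow> gamma_factor a b > 0"
  by (simp add: gamma_factor_exp)

text \<open>The relation by which \<gamma>^2 equals the coupling term 1 / (\<gamma>a
  \<gamma>b).\<close>

lemma gamma_factor_power4:
  assumes "a > 0" "b > 0"
  shows "gamma_factor a b ^ 4 * (a * b) = 1"
proof -
  have "gamma_factor a b ^ 4 = exp (- (ln a + ln b))"
    unfolding gamma_factor_exp[OF assms] exp_of_nat_mult[symmetric]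
    by (intro arg_cong[where f = exp]) (simp add: field_simps)
  also have "\<dots> = inverse (a * b)"
    using assms by (simp add: exp_minus exp_diff field_simps)
  finally show ?thesis using assms by (simp add: field_simps)
qed

lemma gamma_factor_square:
  assumes "a > 0" "b > 0"
  shows "(gamma_factor a b)\<^sup>2 = 1 / sqrt (a * b)"
proof -
  have "sqrt (gamma_factor a b ^ 4) = (gamma_factor a b)\<^sup>2"
    by (rule real_sqrt_unique) simp_all
  then have "(gamma_factor a b)\<^sup>2 * sqrt (a * b) = 1"
    by (metis gamma_factor_power4[OF assms] real_sqrt_mult real_sqrt_one)
  then show ?thesis using assms by (simp add: field_simps)
qed

text \<open>As \<gamma>^2 = (ab)^(-1/2), the rescaling is linear in (ln a, ln b), with matrix rows
  (3/2, -1/2) and (-1/2, 3/2) of determinant 2. Its invertibility underlies both the equivalence of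
  the systems and the bijectivity of the change of unknowns.\<close>

lemma ln_gamma_factor_mult:
  assumes "a > 0" "b > 0"
  shows "ln ((gamma_factor a b * a)\<^sup>2) = 3/2 * ln a - 1/2 * ln b"
    "ln ((gamma_factor a b * b)\<^sup>2) = 3/2 * ln b - 1/2 * ln a"
  using assms gamma_factor_pos[OF assms]
  by (auto simp: ln_realpow ln_mult gamma_factor_exp field_simps)

lemma toda_unknowns_ln:
  assumes "a > 0" "b > 0"
  shows "toda_unknowns a b
    = (ln (sqrt 2) + 3/2 * ln a - 1/2 * ln b, - (ln (sqrt 2) + 3/2 * ln b - 1/2 * ln a))"
proof -
  have "ln (sqrt 2 * (gamma_factor a b * x)\<^sup>2) = ln (sqrt 2) + ln ((gamma_factor a b * x)\<^sup>2)"
    if "x > 0" for x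
    using that gamma_factor_pos[OF assms] by (subst ln_mult) auto
  then show ?thesis using assms by (simp add: toda_unknowns_def ln_gamma_factor_mult)
qed

lemma toda_unknowns_exp:
  assumes "a > 0" "b > 0" "toda_unknowns a b = (x, y)"
  shows "exp x = sqrt 2 * (gamma_factor a b * a)\<^sup>2" "exp (- y) = sqrt 2 * (gamma_factor a b * b)\<^sup>2"
    "sqrt 2 * exp ((y - x) / 2) = (gamma_factor a b)\<^sup>2"
proof -
  show "exp x = sqrt 2 * (gamma_factor a b * a)\<^sup>2" "exp (- y) = sqrt 2 * (gamma_factor a b * b)\<^sup>2"
    using assms gamma_factor_pos[OF assms(1,2)] by (auto simp: toda_unknowns_def)
  have e: "(y - x) / 2 = - (ln a + ln b) / 2 - ln (sqrt 2)"
    using assms by (auto simp: toda_unknowns_ln field_simps)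
  have "(gamma_factor a b)\<^sup>2 = exp (- (ln a + ln b) / 2)"
    by (simp add: gamma_factor_exp[OF assms(1,2)] exp_double[symmetric] field_simps flip: exp_of_nat_mult)
  then show "sqrt 2 * exp ((y - x) / 2) = (gamma_factor a b)\<^sup>2"
    by (simp only: e exp_diff) simp
qed

lemma bij_betw_toda_unknowns: "bij_betw (\<lambda>(a, b). toda_unknowns a b) ({0<..} \<times> {0<..}) UNIV"
\<comment> \<open>The inverse of that matrix has rows (3/4, 1/4) and (1/4, 3/4); it is applied to (x
  - ln (sqrt 2), - (y + ln (sqrt 2))).\<close>
proof (rule bij_betwI[where g = "\<lambda>(x, y). (exp ((3 * (x - ln (sqrt 2)) - (y + ln (sqrt 2))) / 4),
      exp (((x - ln (sqrt 2)) - 3 * (y + ln (sqrt 2))) / 4))"])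
qed (auto simp: toda_unknowns_ln field_simps)

text \<open>A and B stand for the Laplacians of ln a^2 and ln b^2. The combinations 3A/4 - B/4 and
  3B/4 - A/4 are the Laplacians after rescaling; they determine A and B, hence the equivalence. On
  the right-hand side the same combination cancels the mixed squares and leaves 2 a^2 - 1, times -4
  \<gamma>^2.\<close>

lemma rescaled_angle_equations:
  assumes "a > 0" "b > 0"
  defines "\<gamma> \<equiv> gamma_factor a b"
  shows "(A = - 4 * (3 * a\<^sup>2 + b\<^sup>2 - 2) * \<gamma>\<^sup>2 \<and> B = - 4 * (3 * b\<^sup>2 + a\<^sup>2 - 2) * \<gamma>\<^sup>2) \<longleftrightarrow>
    (3/4 * A - 1/4 * B = - 4 * (2 * (\<gamma> * a)\<^sup>2 - inverse (\<gamma> * a) * inverse (\<gamma> * b)) \<and>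
     3/4 * B - 1/4 * A = - 4 * (2 * (\<gamma> * b)\<^sup>2 - inverse (\<gamma> * a) * inverse (\<gamma> * b)))"
proof -
  have g: "\<gamma> > 0" unfolding \<gamma>_def by (rule gamma_factor_pos[OF assms(1,2)])
  have "\<gamma>\<^sup>2 * ((\<gamma> * a) * (\<gamma> * b)) = 1"
    using gamma_factor_power4[OF assms(1,2)] by (simp add: \<gamma>_def power4_eq_xxxx power2_eq_square ac_simps)
  then have i: "inverse (\<gamma> * a) * inverse (\<gamma> * b) = \<gamma>\<^sup>2"
    using g assms(1,2) by (simp add: field_simps)
  show ?thesis unfolding i power_mult_distrib by (auto simp: algebra_simps)
qed

lemma laplacian_lincomb:
  assumes S: "open S" "p \<in> S" and g: "conformal_on S l g" and f: "smooth_on S f" and h: "smooth_on S h"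
    and F: "\<And>q. q \<in> S \<Longrightarrow> F q = k + c * f q + d * h q"
  shows "laplacian g F p = c * laplacian g f p + d * laplacian g h p"
  using plane_lap_cong[OF S F] plane_lap_lincomb[OF S f h, of k c d]
  by (simp add: laplacian_conformal[OF S g] add_divide_distrib)

lemma laplacian_angle_functions:
  fixes a b :: "complex \<Rightarrow> real"
  assumes S: "open S" "p \<in> S" and g: "conformal_on S l g"
    and a: "smooth_on S a" "\<And>q. q \<in> S \<Longrightarrow> a q > 0" and b: "smooth_on S b" "\<And>q. q \<in> S \<Longrightarrow> b q > 0"
  defines "A \<equiv> laplacian g (\<lambda>q. ln ((a q)\<^sup>2)) p" and "B \<equiv> laplacian g (\<lambda>q. ln ((b q)\<^sup>2)) p"
  shows "laplacian g (\<lambda>q. ln ((gamma_factor (a q) (b q) * a q)\<^sup>2)) p = 3/4 * A - 1/4 * B"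
    "laplacian g (\<lambda>q. ln ((gamma_factor (a q) (b q) * b q)\<^sup>2)) p = 3/4 * B - 1/4 * A"
    "laplacian g (\<lambda>q. fst (toda_unknowns (a q) (b q))) p = 3/4 * A - 1/4 * B"
    "laplacian g (\<lambda>q. snd (toda_unknowns (a q) (b q))) p = - (3/4 * B - 1/4 * A)"
proof -
  note ln_ab = smooth_on_ln[OF S(1) a(2,1)] smooth_on_ln[OF S(1) b(2,1)]
  note lc = laplacian_lincomb[OF S g ln_ab]
  have AB: "A = 2 * laplacian g (\<lambda>q. ln (a q)) p" "B = 2 * laplacian g (\<lambda>q. ln (b q)) p"
    unfolding A_def B_def
    using lc[of "\<lambda>q. ln ((a q)\<^sup>2)" 0 2 0] lc[of "\<lambda>q. ln ((b q)\<^sup>2)" 0 0 2] a(2) b(2)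
    by (simp_all add: ln_realpow)
  show "laplacian g (\<lambda>q. ln ((gamma_factor (a q) (b q) * a q)\<^sup>2)) p = 3/4 * A - 1/4 * B"
    "laplacian g (\<lambda>q. ln ((gamma_factor (a q) (b q) * b q)\<^sup>2)) p = 3/4 * B - 1/4 * A"
    "laplacian g (\<lambda>q. fst (toda_unknowns (a q) (b q))) p = 3/4 * A - 1/4 * B"
    "laplacian g (\<lambda>q. snd (toda_unknowns (a q) (b q))) p = - (3/4 * B - 1/4 * A)"
    using lc[of "\<lambda>q. ln ((gamma_factor (a q) (b q) * a q)\<^sup>2)" 0 "3/2" "-1/2"]
      lc[of "\<lambda>q. ln ((gamma_factor (a q) (b q) * b q)\<^sup>2)" 0 "-1/2" "3/2"]
      lc[of "\<lambda>q. fst (toda_unknowns (a q) (b q))" "ln (sqrt 2)" "3/2" "-1/2"]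
      lc[of "\<lambda>q. snd (toda_unknowns (a q) (b q))" "- ln (sqrt 2)" "1/2" "-3/2"] a(2) b(2)
    by (simp_all add: ln_gamma_factor_mult toda_unknowns_ln AB)
qed

lemma smooth_on_toda_unknowns:
  fixes a b :: "complex \<Rightarrow> real"
  assumes S: "open S" and a: "smooth_on S a" "\<And>q. q \<in> S \<Longrightarrow> a q > 0"
    and b: "smooth_on S b" "\<And>q. q \<in> S \<Longrightarrow> b q > 0"
  shows "smooth_on S (\<lambda>q. fst (toda_unknowns (a q) (b q)))" "smooth_on S (\<lambda>q. snd (toda_unknowns (a q) (b q)))"
proof -
  note ln_ab = smooth_on_ln[OF S(1) a(2,1)] smooth_on_ln[OF S(1) b(2,1)]
  have s: "smooth_on S (\<lambda>q. k + c * ln (a q) + d * ln (b q))" for k c d :: real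
    by (intro smooth_on_add smooth_on_mult S ln_ab smooth_on_const)
  show "smooth_on S (\<lambda>q. fst (toda_unknowns (a q) (b q)))"
    by (rule smooth_on_cong[OF S _ s[of "ln (sqrt 2)" "3/2" "-1/2"]]) (simp add: toda_unknowns_ln a b)
  show "smooth_on S (\<lambda>q. snd (toda_unknowns (a q) (b q)))"
    by (rule smooth_on_cong[OF S _ s[of "- ln (sqrt 2)" "1/2" "-3/2"]]) (simp add: toda_unknowns_ln a b)
qed

text \<open>The factor sqrt 2 in the unknowns is chosen so that sqrt 2 times the exponentials of x,
  -y and (y - x)/2 are 2 (\<gamma>a)^2, 2 (\<gamma>b)^2 and \<gamma>^2, the terms of the rescaled
  system.\<close>

lemma toda_equations:
  assumes "a > 0" "b > 0"
  defines "\<gamma> \<equiv> gamma_factor a b" and "x \<equiv> fst (toda_unknowns a b)" and "y \<equiv> snd (toda_unknowns a b)"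
  shows "(A = - 4 * (3 * a\<^sup>2 + b\<^sup>2 - 2) * \<gamma>\<^sup>2 \<and> B = - 4 * (3 * b\<^sup>2 + a\<^sup>2 - 2) * \<gamma>\<^sup>2) \<longleftrightarrow>
    (3/4 * A - 1/4 * B = - 4 * sqrt 2 * (exp x - exp ((y - x) / 2)) \<and>
     - (3/4 * B - 1/4 * A) = 4 * sqrt 2 * (exp (- y) - exp ((y - x) / 2)))"
proof -
  have xy: "toda_unknowns a b = (x, y)" by (simp add: x_def y_def)
  note e = toda_unknowns_exp[OF assms(1,2) xy, folded \<gamma>_def]
  have e3: "sqrt 2 * exp x = 2 * (\<gamma> * a)\<^sup>2" "sqrt 2 * exp (- y) = 2 * (\<gamma> * b)\<^sup>2"
    by (simp_all add: e)
  show ?thesis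
    unfolding mult.assoc right_diff_distrib e3 e(3) power_mult_distrib by (auto simp: algebra_simps)
qed

section \<open>Quaternionic matrices\<close>

notation qmat_mult (infixl "\<otimes>" 70)

lemma qmult_assoc: "qmult (qmult x y) z = qmult x (qmult y z)"
  by (simp add: qmult_def algebra_simps)

lemma qmult_one [simp]: "qmult (1, 0) x = x" "qmult x (1, 0) = x"
  by (simp_all add: qmult_def)

lemma qmult_zero [simp]: "qmult 0 x = 0" "qmult x 0 = 0"
  by (simp_all add: qmult_def zero_prod_def)

lemma qmult_add: "qmult (x + y) z = qmult x z + qmult y z" "qmult x (y + z) = qmult x y + qmult x z"
  by (simp_all add: qmult_def plus_prod_def algebra_simps)

lemma qmult_scaleR: "qmult (r *\<^sub>R x) y = r *\<^sub>R qmult x y" "qmult x (r *\<^sub>R y) = r *\<^sub>R qmult x y"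
  by (simp_all add: qmult_def scaleR_prod_def algebra_simps)

lemma qcnj_qmult: "qcnj (qmult x y) = qmult (qcnj y) (qcnj x)"
  by (simp add: qmult_def qcnj_def algebra_simps)

lemma qcnj_qcnj [simp]: "qcnj (qcnj x) = x"
  by (simp add: qcnj_def)

lemma qcnj_zero [simp]: "qcnj 0 = 0"
  by (simp add: qcnj_def zero_prod_def)

lemma qcnj_add: "qcnj (x + y) = qcnj x + qcnj y"
  by (simp add: qcnj_def)

lemma qcnj_scaleR: "qcnj (r *\<^sub>R x) = r *\<^sub>R qcnj x"
  by (simp add: qcnj_def scaleR_prod_def)

lemma qmult_qcnj_self: "qmult (qcnj x) x = (complex_of_real ((norm x)\<^sup>2), 0)"
  "qmult x (qcnj x) = (complex_of_real ((norm x)\<^sup>2), 0)"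
  by (simp_all add: qmult_def qcnj_def norm_prod_def complex_norm_square[symmetric] mult.commute
      flip: of_real_power)

text \<open>Multiplication by a quaternion, on either side, is a similarity of Euclidean 4-space.
  For unit quaternions this is the invariance of the horizontal metric under a change of
  lift.\<close>

lemma inner_qmult_left: "inner (qmult q x) (qmult q y) = (norm q)\<^sup>2 * inner x y"
  by (cases q; cases x; cases y)
    (simp add: qmult_def inner_prod_def inner_complex_def power2_norm_eq_inner algebra_simps)

lemma inner_qmult_right: "inner (qmult x q) (qmult y q) = (norm q)\<^sup>2 * inner x y"
  by (cases q; cases x; cases y)
    (simp add: qmult_def inner_prod_def inner_complex_def power2_norm_eq_inner algebra_simps)

lemma norm_qmult: "norm (qmult x y) = norm x * norm y"
proof -
  have "(norm (qmult x y))\<^sup>2 = (norm x * norm y)\<^sup>2"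
    using inner_qmult_left[of x y y] by (simp add: power2_norm_eq_inner power_mult_distrib)
  then show ?thesis by (simp add: power2_eq_iff_nonneg)
qed

lemma norm_qcnj [simp]: "norm (qcnj x) = norm x"
  by (simp add: qcnj_def norm_prod_def)

definition qid :: qmat where
  "qid = (\<chi> r s. if r = s then (1, 0) else 0)"

definition qdiag :: "quat \<Rightarrow> quat \<Rightarrow> qmat" where
  "qdiag a b = (\<chi> r s. if r = s then if r = 1 then a else b else 0)"

lemma qmat_mult_nth: "(A \<otimes> B) $ r $ s = qmult (A $ r $ 1) (B $ 1 $ s) + qmult (A $ r $ 2) (B $ 2 $ s)"
  by (simp add: qmat_mult_def sum_2)

lemma qmat_adj_nth [simp]: "qmat_adj A $ r $ s = qcnj (A $ s $ r)"
  by (simp add: qmat_adj_def)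

lemma qid_nth [simp]: "qid $ 1 $ 1 = (1, 0)" "qid $ 2 $ 2 = (1, 0)" "qid $ 1 $ 2 = 0" "qid $ 2 $ 1 = 0"
  by (simp_all add: qid_def)

lemma qdiag_nth [simp]: "qdiag a b $ 1 $ 1 = a" "qdiag a b $ 2 $ 2 = b" "qdiag a b $ 1 $ 2 = 0" "qdiag a b $ 2 $ 1 = 0"
  by (simp_all add: qdiag_def)

lemma qmat_eq_iff:
  "(A :: qmat) = B \<longleftrightarrow> A $ 1 $ 1 = B $ 1 $ 1 \<and> A $ 1 $ 2 = B $ 1 $ 2 \<and> A $ 2 $ 1 = B $ 2 $ 1 \<and> A $ 2 $ 2 = B $ 2 $ 2"
  by (auto simp: vec_eq_iff forall_2)

lemma qmat_mult_assoc: "A \<otimes> B \<otimes> C = A \<otimes> (B \<otimes> C)"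
  by (simp add: qmat_eq_iff qmat_mult_nth qmult_add qmult_assoc add_ac)

lemma qmat_mult_qid [simp]: "qid \<otimes> A = A" "A \<otimes> qid = A"
  by (simp_all add: qmat_eq_iff qmat_mult_nth)

lemma qmat_adj_mult: "qmat_adj (A \<otimes> B) = qmat_adj B \<otimes> qmat_adj A"
  by (simp add: qmat_eq_iff qmat_mult_nth qcnj_add qcnj_qmult)

lemma qmat_adj_adj [simp]: "qmat_adj (qmat_adj A) = A"
  by (simp add: qmat_eq_iff)

lemma linear_qmat_adj: "linear qmat_adj"
  by (rule linearI) (simp_all add: qmat_eq_iff qcnj_add qcnj_scaleR)

lemma bilinear_qmat_mult: "bilinear (\<otimes>)"
  unfolding bilinear_def
  by (auto intro!: linearI simp: qmat_eq_iff qmat_mult_nth qmult_add qmult_scaleR scaleR_right_distrib add_ac)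

lemma qmat_mult_simps:
  "(A + B) \<otimes> C = A \<otimes> C + B \<otimes> C" "A \<otimes> (B + C) = A \<otimes> B + A \<otimes> C"
  "(A - B) \<otimes> C = A \<otimes> C - B \<otimes> C" "A \<otimes> (B - C) = A \<otimes> B - A \<otimes> C"
  "(- A) \<otimes> C = - (A \<otimes> C)" "A \<otimes> (- C) = - (A \<otimes> C)" "A \<otimes> 0 = 0" "0 \<otimes> A = 0"
  using bilinear_qmat_mult
  by (simp_all add: bilinear_ladd bilinear_radd bilinear_lsub bilinear_rsub bilinear_lneg bilinear_rneg
      bilinear_lzero bilinear_rzero)

lemma Sp2_iff: "A \<in> Sp2 \<longleftrightarrow> qmat_adj A \<otimes> A = qid"
  by (simp add: Sp2_def qid_def)

lemma Sp2_adj_mult: "A \<in> Sp2 \<Longrightarrow> qmat_adj A \<otimes> A = qid" "A \<in> Sp2 \<Longrightarrow> qmat_adj A \<otimes> (A \<otimes> B) = B"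
  by (simp_all add: Sp2_iff qmat_mult_assoc[symmetric])

lemma Sp2_mult_adj:
  assumes "A \<in> Sp2"
  shows "A \<otimes> qmat_adj A = qid" "A \<otimes> (qmat_adj A \<otimes> B) = B"
proof -
  \<comment> \<open>Membership in \<open>Sp2\<close> supplies only a left inverse. Multiplication by
    A is an injective linear map of a finite-dimensional space, hence onto, which makes the left
    inverse two-sided.\<close>
  have lin: "linear (\<lambda>B. A \<otimes> B)" using bilinear_qmat_mult by (simp add: bilinear_def)
  have "inj (\<lambda>B. A \<otimes> B)" by (rule inj_on_inverseI[where g = "\<lambda>B. qmat_adj A \<otimes> B"]) (rule Sp2_adj_mult(2)[OF assms])
  then have "surj (\<lambda>B. A \<otimes> B)" by (rule linear_inj_imp_surj[OF lin])
  then obtain C where C: "A \<otimes> C = qid" by (metis surjD)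
  then have "C = qmat_adj A" using Sp2_adj_mult(2)[OF assms, of C] by simp
  then show "A \<otimes> qmat_adj A = qid" using C by simp
  then show "A \<otimes> (qmat_adj A \<otimes> B) = B" by (simp add: qmat_mult_assoc[symmetric])
qed

lemma Sp2_mult: "A \<in> Sp2 \<Longrightarrow> B \<in> Sp2 \<Longrightarrow> A \<otimes> B \<in> Sp2"
  by (simp add: Sp2_iff qmat_adj_mult qmat_mult_assoc Sp2_adj_mult)

lemma Sp2_adj: "A \<in> Sp2 \<Longrightarrow> qmat_adj A \<in> Sp2"
  by (simp add: Sp2_iff Sp2_mult_adj)

lemma sp2_algebra_conj: "M \<in> sp2_algebra \<Longrightarrow> G \<otimes> M \<otimes> qmat_adj G \<in> sp2_algebra"
  by (simp add: sp2_algebra_def qmat_adj_mult qmat_mult_simps qmat_mult_assoc)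

lemma sp2_algebra_diff: "M \<in> sp2_algebra \<Longrightarrow> N \<in> sp2_algebra \<Longrightarrow> M - N \<in> sp2_algebra"
  by (simp add: sp2_algebra_def linear_diff[OF linear_qmat_adj])

section \<open>The orbit map to projective space\<close>

definition qcol :: "qmat \<Rightarrow> complex^4" where
  "qcol A = vector [fst (A$1$1), snd (A$1$1), fst (A$2$1), snd (A$2$1)]"

lemma vec4_eq_iff: "(v :: 'b^4) = w \<longleftrightarrow> v $ 1 = w $ 1 \<and> v $ 2 = w $ 2 \<and> v $ 3 = w $ 3 \<and> v $ 4 = w $ 4"
  by (simp add: vec_eq_iff forall_4)

lemma qcol_nth [simp]: "qcol A $ 1 = fst (A$1$1)" "qcol A $ 2 = snd (A$1$1)"
  "qcol A $ 3 = fst (A$2$1)" "qcol A $ 4 = snd (A$2$1)"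
  by (simp_all add: qcol_def vector_def)

lemma linear_qcol: "linear qcol"
  by (rule linearI) (simp_all add: vec4_eq_iff)

lemma qcol_eq_iff: "qcol A = qcol B \<longleftrightarrow> A $ 1 $ 1 = B $ 1 $ 1 \<and> A $ 2 $ 1 = B $ 2 $ 1"
  by (auto simp: vec4_eq_iff prod_eq_iff)

lemma inner_qcol: "qcol A \<bullet> qcol B = A $ 1 $ 1 \<bullet> B $ 1 $ 1 + A $ 2 $ 1 \<bullet> B $ 2 $ 1"
  by (simp add: inner_vec_def sum_4 inner_prod_def)

lemma norm_qcol: "(norm (qcol A))\<^sup>2 = (norm (A$1$1))\<^sup>2 + (norm (A$2$1))\<^sup>2"
  by (simp add: power2_norm_eq_inner inner_qcol)

lemma Re_fst_qmult_qcnj: "Re (fst (qmult (qcnj x) y)) = x \<bullet> y"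
  by (simp add: qmult_def qcnj_def inner_prod_def inner_complex_def)

lemma Sp2_norm_qcol: "A \<in> Sp2 \<Longrightarrow> norm (qcol A) = 1"
proof -
  assume "A \<in> Sp2"
  then have "fst ((qmat_adj A \<otimes> A) $ 1 $ 1) = 1" by (simp add: Sp2_adj_mult)
  then have "(norm (qcol A))\<^sup>2 = 1"
    unfolding norm_qcol by (simp add: qmat_mult_nth qmult_qcnj_self flip: of_real_power of_real_add)
  then show ?thesis by (simp add: power2_eq_1_iff) (metis abs_norm_cancel abs_of_neg less_minus_one_simps(1) norm_ge_zero not_le)
qed

definition outer :: "complex^4 \<Rightarrow> complex^4 \<Rightarrow> complex^4^4" where
  "outer v w = (\<chi> r s. v $ r * cnj (w $ s))"

lemma outer_nth [simp]: "outer v w $ r $ s = v $ r * cnj (w $ s)"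
  by (simp add: outer_def)

lemma bilinear_outer: "bilinear outer"
  unfolding bilinear_def
  by (auto intro!: linearI simp: vec_eq_iff algebra_simps)

text \<open>The differential at a unit vector v of the projection onto the line of v; the last term
  is the derivative of the normalising factor \<open>inverse (v \<bullet> v)\<close>.\<close>

definition dproj :: "complex^4 \<Rightarrow> complex^4 \<Rightarrow> complex^4^4" where
  "dproj v w = outer w v + outer v w - (2 * (v \<bullet> w)) *\<^sub>R outer v v"

lemma linear_dproj: "linear (dproj v)"
  by (rule linearI)
    (simp_all add: dproj_def bilinear_ladd[OF bilinear_outer] bilinear_radd[OF bilinear_outer]
      bilinear_lmul[OF bilinear_outer] bilinear_rmul[OF bilinear_outer] inner_add_right
      scaleR_left_distrib scaleR_right_distrib scaleR_right_diff_distrib algebra_simps)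

lemma proj_point_outer: "proj_point v = inverse (v \<bullet> v) *\<^sub>R outer v v"
proof -
  have "proj_point v $ r $ s = (inverse (v \<bullet> v) *\<^sub>R outer v v) $ r $ s" for r s
    unfolding vector_scaleR_component outer_nth
    by (simp add: scaleR_conv_of_real proj_point_def divide_inverse power2_norm_eq_inner flip: of_real_power)
  then show ?thesis by (simp add: vec_eq_iff)
qed

lemma has_derivative_proj_point:
  assumes "norm v = 1"
  shows "(proj_point has_derivative dproj v) (at v)"
proof -
  have v: "v \<bullet> v = 1" using assms by (simp add: norm_eq_1)
  have 1: "((\<lambda>x. outer x x) has_derivative (\<lambda>w. outer v w + outer w v)) (at v)"
    using bounded_bilinear.FDERIV[OF bilinear_conv_bounded_bilinear[THEN iffD1, OF bilinear_outer]
        has_derivative_ident has_derivative_ident] .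
  have 2: "((\<lambda>x. inverse (x \<bullet> x)) has_derivative (\<lambda>w. - (2 * (v \<bullet> w)))) (at v)"
    using v by (auto intro!: derivative_eq_intros simp: inner_commute)
  have "((\<lambda>x. inverse (x \<bullet> x) *\<^sub>R outer x x) has_derivative dproj v) (at v)"
    by (rule has_derivative_eq_rhs[OF has_derivative_scaleR[OF 2 1]]) (simp add: fun_eq_iff dproj_def v)
  then show ?thesis by (simp add: proj_point_outer[abs_def])
qed

lemma Sp2_proj_qcol: "Sp2_proj A = proj_point (qcol A)"
  by (simp add: Sp2_proj_def qcol_def)

lemma has_derivative_Sp2_proj:
  assumes "A \<in> Sp2"
  shows "(Sp2_proj has_derivative (\<lambda>B. dproj (qcol A) (qcol B))) (at A)"
proof -
  have "(qcol has_derivative qcol) (at A)"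
    using linear_qcol by (intro bounded_linear_imp_has_derivative) (simp add: linear_conv_bounded_linear)
  from has_derivative_compose[OF this has_derivative_proj_point[OF Sp2_norm_qcol[OF assms]]]
  show ?thesis by (simp add: Sp2_proj_qcol[abs_def])
qed

lemma frechet_derivative_Sp2_proj:
  "A \<in> Sp2 \<Longrightarrow> frechet_derivative Sp2_proj (at A) B = dproj (qcol A) (qcol B)"
  using frechet_derivative_at[OF has_derivative_Sp2_proj] by metis

text \<open>The fibres of the orbit map are cosets of the stabiliser U(1) x Sp(1). Proportional
  first columns make the first column of G = \<open>qmat_adj A \<otimes> A'\<close> equal to (c, 0),
  and \<open>G \<in> Sp2\<close> then forces the entry above the diagonal to vanish and the last
  entry to be a unit.\<close>

lemma Sp2_fibre:
  assumes A: "A \<in> Sp2" and A': "A' \<in> Sp2" and eq: "Sp2_proj A = Sp2_proj A'"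
  obtains c q where "cmod c = 1" "norm q = 1" "qmat_adj A \<otimes> A' = qdiag (c, 0) q"
    "A' = A \<otimes> qdiag (c, 0) q" "qcol A' = c *s qcol A"
proof -
  have "qcol A \<noteq> 0" "qcol A' \<noteq> 0" using Sp2_norm_qcol[OF A] Sp2_norm_qcol[OF A'] by auto
  then obtain c where c: "qcol A' = c *s qcol A"
    using eq by (auto simp: Sp2_proj_qcol proj_point_eq_iff)
  have "norm (qcol A') = cmod c * norm (qcol A)"
    unfolding c by (simp add: norm_vec_def norm_mult L2_set_right_distrib)
  then have c1: "cmod c = 1" using Sp2_norm_qcol A A' by simp
  define G where "G = qmat_adj A \<otimes> A'"
  have col: "A' $ r $ 1 = qmult (A $ r $ 1) (c, 0)" for r
  proof -
    have "\<forall>i. qcol A' $ i = c * qcol A $ i" by (simp add: c)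
    then have "A' $ 1 $ 1 = qmult (A $ 1 $ 1) (c, 0)" "A' $ 2 $ 1 = qmult (A $ 2 $ 1) (c, 0)"
      by (auto simp: forall_4 prod_eq_iff qmult_def)
    then show ?thesis using exhaust_2[of r] by auto
  qed
  have G1: "G $ r $ 1 = qmult ((qmat_adj A \<otimes> A) $ r $ 1) (c, 0)" for r
    by (simp add: G_def qmat_mult_nth col qmult_add qmult_assoc)
  have G11: "G $ 1 $ 1 = (c, 0)" and G21: "G $ 2 $ 1 = 0"
    using G1[of 1] G1[of 2] by (simp_all add: Sp2_adj_mult[OF A])
  have "G \<in> Sp2" unfolding G_def by (intro Sp2_mult Sp2_adj A A')
  then have GG: "qmat_adj G \<otimes> G = qid" by (rule Sp2_adj_mult)
  have "(qmat_adj G \<otimes> G) $ 1 $ 2 = 0" "(qmat_adj G \<otimes> G) $ 2 $ 2 = (1, 0)" by (simp_all add: GG)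
  then have G12: "G $ 1 $ 2 = 0" and n: "qmult (qcnj (G $ 2 $ 2)) (G $ 2 $ 2) = (1, 0)"
  proof -
    assume *: "(qmat_adj G \<otimes> G) $ 1 $ 2 = 0" "(qmat_adj G \<otimes> G) $ 2 $ 2 = (1, 0)"
    have "c \<noteq> 0" using c1 by auto
    then show "G $ 1 $ 2 = 0"
      using *(1) by (simp add: qmat_mult_nth G11 G21 qmult_def qcnj_def prod_eq_iff zero_prod_def)
    then show "qmult (qcnj (G $ 2 $ 2)) (G $ 2 $ 2) = (1, 0)"
      using *(2) by (simp add: qmat_mult_nth)
  qed
  have "norm (G $ 2 $ 2) = 1"
    using n by (simp add: qmult_qcnj_self power2_eq_1_iff flip: of_real_power)
      (metis abs_norm_cancel abs_of_neg less_minus_one_simps(1) norm_ge_zero not_le)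
  moreover have Gd: "G = qdiag (c, 0) (G $ 2 $ 2)" by (simp add: qmat_eq_iff G11 G21 G12)
  moreover have "A' = A \<otimes> G" by (simp add: G_def Sp2_mult_adj[OF A])
  ultimately show ?thesis using that[of c "G $ 2 $ 2"] c1 c G_def by metis
qed

text \<open>Provides a lift at a single point, for use before any frame is available.\<close>

lemma Sp2_completion:
  assumes "(norm x)\<^sup>2 + (norm y)\<^sup>2 = 1"
  shows "\<exists>A\<in>Sp2. A $ 1 $ 1 = x \<and> A $ 2 $ 1 = y"
proof -
  have cst: "qmult a (complex_of_real r, 0) = r *\<^sub>R a" "qmult (complex_of_real r, 0) a = r *\<^sub>R a" for a r
    by (simp_all add: qmult_def scaleR_prod_def scaleR_conv_of_real mult.commute prod_eq_iff)
  have one: "(1, 0) = (complex_of_real 1, 0::complex)" by simp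
  define M where "M = (\<lambda>u v. (\<chi> r s. if s = 1 then if r = 1 then x else y else if r = 1 then u else v) :: qmat)"
  have M: "M u v $ 1 $ 1 = x" "M u v $ 2 $ 1 = y" "M u v $ 1 $ 2 = u" "M u v $ 2 $ 2 = v" for u v
    by (simp_all add: M_def)
  have Sp: "M u v \<in> Sp2" if "qmult (qcnj x) u + qmult (qcnj y) v = 0" "(norm u)\<^sup>2 + (norm v)\<^sup>2 = 1" for u v
  proof -
    have "qmult (qcnj u) x + qmult (qcnj v) y = qcnj (qmult (qcnj x) u + qmult (qcnj y) v)"
      by (simp add: qcnj_add qcnj_qmult)
    moreover have "qmult (qcnj x) x + qmult (qcnj y) y = (1, 0)" "qmult (qcnj u) u + qmult (qcnj v) v = (1, 0)"
      using assms that(2) by (simp_all add: qmult_qcnj_self flip: of_real_power of_real_add)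
    ultimately show ?thesis using that(1) by (simp add: Sp2_iff qmat_eq_iff qmat_mult_nth M)
  qed
  consider "x \<noteq> 0" | "y \<noteq> 0" using assms by fastforce
  then show ?thesis
  proof cases
    case 1
    \<comment> \<open>The orthogonality relation is solved by the column with entries -x
      \<open>qcnj y\<close> and |x|^2; dividing by |x| makes it a unit column. The other case
      exchanges x and y.\<close>
    define u where "u = - (inverse (norm x) *\<^sub>R qmult x (qcnj y))"
    have "qmult (qcnj x) (qmult x (qcnj y)) = (norm x)\<^sup>2 *\<^sub>R qcnj y"
      by (simp only: qmult_assoc[symmetric] qmult_qcnj_self cst)
    then have "qmult (qcnj x) u = - (norm x *\<^sub>R qcnj y)"
      using 1 by (simp add: u_def qmult_scaleR power2_eq_square flip: scaleR_minus_left)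
    moreover have "norm u = norm y" using 1 by (simp add: u_def norm_qmult)
    ultimately have "M u (complex_of_real (norm x), 0) \<in> Sp2"
      using assms by (intro Sp) (simp_all add: cst norm_prod_def add.commute)
    then show ?thesis using M by blast
  next
    case 2
    define v where "v = - (inverse (norm y) *\<^sub>R qmult y (qcnj x))"
    have "qmult (qcnj y) (qmult y (qcnj x)) = (norm y)\<^sup>2 *\<^sub>R qcnj x"
      by (simp only: qmult_assoc[symmetric] qmult_qcnj_self cst)
    then have "qmult (qcnj y) v = - (norm y *\<^sub>R qcnj x)"
      using 2 by (simp add: v_def qmult_scaleR power2_eq_square flip: scaleR_minus_left)
    moreover have "norm v = norm x" using 2 by (simp add: v_def norm_qmult)
    ultimately have "M (complex_of_real (norm y), 0) v \<in> Sp2"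
      using assms by (intro Sp) (simp_all add: cst norm_prod_def add.commute)
    then show ?thesis using M by blast
  qed
qed

section \<open>Tangent lifts\<close>

text \<open>The differential of the orbit map at A in the left trivialisation of the tangent bundle
  of Sp(2).\<close>

definition dlift :: "qmat \<Rightarrow> qmat \<Rightarrow> complex^4^4" where
  "dlift A M = dproj (qcol A) (qcol (A \<otimes> M))"

lemma tangent_lift_iff:
  "tangent_lift P V A M \<longleftrightarrow> A \<in> Sp2 \<and> Sp2_proj A = P \<and> M \<in> sp2_algebra \<and> V = dlift A M"
proof
  assume "tangent_lift P V A M"
  then show "A \<in> Sp2 \<and> Sp2_proj A = P \<and> M \<in> sp2_algebra \<and> V = dlift A M"
    by (auto simp: tangent_lift_def Sp2_tangent_def dlift_def maurer_cartan_def
        frechet_derivative_Sp2_proj Sp2_mult_adj)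
next
  assume *: "A \<in> Sp2 \<and> Sp2_proj A = P \<and> M \<in> sp2_algebra \<and> V = dlift A M"
  then have "A \<otimes> M \<in> Sp2_tangent A" "M = maurer_cartan A (A \<otimes> M)"
    by (auto simp: Sp2_tangent_def maurer_cartan_def Sp2_adj_mult)
  with * show "tangent_lift P V A M"
    by (auto simp: tangent_lift_def dlift_def frechet_derivative_Sp2_proj intro!: bexI[of _ "A \<otimes> M"])
qed

lemma inner_qcol_tangent:
  assumes "A \<in> Sp2" "M \<in> sp2_algebra"
  shows "qcol A \<bullet> qcol (A \<otimes> M) = 0"
proof -
  have "qcol A \<bullet> qcol (A \<otimes> M) = Re (fst ((qmat_adj A \<otimes> (A \<otimes> M)) $ 1 $ 1))"
    by (subst qmat_mult_nth) (simp add: inner_qcol Re_fst_qmult_qcnj)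
  also have "\<dots> = 0"
    using assms sp2_algebra_components(1)[OF assms(2)] by (simp add: Sp2_adj_mult)
  finally show ?thesis .
qed

lemma dlift_diff: "dlift A M - dlift A N = dlift A (M - N)"
  by (simp add: dlift_def qmat_mult_simps linear_diff[OF linear_dproj] linear_diff[OF linear_qcol])

lemma forms_zero_iff:
  assumes "N \<in> sp2_algebra"
  shows "\<omega>1 N = 0 \<and> \<omega>2 N = 0 \<and> \<omega>3 N = 0 \<longleftrightarrow> N $ 2 $ 1 = 0 \<and> N $ 1 $ 1 = (\<i> * \<rho>1 N, 0)"
  using sp2_algebra_components(1,3)[OF assms] by (auto simp: \<omega>1_def \<omega>2_def \<omega>3_def prod_eq_iff zero_prod_def)

lemma qcol_right_complex:
  "N $ 1 $ 1 = (k, 0) \<Longrightarrow> N $ 2 $ 1 = 0 \<Longrightarrow> qcol (A \<otimes> N) = k *s qcol A"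
  by (simp add: vec4_eq_iff qmat_mult_nth qmult_def zero_prod_def)

text \<open>The kernel of the differential of the orbit map is the Lie algebra of the stabiliser, on
  which \<rho>1, \<rho>2 and \<tau> are free. Hence the three forms are coordinates on the tangent
  space below.\<close>

lemma dlift_eq_0_iff:
  assumes A: "A \<in> Sp2" and N: "N \<in> sp2_algebra"
  shows "dlift A N = 0 \<longleftrightarrow> \<omega>1 N = 0 \<and> \<omega>2 N = 0 \<and> \<omega>3 N = 0"
proof
  assume "\<omega>1 N = 0 \<and> \<omega>2 N = 0 \<and> \<omega>3 N = 0"
  then have "N $ 2 $ 1 = 0" "N $ 1 $ 1 = (\<i> * \<rho>1 N, 0)" by (simp_all add: forms_zero_iff[OF N])
  then have "qcol (A \<otimes> N) = (\<i> * \<rho>1 N) *s qcol A" by (intro qcol_right_complex)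
  then show "dlift A N = 0"
    using inner_qcol_tangent[OF A N] by (simp add: dlift_def dproj_def vec_eq_iff)
next
  define v where "v = qcol A"
  define d where "d = qcol (A \<otimes> N)"
  assume "dlift A N = 0"
  then have 0: "d $ r * cnj (v $ s) + v $ r * cnj (d $ s) = 0" for r s
    using inner_qcol_tangent[OF A N] by (simp add: dlift_def dproj_def vec_eq_iff v_def d_def)
  have "(norm v)\<^sup>2 = 1" using Sp2_norm_qcol[OF A] by (simp add: v_def)
  then have "(\<Sum>s\<in>UNIV. (cmod (v $ s))\<^sup>2) = 1"
    by (simp add: norm_vec_def L2_set_def sum_nonneg)
  then have "complex_of_real (\<Sum>s\<in>UNIV. (cmod (v $ s))\<^sup>2) = 1" by simp
  then have 1: "(\<Sum>s\<in>UNIV. cnj (v $ s) * v $ s) = 1"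
    by (simp only: of_real_sum complex_norm_square mult.commute)
  \<comment> \<open>Since d is orthogonal to v, the vanishing differential reads
    \<open>outer d v + outer v d = 0\<close>. Applying this matrix to the unit vector v shows that d
    is the complex multiple k of v.\<close>
  define k where "k = - (\<Sum>s\<in>UNIV. cnj (d $ s) * v $ s)"
  have dk: "d $ r = k * v $ r" for r
  proof -
    have "0 = (\<Sum>s\<in>UNIV. (d $ r * cnj (v $ s) + v $ r * cnj (d $ s)) * v $ s)" by (simp add: 0)
    also have "\<dots> = d $ r * (\<Sum>s\<in>UNIV. cnj (v $ s) * v $ s) + v $ r * (\<Sum>s\<in>UNIV. cnj (d $ s) * v $ s)"
      by (simp add: sum_distrib_left sum.distrib algebra_simps)
    finally have "d $ r + v $ r * (\<Sum>s\<in>UNIV. cnj (d $ s) * v $ s) = 0" by (simp only: 1 mult_1_right)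
    then show ?thesis by (simp add: k_def eq_neg_iff_add_eq_0 mult.commute)
  qed
  have "qcol (A \<otimes> N) = qcol (A \<otimes> qdiag (k, 0) 0)"
    using dk by (simp add: qcol_right_complex[of "qdiag (k, 0) 0" k] vec_eq_iff d_def v_def)
  then have e: "(A \<otimes> N) $ r $ 1 = (A \<otimes> qdiag (k, 0) 0) $ r $ 1" for r
    using exhaust_2[of r] by (auto simp: qcol_eq_iff)
  have "(qmat_adj A \<otimes> (A \<otimes> N)) $ r $ 1 = (qmat_adj A \<otimes> (A \<otimes> qdiag (k, 0) 0)) $ r $ 1" for r
    by (simp only: qmat_mult_nth[of "qmat_adj A"] e)
  then have "N $ r $ 1 = qdiag (k, 0) 0 $ r $ 1" for r by (simp only: Sp2_adj_mult[OF A])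
  from this[of 1] this[of 2] show "\<omega>1 N = 0 \<and> \<omega>2 N = 0 \<and> \<omega>3 N = 0"
    by (simp add: \<omega>1_def \<omega>2_def \<omega>3_def)
qed

lemma forms_diff: "\<omega>1 (M - N) = \<omega>1 M - \<omega>1 N" "\<omega>2 (M - N) = \<omega>2 M - \<omega>2 N" "\<omega>3 (M - N) = \<omega>3 M - \<omega>3 N"
  by (simp_all add: \<omega>1_def \<omega>2_def \<omega>3_def algebra_simps)

lemma dlift_eq_iff:
  assumes "A \<in> Sp2" "M \<in> sp2_algebra" "N \<in> sp2_algebra"
  shows "dlift A M = dlift A N \<longleftrightarrow> \<omega>1 M = \<omega>1 N \<and> \<omega>2 M = \<omega>2 N \<and> \<omega>3 M = \<omega>3 N"
  using dlift_eq_0_iff[OF assms(1) sp2_algebra_diff[OF assms(2,3)]]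
  by (simp add: dlift_diff[symmetric] forms_diff)

text \<open>The projection onto a line ignores the phase of the vector spanning it.\<close>

lemma dproj_cscale:
  assumes "cmod c = 1"
  shows "dproj (c *s v) (c *s w) = dproj v w"
proof -
  have o: "outer (c *s x) (c *s y) = outer x y" for x y
  proof -
    have "c * cnj c = 1" using assms by (simp add: complex_norm_square[symmetric])
    then have "(c * a) * cnj (c * b) = a * cnj b" for a b
      by (metis (no_types, opaque_lifting) complex_cnj_mult mult.assoc mult.commute mult_1)
    then show ?thesis by (simp add: vec_eq_iff)
  qed
  have "(c *s v) \<bullet> (c *s w) = Re (cnj c * c) * (v \<bullet> w)"
    by (simp add: inner_vec_def inner_complex_def sum_distrib_left algebra_simps)
  then have "(c *s v) \<bullet> (c *s w) = v \<bullet> w"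
    using assms by (simp add: complex_norm_square[symmetric] mult.commute)
  then show ?thesis by (simp add: dproj_def o)
qed

text \<open>Multiplying \<open>A' \<otimes> M\<close> on the right by the adjoint of G multiplies
  its first column by \<open>cnj c\<close>, the same phase that leads from the first column of A'
  back to that of A; by phase invariance the tangent vector below is unchanged.\<close>

lemma dlift_change_frame:
  assumes "cmod c = 1" "norm q = 1" "A' = A \<otimes> qdiag (c, 0) q" "qcol A' = c *s qcol A"
  defines "G \<equiv> qdiag (c, 0) q"
  shows "dlift A' M = dlift A (G \<otimes> M \<otimes> qmat_adj G)"
proof -
  have cc: "c * cnj c = 1" using assms(1) by (simp add: complex_norm_square[symmetric])
  have "qcol (A' \<otimes> M \<otimes> qmat_adj G) = cnj c *s qcol (A' \<otimes> M)"
    by (rule qcol_right_complex) (simp_all add: G_def qcnj_def zero_prod_def)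
  moreover have "A' \<otimes> M \<otimes> qmat_adj G = A \<otimes> (G \<otimes> M \<otimes> qmat_adj G)"
    by (simp add: assms(3) G_def qmat_mult_assoc)
  moreover have "qcol A = cnj c *s qcol A'"
    using cc by (simp add: assms(4) vec_eq_iff mult.commute mult.left_commute)
  ultimately show ?thesis
    using assms(1) by (simp add: dlift_def dproj_cscale)
qed

lemma forms_conj:
  fixes c :: complex and q :: quat
  defines "G \<equiv> qdiag (c, 0) q"
  shows "\<omega>3 (G \<otimes> M \<otimes> qmat_adj G) = c\<^sup>2 * \<omega>3 M"
    "(\<omega>1 (G \<otimes> M \<otimes> qmat_adj G), \<omega>2 (G \<otimes> M \<otimes> qmat_adj G)) = qmult (qmult q (\<omega>1 M, \<omega>2 M)) (cnj c, 0)"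
  by (simp_all add: G_def \<omega>1_def \<omega>2_def \<omega>3_def qmat_mult_nth qmult_def qcnj_def zero_prod_def
      power2_eq_square algebra_simps)

text \<open>In terms of \<open>\<omega>1, \<omega>2, \<omega>3\<close>, changing the lift of a point acts by an element of
  \<open>U(1) \<times> Sp(1)\<close>, which commutes with multiplication by \<open>\<i>\<close> and preserves inner products.\<close>

lemma tangent_lift_change:
  assumes A: "A \<in> Sp2" and A': "A' \<in> Sp2" and eq: "Sp2_proj A = Sp2_proj A'"
  obtains c q where "cmod c = 1" "norm q = 1"
    "\<And>P V M'. tangent_lift P V A' M' \<Longrightarrow> \<exists>M. tangent_lift P V A M \<and> \<omega>3 M = c\<^sup>2 * \<omega>3 M' \<and>
      (\<omega>1 M, \<omega>2 M) = qmult (qmult q (\<omega>1 M', \<omega>2 M')) (cnj c, 0)"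
proof -
  obtain c q where cq: "cmod c = 1" "norm q = 1" "A' = A \<otimes> qdiag (c, 0) q" "qcol A' = c *s qcol A"
    by (rule Sp2_fibre[OF A A' eq])
  show ?thesis
  proof (rule that[OF cq(1,2)])
    fix P V M' assume "tangent_lift P V A' M'"
    then have *: "Sp2_proj A' = P" "M' \<in> sp2_algebra" "V = dlift A' M'" by (auto simp: tangent_lift_iff)
    let ?G = "qdiag (c, 0) q"
    have "tangent_lift P V A (?G \<otimes> M' \<otimes> qmat_adj ?G)"
      using A eq * by (simp add: tangent_lift_iff sp2_algebra_conj dlift_change_frame[OF cq])
    then show "\<exists>M. tangent_lift P V A M \<and> \<omega>3 M = c\<^sup>2 * \<omega>3 M' \<and>
      (\<omega>1 M, \<omega>2 M) = qmult (qmult q (\<omega>1 M', \<omega>2 M')) (cnj c, 0)"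
      using forms_conj by blast
  qed
qed

lemma tangent_lift_unique:
  assumes "tangent_lift P V A M" "tangent_lift P V A N"
  shows "\<omega>1 M = \<omega>1 N" "\<omega>2 M = \<omega>2 N" "\<omega>3 M = \<omega>3 N"
  using assms by (auto simp: tangent_lift_iff dlift_eq_iff)

lemma tangent_lift_eqI:
  assumes "tangent_lift P V A M" "tangent_lift P W A N" "\<omega>1 M = \<omega>1 N" "\<omega>2 M = \<omega>2 N" "\<omega>3 M = \<omega>3 N"
  shows "V = W"
  using assms by (auto simp: tangent_lift_iff dlift_eq_iff)

text \<open>Well-definedness of the metric: any other lift yields the same value because left
  multiplication by q and right multiplication by \<open>cnj c\<close> preserve the inner product of
  the pairs (\<omega>1, \<omega>2).\<close>

lemma g_hor_lift:
  assumes "tangent_lift P V A M" "tangent_lift P W A N"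
  shows "g_hor P V W = Re (\<omega>1 M * cnj (\<omega>1 N)) + Re (\<omega>2 M * cnj (\<omega>2 N))"
  unfolding g_hor_def
proof (rule the_equality)
  fix r assume "\<exists>A M N. tangent_lift P V A M \<and> tangent_lift P W A N \<and>
    r = Re (\<omega>1 M * cnj (\<omega>1 N)) + Re (\<omega>2 M * cnj (\<omega>2 N))"
  then obtain A' M' N' where *: "tangent_lift P V A' M'" "tangent_lift P W A' N'"
    "r = Re (\<omega>1 M' * cnj (\<omega>1 N')) + Re (\<omega>2 M' * cnj (\<omega>2 N'))" by blast
  obtain c q where cq: "cmod c = 1" "norm q = 1"
    "\<And>P V M'. tangent_lift P V A' M' \<Longrightarrow> \<exists>M. tangent_lift P V A M \<and> \<omega>3 M = c\<^sup>2 * \<omega>3 M' \<and>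
      (\<omega>1 M, \<omega>2 M) = qmult (qmult q (\<omega>1 M', \<omega>2 M')) (cnj c, 0)"
    by (rule tangent_lift_change[of A A']) (use assms * in \<open>auto simp: tangent_lift_iff\<close>)
  have i: "Re (x * cnj y) + Re (x' * cnj y') = (x, x') \<bullet> (y, y')" for x y x' y' :: complex
    by (simp add: inner_prod_def inner_complex_def)
  have "(\<omega>1 M, \<omega>2 M) = qmult (qmult q (\<omega>1 M', \<omega>2 M')) (cnj c, 0)"
    "(\<omega>1 N, \<omega>2 N) = qmult (qmult q (\<omega>1 N', \<omega>2 N')) (cnj c, 0)"
    using cq(3)[OF *(1)] cq(3)[OF *(2)] tangent_lift_unique[OF assms(1)] tangent_lift_unique[OF assms(2)]
    by auto
  then show "r = Re (\<omega>1 M * cnj (\<omega>1 N)) + Re (\<omega>2 M * cnj (\<omega>2 N))"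
    by (simp only: i *(3)) (simp add: inner_qmult_left inner_qmult_right cq(1,2))
qed (use assms in blast)

lemma g_ver_lift:
  assumes "tangent_lift P V A M" "tangent_lift P W A N"
  shows "g_ver P V W = Re (\<omega>3 M * cnj (\<omega>3 N))"
  unfolding g_ver_def
proof (rule the_equality)
  fix r assume "\<exists>A M N. tangent_lift P V A M \<and> tangent_lift P W A N \<and> r = Re (\<omega>3 M * cnj (\<omega>3 N))"
  then obtain A' M' N' where *: "tangent_lift P V A' M'" "tangent_lift P W A' N'"
    "r = Re (\<omega>3 M' * cnj (\<omega>3 N'))" by blast
  obtain c q where cq: "cmod c = 1" "norm q = 1"
    "\<And>P V M'. tangent_lift P V A' M' \<Longrightarrow> \<exists>M. tangent_lift P V A M \<and> \<omega>3 M = c\<^sup>2 * \<omega>3 M' \<and>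
      (\<omega>1 M, \<omega>2 M) = qmult (qmult q (\<omega>1 M', \<omega>2 M')) (cnj c, 0)"
    by (rule tangent_lift_change[of A A']) (use assms * in \<open>auto simp: tangent_lift_iff\<close>)
  have cc: "c * cnj c = 1" using cq(1) by (simp add: complex_norm_square[symmetric])
  have e: "\<omega>3 M = c\<^sup>2 * \<omega>3 M'" "\<omega>3 N = c\<^sup>2 * \<omega>3 N'"
    using cq(3)[OF *(1)] cq(3)[OF *(2)] tangent_lift_unique[OF assms(1)] tangent_lift_unique[OF assms(2)]
    by auto
  have "\<omega>3 M * cnj (\<omega>3 N) = (c * cnj c)\<^sup>2 * (\<omega>3 M' * cnj (\<omega>3 N'))"
    by (simp add: e power2_eq_square ac_simps)
  then show "r = Re (\<omega>3 M * cnj (\<omega>3 N))" by (simp add: cc *(3))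
qed (use assms in blast)

text \<open>The definition asks for some lift with vanishing forms. Since vanishing of both forms is
  vanishing of the lift-independent \<open>g_hor\<close>, it holds for the given lift as
  well.\<close>

lemma vertical_space_lift:
  assumes "tangent_lift P V A M"
  shows "V \<in> vertical_space P \<longleftrightarrow> \<omega>1 M = 0 \<and> \<omega>2 M = 0"
proof
  assume "V \<in> vertical_space P"
  then obtain A' M' where *: "tangent_lift P V A' M'" "\<omega>1 M' = 0" "\<omega>2 M' = 0"
    by (auto simp: vertical_space_def)
  then have "g_hor P V V = 0" using g_hor_lift[OF *(1) *(1)] by simp
  then have "(Re (\<omega>1 M))\<^sup>2 + (Im (\<omega>1 M))\<^sup>2 + ((Re (\<omega>2 M))\<^sup>2 + (Im (\<omega>2 M))\<^sup>2) = 0"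
    using g_hor_lift[OF assms assms] by (simp add: power2_eq_square)
  then show "\<omega>1 M = 0 \<and> \<omega>2 M = 0"
    by (smt (verit, best) complex_eq_iff zero_complex.simps zero_le_power2 power_eq_0_iff)
qed (use assms in \<open>auto simp: vertical_space_def\<close>)

lemma horizontal_space_lift:
  assumes "tangent_lift P V A M"
  shows "V \<in> horizontal_space P \<longleftrightarrow> \<omega>3 M = 0"
proof
  assume "V \<in> horizontal_space P"
  then obtain A' M' where *: "tangent_lift P V A' M'" "\<omega>3 M' = 0"
    by (auto simp: horizontal_space_def)
  then have "g_ver P V V = 0" using g_ver_lift[OF *(1) *(1)] by simp
  then have "(Re (\<omega>3 M))\<^sup>2 + (Im (\<omega>3 M))\<^sup>2 = 0"
    using g_ver_lift[OF assms assms] by (simp add: power2_eq_square)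
  then show "\<omega>3 M = 0" by (simp add: complex_eq_iff sum_power2_eq_zero_iff)
qed (use assms in \<open>auto simp: horizontal_space_def\<close>)

lemma sp2_algebra_exists: "\<exists>N\<in>sp2_algebra. \<omega>1 N = x \<and> \<omega>2 N = y \<and> \<omega>3 N = z"
proof -
  define N :: qmat where "N = (\<chi> r s. if r = 1 then if s = 1 then (0, cnj z) else (- cnj x / sqrt 2, y / sqrt 2)
      else if s = 1 then (x / sqrt 2, y / sqrt 2) else 0)"
  have "N \<in> sp2_algebra" by (simp add: N_def sp2_algebra_def qmat_eq_iff qcnj_def zero_prod_def)
  moreover have "\<omega>1 N = x \<and> \<omega>2 N = y \<and> \<omega>3 N = z"
    by (simp add: N_def \<omega>1_def \<omega>2_def \<omega>3_def)
  ultimately show ?thesis by blast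
qed

text \<open>The description defining J has a unique solution: existence because the three forms take
  arbitrary values on the Lie algebra, uniqueness because the change of lift is complex linear in
  (\<omega>1, \<omega>2, \<omega>3).\<close>

lemma J_nk_lift:
  assumes M: "tangent_lift P V A M" and N: "tangent_lift P (J_nk P V) A N"
  shows "\<omega>1 N = \<i> * \<omega>1 M" "\<omega>2 N = \<i> * \<omega>2 M" "\<omega>3 N = \<i> * \<omega>3 M"
proof -
  obtain N0 where N0: "N0 \<in> sp2_algebra" "\<omega>1 N0 = \<i> * \<omega>1 M" "\<omega>2 N0 = \<i> * \<omega>2 M" "\<omega>3 N0 = \<i> * \<omega>3 M"
    using sp2_algebra_exists by metis
  have l0: "tangent_lift P (dlift A N0) A N0" using M N0(1) by (simp add: tangent_lift_iff)
  have "J_nk P V = dlift A N0"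
    unfolding J_nk_def
  proof (rule the_equality)
    show "\<exists>B M N. tangent_lift P V B M \<and> tangent_lift P (dlift A N0) B N \<and>
      \<omega>1 N = \<i> * \<omega>1 M \<and> \<omega>2 N = \<i> * \<omega>2 M \<and> \<omega>3 N = \<i> * \<omega>3 M"
      using M l0 N0 by blast
    fix W assume "\<exists>A M N. tangent_lift P V A M \<and> tangent_lift P W A N \<and>
      \<omega>1 N = \<i> * \<omega>1 M \<and> \<omega>2 N = \<i> * \<omega>2 M \<and> \<omega>3 N = \<i> * \<omega>3 M"
    then obtain A' M' N' where *: "tangent_lift P V A' M'" "tangent_lift P W A' N'"
      "\<omega>1 N' = \<i> * \<omega>1 M'" "\<omega>2 N' = \<i> * \<omega>2 M'" "\<omega>3 N' = \<i> * \<omega>3 M'" by blast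
    obtain c q where cq: "cmod c = 1" "norm q = 1"
      "\<And>P V M'. tangent_lift P V A' M' \<Longrightarrow> \<exists>M. tangent_lift P V A M \<and> \<omega>3 M = c\<^sup>2 * \<omega>3 M' \<and>
        (\<omega>1 M, \<omega>2 M) = qmult (qmult q (\<omega>1 M', \<omega>2 M')) (cnj c, 0)"
      by (rule tangent_lift_change[of A A']) (use M * in \<open>auto simp: tangent_lift_iff\<close>)
    have mM: "\<omega>3 M = c\<^sup>2 * \<omega>3 M'" "(\<omega>1 M, \<omega>2 M) = qmult (qmult q (\<omega>1 M', \<omega>2 M')) (cnj c, 0)"
      using cq(3)[OF *(1)] tangent_lift_unique[OF M] by auto
    obtain K where K: "tangent_lift P W A K" "\<omega>3 K = c\<^sup>2 * \<omega>3 N'"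
      "(\<omega>1 K, \<omega>2 K) = qmult (qmult q (\<omega>1 N', \<omega>2 N')) (cnj c, 0)"
      using cq(3)[OF *(2)] by blast
    have "\<omega>1 K = \<i> * \<omega>1 M" "\<omega>2 K = \<i> * \<omega>2 M" "\<omega>3 K = \<i> * \<omega>3 M"
      using mM K(2,3) *(3-5) by (simp_all add: qmult_def ring_distribs mult_ac)
    then show "W = dlift A N0"
      by (intro tangent_lift_eqI[OF K(1) l0]) (simp_all add: N0)
  qed
  then show "\<omega>1 N = \<i> * \<omega>1 M" "\<omega>2 N = \<i> * \<omega>2 M" "\<omega>3 N = \<i> * \<omega>3 M"
    using tangent_lift_unique[OF N, of N0] l0 N0 by auto
qed

section \<open>Structure equations of a frame\<close>

lemma linear_forms: "linear \<omega>1" "linear \<omega>2" "linear \<omega>3" "linear \<tau>_form" "linear \<rho>1" "linear \<rho>2"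
  by (rule linearI; simp add: \<omega>1_def \<omega>2_def \<omega>3_def \<tau>_form_def \<rho>1_def \<rho>2_def algebra_simps)+

lemma pullback_mc_eq: "pullback_mc F q \<xi> = qmat_adj (F q) \<otimes> pderiv_dir \<xi> F q"
  by (simp add: pullback_mc_def maurer_cartan_def pderiv_dir_def)

lemma pullback_mc_Re_Im:
  assumes "F differentiable (at q)"
  shows "pullback_mc F q \<xi> = Re \<xi> *\<^sub>R pullback_mc F q 1 + Im \<xi> *\<^sub>R pullback_mc F q \<i>"
  unfolding pullback_mc_eq pderiv_dir_Re_Im[OF assms, of \<xi>]
  by (simp add: qmat_mult_simps bilinear_rmul[OF bilinear_qmat_mult])

lemma pullback_mc_complex_linear:
  assumes "F differentiable (at q)" "linear \<phi>" "\<phi> (pullback_mc F q \<i>) = \<i> * \<phi> (pullback_mc F q 1)"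
  shows "\<phi> (pullback_mc F q \<xi>) = \<phi> (pullback_mc F q 1) * \<xi>"
  unfolding pullback_mc_Re_Im[OF assms(1), of \<xi>] linear_add[OF assms(2)] linear_scale[OF assms(2)] assms(3)
  by (simp add: complex_eq_iff algebra_simps)

text \<open>Differentiating the defining relation of Sp(2) along F gives skewness.\<close>

lemma pullback_mc_sp2_algebra:
  assumes "open D" "q \<in> D" "\<And>x. x \<in> D \<Longrightarrow> F x \<in> Sp2" "F differentiable (at q)"
  shows "pullback_mc F q \<xi> \<in> sp2_algebra"
proof -
  have adj: "(\<lambda>x. qmat_adj (F x)) differentiable (at q)"
    using bounded_linear.has_derivative[OF linear_conv_bounded_linear[THEN iffD1, OF linear_qmat_adj]] assms(4)
    by (auto simp: differentiable_def)
  have "pderiv_dir \<xi> (\<lambda>x. qmat_adj (F x) \<otimes> F x) q = pderiv_dir \<xi> (\<lambda>x. qid) q"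
    by (rule pderiv_dir_cong[OF assms(1,2)]) (simp add: Sp2_adj_mult assms(3))
  then have "qmat_adj (F q) \<otimes> pderiv_dir \<xi> F q + qmat_adj (pderiv_dir \<xi> F q) \<otimes> F q = 0"
    by (simp add: pderiv_dir_bilinear[OF bilinear_qmat_mult adj assms(4)]
        pderiv_dir_linear[OF linear_qmat_adj assms(4)])
  then show ?thesis
    by (simp add: sp2_algebra_def pullback_mc_eq qmat_adj_mult eq_neg_iff_add_eq_0 add.commute)
qed

lemma pullback_mc_tangent_lift:
  assumes "open D" "q \<in> D" "\<And>x. x \<in> D \<Longrightarrow> F x \<in> Sp2" "F differentiable (at q)"
    and f: "\<And>x. x \<in> D \<Longrightarrow> Sp2_proj (F x) = f x"
  shows "tangent_lift (f q) (pderiv_dir \<xi> f q) (F q) (pullback_mc F q \<xi>)"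
proof -
  have "(F has_derivative (\<lambda>\<xi>. pderiv_dir \<xi> F q)) (at q)"
    using assms(4) by (simp add: pderiv_dir_def frechet_derivative_works)
  from has_derivative_compose[OF this has_derivative_Sp2_proj[OF assms(3)[OF assms(2)]]]
  have "pderiv_dir \<xi> (\<lambda>x. Sp2_proj (F x)) q = dproj (qcol (F q)) (qcol (pderiv_dir \<xi> F q))"
    by (rule pderiv_dir_eqI)
  also have "pderiv_dir \<xi> (\<lambda>x. Sp2_proj (F x)) q = pderiv_dir \<xi> f q"
    by (rule pderiv_dir_cong[OF assms(1,2) f])
  finally show ?thesis
    using assms pullback_mc_sp2_algebra[OF assms(1-4)]
    by (simp add: tangent_lift_iff dlift_def pullback_mc_eq Sp2_mult_adj)
qed

lemma smooth_on_pullback_mc: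
  assumes "open D" "smooth_on D F"
  shows "smooth_on D (\<lambda>q. pullback_mc F q \<xi>)"
  unfolding pullback_mc_eq
  by (rule smooth_on_bilinear[OF assms(1) bilinear_qmat_mult
        smooth_on_linear[OF assms(1) linear_qmat_adj assms(2)] smooth_on_pderiv_dir[OF assms]])

text \<open>The equation d\<Omega> + \<Omega> \<and> \<Omega> = 0 on the two coordinate fields. The
  second derivatives of F cancel by symmetry, and the products of first derivatives are rewritten
  with dF = F \<Omega> and the skewness of \<Omega>.\<close>

lemma maurer_cartan_structure_equation:
  assumes D: "open D" "q \<in> D" and F: "smooth_on D F" "\<And>x. x \<in> D \<Longrightarrow> F x \<in> Sp2"
  shows "pderiv_dir 1 (\<lambda>x. pullback_mc F x \<i>) q - pderiv_dir \<i> (\<lambda>x. pullback_mc F x 1) q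
    = pullback_mc F q \<i> \<otimes> pullback_mc F q 1 - pullback_mc F q 1 \<otimes> pullback_mc F q \<i>"
proof -
  let ?M = "pullback_mc F q"
  have dF: "F differentiable (at q)" by (rule smooth_on_differentiable[OF D(1) F(1) D(2)])
  have adj: "(\<lambda>x. qmat_adj (F x)) differentiable (at q)"
    by (rule smooth_on_differentiable[OF D(1) smooth_on_linear[OF D(1) linear_qmat_adj F(1)] D(2)])
  have d: "pderiv_dir u (\<lambda>x. pullback_mc F x v) q
    = qmat_adj (F q) \<otimes> pderiv_dir u (pderiv_dir v F) q + qmat_adj (pderiv_dir u F q) \<otimes> pderiv_dir v F q" for u v
    using smooth_on_differentiable[OF D(1) smooth_on_pderiv_dir[OF D(1) F(1)] D(2)]
    by (simp add: pullback_mc_eq pderiv_dir_bilinear[OF bilinear_qmat_mult adj]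
        pderiv_dir_linear[OF linear_qmat_adj dF])
  have e: "qmat_adj (pderiv_dir u F q) \<otimes> pderiv_dir v F q = - (?M u \<otimes> ?M v)" for u v
  proof -
    have "pderiv_dir u F q = F q \<otimes> ?M u" for u
      by (simp add: pullback_mc_eq Sp2_mult_adj F(2)[OF D(2)])
    then have "qmat_adj (pderiv_dir u F q) \<otimes> pderiv_dir v F q = qmat_adj (?M u) \<otimes> ?M v"
      by (simp add: qmat_adj_mult qmat_mult_assoc Sp2_adj_mult F(2)[OF D(2)])
    also have "qmat_adj (?M u) = - ?M u"
      using pullback_mc_sp2_algebra[OF D F(2) dF, of u] by (simp add: sp2_algebra_def)
    finally show ?thesis by (simp add: qmat_mult_simps)
  qed
  show ?thesis
    unfolding d e smooth_on_pderiv_dir_commute[OF D F(1)] by simp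
qed

text \<open>With X and Y the values of \<Omega> on the coordinate fields of x and y, S is the value
  of d\<Omega> on this pair, so these are the structure equations on the bundle \<omega>2 = 0. The
  halves come from products of two entries carrying 1 / sqrt 2.\<close>

lemma forms_commutator:
  assumes X: "X \<in> sp2_algebra" "\<omega>2 X = 0" and Y: "Y \<in> sp2_algebra" "\<omega>2 Y = 0"
  defines "S \<equiv> Y \<otimes> X - X \<otimes> Y"
  shows "\<omega>1 S = \<i> * ((\<rho>1 X - \<rho>2 X) * \<omega>1 Y - (\<rho>1 Y - \<rho>2 Y) * \<omega>1 X)"
    "\<omega>2 S = cnj (\<omega>1 Y) * cnj (\<omega>3 X) - cnj (\<omega>1 X) * cnj (\<omega>3 Y) + \<tau>_form Y * \<omega>1 X - \<tau>_form X * \<omega>1 Y"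
    "\<omega>3 S = \<i> * ((- 2 * \<rho>1 X) * \<omega>3 Y - (- 2 * \<rho>1 Y) * \<omega>3 X)"
    "\<tau>_form S = \<i> * ((2 * \<rho>2 X) * \<tau>_form Y - (2 * \<rho>2 Y) * \<tau>_form X)"
    "\<rho>1 S = Im (\<omega>3 X * cnj (\<omega>3 Y) - \<omega>3 Y * cnj (\<omega>3 X)) + Im (cnj (\<omega>1 X) * \<omega>1 Y - cnj (\<omega>1 Y) * \<omega>1 X) / 2"
    "\<rho>2 S = Im (cnj (\<tau>_form X) * \<tau>_form Y - cnj (\<tau>_form Y) * \<tau>_form X)
      + Im (\<omega>1 X * cnj (\<omega>1 Y) - \<omega>1 Y * cnj (\<omega>1 X)) / 2"
proof -
  have r: "complex_of_real (sqrt 2) * complex_of_real (sqrt 2) = 2" by (simp flip: of_real_mult)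
  note c = sp2_algebra_components[OF X(1), unfolded X(2)] sp2_algebra_components[OF Y(1), unfolded Y(2)]
  have S: "S $ i $ j = qmult (Y$i$1) (X$1$j) + qmult (Y$i$2) (X$2$j) - (qmult (X$i$1) (Y$1$j) + qmult (X$i$2) (Y$2$j))" for i j
    by (simp add: S_def qmat_mult_nth)
  have S21: "S $ 2 $ 1 = (\<i> * ((\<rho>1 X - \<rho>2 X) * \<omega>1 Y - (\<rho>1 Y - \<rho>2 Y) * \<omega>1 X) / sqrt 2,
     (cnj (\<omega>1 Y) * cnj (\<omega>3 X) - cnj (\<omega>1 X) * cnj (\<omega>3 Y) + \<tau>_form Y * \<omega>1 X - \<tau>_form X * \<omega>1 Y) / sqrt 2)"
    unfolding S c by (simp add: qmult_def add_divide_distrib diff_divide_distrib algebra_simps)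
  show "\<omega>1 S = \<i> * ((\<rho>1 X - \<rho>2 X) * \<omega>1 Y - (\<rho>1 Y - \<rho>2 Y) * \<omega>1 X)"
    "\<omega>2 S = cnj (\<omega>1 Y) * cnj (\<omega>3 X) - cnj (\<omega>1 X) * cnj (\<omega>3 Y) + \<tau>_form Y * \<omega>1 X - \<tau>_form X * \<omega>1 Y"
    unfolding \<omega>1_def[of S] \<omega>2_def[of S] S21 by simp_all
  show "\<omega>3 S = \<i> * ((- 2 * \<rho>1 X) * \<omega>3 Y - (- 2 * \<rho>1 Y) * \<omega>3 X)"
    "\<rho>1 S = Im (\<omega>3 X * cnj (\<omega>3 Y) - \<omega>3 Y * cnj (\<omega>3 X)) + Im (cnj (\<omega>1 X) * \<omega>1 Y - cnj (\<omega>1 Y) * \<omega>1 X) / 2"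
    unfolding \<omega>3_def[of S] \<rho>1_def[of S] S c using r
    by (simp_all add: qmult_def field_simps)
  show "\<tau>_form S = \<i> * ((2 * \<rho>2 X) * \<tau>_form Y - (2 * \<rho>2 Y) * \<tau>_form X)"
    "\<rho>2 S = Im (cnj (\<tau>_form X) * \<tau>_form Y - cnj (\<tau>_form Y) * \<tau>_form X)
      + Im (\<omega>1 X * cnj (\<omega>1 Y) - \<omega>1 Y * cnj (\<omega>1 X)) / 2"
    unfolding \<tau>_form_def[of S] \<rho>2_def[of S] S c using r
    by (simp_all add: qmult_def field_simps)
qed

text \<open>If \<open>d(a dz) = \<i> \<eta> \<and> a dz\<close> with \<open>\<eta>\<close> real, then \<open>d log \<bar>a\<bar> \<circ> \<i>\<close> differs from \<open>\<eta>\<close> by the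
  closed form \<open>Im (da / a)\<close>, so that \<open>\<Delta> log \<bar>a\<bar>\<^sup>2\<close> is \<open>-2 d\<eta>\<close>.\<close>

lemma plane_lap_ln_cmod:
  fixes a :: "complex \<Rightarrow> complex" and \<eta>1 \<eta>2 :: "complex \<Rightarrow> real"
  assumes D: "open D" "p \<in> D" and a: "smooth_on D a" "\<And>q. q \<in> D \<Longrightarrow> a q \<noteq> 0"
    and \<eta>: "smooth_on D \<eta>1" "smooth_on D \<eta>2"
    and eq: "\<And>q. q \<in> D \<Longrightarrow> \<i> * pderiv_dir 1 a q - pderiv_dir \<i> a q = \<i> * (\<eta>1 q * (\<i> * a q) - \<eta>2 q * a q)"
  shows "plane_lap (\<lambda>q. ln ((cmod (a q))\<^sup>2)) p = - 2 * (pderiv_dir 1 \<eta>2 p - pderiv_dir \<i> \<eta>1 p)"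
proof -
  have der: "(a has_derivative (\<lambda>u. pderiv_dir u a q)) (at q)"
    "(pderiv_dir v a has_derivative (\<lambda>u. pderiv_dir u (pderiv_dir v a) q)) (at q)" if "q \<in> D" for q v
    using smooth_on_has_derivative D(1) a(1) smooth_on_pderiv_dir that by blast+
  have L1: "pderiv_dir u (\<lambda>q. ln ((cmod (a q))\<^sup>2)) q = 2 * Re (pderiv_dir u a q / a q)" if q: "q \<in> D" for u q
  proof -
    have pos: "(Re (a q))\<^sup>2 + (Im (a q))\<^sup>2 > 0" using a(2)[OF q] by (simp add: complex_neq_0)
    have "((\<lambda>q. (Re (a q))\<^sup>2 + (Im (a q))\<^sup>2) has_derivative
      (\<lambda>u. 2 * (Re (a q) * Re (pderiv_dir u a q) + Im (a q) * Im (pderiv_dir u a q)))) (at q)"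
      by (auto intro!: derivative_eq_intros der(1)[OF q] simp: algebra_simps)
    from DERIV_compose_FDERIV[OF DERIV_ln_divide[OF pos] this]
    have "((\<lambda>q. ln ((cmod (a q))\<^sup>2)) has_derivative
      (\<lambda>u. 2 * (Re (a q) * Re (pderiv_dir u a q) + Im (a q) * Im (pderiv_dir u a q))
        * (1 / ((Re (a q))\<^sup>2 + (Im (a q))\<^sup>2)))) (at q)"
      by (simp add: cmod_power2)
    from pderiv_dir_eqI[OF this] show ?thesis
      by (simp add: Re_divide add_divide_distrib algebra_simps)
  qed
  have sL: "2 * Re (pderiv_dir 1 a q / a q) = 2 * (Im (pderiv_dir \<i> a q / a q) - \<eta>2 q)"
    "2 * Re (pderiv_dir \<i> a q / a q) = 2 * (\<eta>1 q - Im (pderiv_dir 1 a q / a q))" if q: "q \<in> D" for q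
  proof -
    \<comment> \<open>After division by a, the imaginary and real parts of the equation express Re
      (da / a) through Im (da / a) and \<eta>.\<close>
    define x y where "x = pderiv_dir 1 a q / a q" and "y = pderiv_dir \<i> a q / a q"
    have "\<i> * x - y = \<i> * (\<eta>1 q * \<i> - \<eta>2 q)"
      using eq[OF q] a(2)[OF q] by (simp add: x_def y_def field_simps)
    then have "Re x = Im y - \<eta>2 q" "Re y = \<eta>1 q - Im x" by (auto simp: complex_eq_iff)
    then show "2 * Re (pderiv_dir 1 a q / a q) = 2 * (Im (pderiv_dir \<i> a q / a q) - \<eta>2 q)"
      "2 * Re (pderiv_dir \<i> a q / a q) = 2 * (\<eta>1 q - Im (pderiv_dir 1 a q / a q))"
      by (simp_all only: x_def y_def)
  qed
  have psi: "((\<lambda>q. Im (pderiv_dir v a q / a q)) has_derivative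
      (\<lambda>u. Im (pderiv_dir u (pderiv_dir v a) p / a p - pderiv_dir v a p * pderiv_dir u a p / (a p)\<^sup>2))) (at p)" for v
  proof -
    have "((\<lambda>q. pderiv_dir v a q / a q) has_derivative
      (\<lambda>u. pderiv_dir u (pderiv_dir v a) p / a p - pderiv_dir v a p * pderiv_dir u a p / (a p)\<^sup>2)) (at p)"
      using a(2)[OF D(2)]
      by (rule has_derivative_eq_rhs[OF has_derivative_divide[OF der(2)[OF D(2)] der(1)[OF D(2)]]])
        (use a(2)[OF D(2)] in \<open>auto simp: fun_eq_iff field_simps power2_eq_square\<close>)
    from bounded_linear.has_derivative[OF bounded_linear_Im this] show ?thesis .
  qed
  have e: "(\<eta>1 has_derivative (\<lambda>u. pderiv_dir u \<eta>1 p)) (at p)" "(\<eta>2 has_derivative (\<lambda>u. pderiv_dir u \<eta>2 p)) (at p)"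
    using smooth_on_has_derivative[OF D(1) _ D(2)] \<eta> by blast+
  have 1: "pderiv_dir 1 (pderiv_dir 1 (\<lambda>q. ln ((cmod (a q))\<^sup>2))) p
    = 2 * (Im (pderiv_dir 1 (pderiv_dir \<i> a) p / a p - pderiv_dir \<i> a p * pderiv_dir 1 a p / (a p)\<^sup>2) - pderiv_dir 1 \<eta>2 p)"
    (is "_ = ?r1")
  proof -
    have "pderiv_dir 1 (pderiv_dir 1 (\<lambda>q. ln ((cmod (a q))\<^sup>2))) p
      = pderiv_dir 1 (\<lambda>q. 2 * (Im (pderiv_dir \<i> a q / a q) - \<eta>2 q)) p"
      by (rule pderiv_dir_cong[OF D]) (simp only: L1 sL(1))
    also have "\<dots> = ?r1"
      by (rule pderiv_dir_eqI[OF has_derivative_mult_right[OF has_derivative_diff[OF psi e(2)]]])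
    finally show ?thesis .
  qed
  have 2: "pderiv_dir \<i> (pderiv_dir \<i> (\<lambda>q. ln ((cmod (a q))\<^sup>2))) p
    = 2 * (pderiv_dir \<i> \<eta>1 p - Im (pderiv_dir \<i> (pderiv_dir 1 a) p / a p - pderiv_dir 1 a p * pderiv_dir \<i> a p / (a p)\<^sup>2))"
    (is "_ = ?r2")
  proof -
    have "pderiv_dir \<i> (pderiv_dir \<i> (\<lambda>q. ln ((cmod (a q))\<^sup>2))) p
      = pderiv_dir \<i> (\<lambda>q. 2 * (\<eta>1 q - Im (pderiv_dir 1 a q / a q))) p"
      by (rule pderiv_dir_cong[OF D]) (simp only: L1 sL(2))
    also have "\<dots> = ?r2"
      by (rule pderiv_dir_eqI[OF has_derivative_mult_right[OF has_derivative_diff[OF e(1) psi]]])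
    finally show ?thesis .
  qed
  \<comment> \<open>The mixed second derivatives of a agree and the quadratic terms are equal, so
    that Im (da / a) drops out of the sum.\<close>
  show ?thesis
    unfolding plane_lap_def 1 2 smooth_on_pderiv_dir_commute[OF D a(1)]
    by (simp add: algebra_simps)
qed

section \<open>Adapted frames\<close>

text \<open>A right inverse of \<open>qcol\<close> with zero second column; it makes quaternionic
  matrix algebra available for vectors in \<complex>^4.\<close>

definition qmat_of_col :: "complex^4 \<Rightarrow> qmat" where
  "qmat_of_col v = (\<chi> r s. if s = 1 then if r = 1 then (v $ 1, v $ 2) else (v $ 3, v $ 4) else 0)"

lemma qmat_of_col_nth [simp]: "qmat_of_col v $ 1 $ 1 = (v $ 1, v $ 2)" "qmat_of_col v $ 2 $ 1 = (v $ 3, v $ 4)"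
  "qmat_of_col v $ 1 $ 2 = 0" "qmat_of_col v $ 2 $ 2 = 0"
  by (simp_all add: qmat_of_col_def)

lemma qcol_qmat_of_col [simp]: "qcol (qmat_of_col v) = v"
  by (simp add: vec4_eq_iff)

lemma linear_qmat_of_col: "linear qmat_of_col"
  by (rule linearI) (simp_all add: qmat_eq_iff zero_prod_def)

text \<open>Gram-Schmidt, to be applied to a lift \<open>h\<close> of the curve and \<open>k = \<partial>\<^sub>x h\<close>: then \<open>\<omega>1(\<partial>\<^sub>x) > 0\<close> and
  \<open>\<omega>2(\<partial>\<^sub>x) = 0\<close>, so that \<open>\<omega>2\<close> vanishes identically along a \<open>J\<close>-holomorphic curve.\<close>

definition gs_residue :: "complex^4 \<Rightarrow> complex^4 \<Rightarrow> qmat" where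
  "gs_residue h k = qmat_of_col k - qmat_of_col h \<otimes> (qmat_adj (qmat_of_col h) \<otimes> qmat_of_col k)"

text \<open>The elementary matrix on the right moves the first column of the residue into the second
  place.\<close>

definition gs_frame :: "complex^4 \<Rightarrow> complex^4 \<Rightarrow> qmat" where
  "gs_frame h k = qmat_of_col h
     + inverse (norm (gs_residue h k)) *\<^sub>R (gs_residue h k \<otimes> (\<chi> r s. if r = 1 \<and> s = 2 then (1, 0) else 0))"

text \<open>The last claim is what makes the frame adapted: the (2,1) entry of its product with k is
  the positive real |residue|, whose j-component, and with it \<omega>2 in the x-direction, is
  zero.\<close>

lemma gs_frame:
  assumes h: "norm h = 1" and nz: "gs_residue h k \<noteq> 0"
  shows "gs_frame h k \<in> Sp2" "qcol (gs_frame h k) = h"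
    "qmat_adj (gs_frame h k) \<otimes> qmat_of_col k = (\<chi> r s. if s = 1 then
       if r = 1 then (qmat_adj (qmat_of_col h) \<otimes> qmat_of_col k) $ 1 $ 1
       else (complex_of_real (norm (gs_residue h k)), 0) else 0)"
proof -
  let ?F = "gs_frame h k"
  define W where "W = gs_residue h k"
  define n where "n = norm W"
  define h1 h2 k1 k2 where "h1 = (h $ 1, h $ 2)" and "h2 = (h $ 3, h $ 4)"
    and "k1 = (k $ 1, k $ 2)" and "k2 = (k $ 3, k $ 4)"
  define m where "m = qmult (qcnj h1) k1 + qmult (qcnj h2) k2"
  define w1 w2 where "w1 = k1 - qmult h1 m" and "w2 = k2 - qmult h2 m"
  have n0: "n > 0" using nz by (simp add: n_def W_def)
  have W: "W $ 1 $ 1 = w1" "W $ 2 $ 1 = w2" "W $ 1 $ 2 = 0" "W $ 2 $ 2 = 0"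
    by (simp_all add: W_def gs_residue_def qmat_mult_nth w1_def w2_def m_def h1_def h2_def k1_def k2_def)
  have F: "?F $ 1 $ 1 = h1" "?F $ 2 $ 1 = h2" "?F $ 1 $ 2 = inverse n *\<^sub>R w1" "?F $ 2 $ 2 = inverse n *\<^sub>R w2"
    unfolding gs_frame_def W_def[symmetric] n_def[symmetric]
    by (simp_all add: qmat_mult_nth W h1_def h2_def)
  show "qcol ?F = h" by (simp add: vec4_eq_iff F h1_def h2_def)
  have "(norm h1)\<^sup>2 + (norm h2)\<^sup>2 = (norm h)\<^sup>2"
    using norm_qcol[of "qmat_of_col h"] by (simp add: h1_def h2_def)
  then have hh: "qmult (qcnj h1) h1 + qmult (qcnj h2) h2 = (1, 0)"
    using h by (simp add: qmult_qcnj_self flip: of_real_power of_real_add)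
  have sub: "qmult x (y - z) = qmult x y - qmult x z" for x y z
    by (simp add: qmult_def minus_prod_def algebra_simps)
  have "qmult (qcnj h1) w1 + qmult (qcnj h2) w2 = m - qmult (qmult (qcnj h1) h1 + qmult (qcnj h2) h2) m"
    by (simp add: w1_def w2_def sub m_def qmult_add qmult_assoc)
  then have hw: "qmult (qcnj h1) w1 + qmult (qcnj h2) w2 = 0" by (simp add: hh)
  have "qmult (qcnj w1) h1 + qmult (qcnj w2) h2 = qcnj (qmult (qcnj h1) w1 + qmult (qcnj h2) w2)"
    by (simp add: qcnj_add qcnj_qmult)
  then have wh: "qmult (qcnj w1) h1 + qmult (qcnj w2) h2 = 0" by (simp add: hw)
  have "n\<^sup>2 = (norm w1)\<^sup>2 + (norm w2)\<^sup>2"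
    by (simp add: n_def power2_norm_eq_inner inner_vec_def sum_2 W)
  then have ww: "qmult (qcnj w1) w1 + qmult (qcnj w2) w2 = (complex_of_real (n\<^sup>2), 0)"
    by (simp add: qmult_qcnj_self flip: of_real_power of_real_add)
  have "qmat_adj ?F \<otimes> ?F = qid"
    unfolding qmat_eq_iff
    using n0 hh hw wh ww
    by (simp add: qmat_mult_nth F qcnj_scaleR qmult_scaleR power2_eq_square flip: scaleR_right_distrib)
      (simp add: scaleR_conv_of_real field_simps)
  then show "?F \<in> Sp2" by (simp add: Sp2_iff)
  have "qmult (qcnj w1) k1 + qmult (qcnj w2) k2
    = (qmult (qcnj w1) w1 + qmult (qcnj w2) w2) + qmult (qmult (qcnj w1) h1 + qmult (qcnj w2) h2) m"
    by (simp add: w1_def w2_def sub qmult_add qmult_assoc)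
  then have wk: "qmult (qcnj w1) k1 + qmult (qcnj w2) k2 = (complex_of_real (n\<^sup>2), 0)"
    by (simp add: wh ww)
  show "qmat_adj ?F \<otimes> qmat_of_col k = (\<chi> r s. if s = 1 then
       if r = 1 then (qmat_adj (qmat_of_col h) \<otimes> qmat_of_col k) $ 1 $ 1
       else (complex_of_real (norm (gs_residue h k)), 0) else 0)"
    unfolding W_def[symmetric] n_def[symmetric] qmat_eq_iff
    using n0 wk
    by (simp add: qmat_mult_nth F qcnj_scaleR qmult_scaleR m_def h1_def h2_def k1_def k2_def power2_eq_square
        flip: scaleR_right_distrib)
      (simp add: scaleR_conv_of_real field_simps)
qed

lemma smooth_on_gs_frame:
  assumes D: "open D" and h: "smooth_on D h" and k: "smooth_on D k"
    and nz: "\<And>q. q \<in> D \<Longrightarrow> gs_residue (h q) (k q) \<noteq> 0"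
  shows "smooth_on D (\<lambda>q. gs_frame (h q) (k q))"
proof -
  note mul = smooth_on_bilinear[OF D bilinear_qmat_mult]
  note H = smooth_on_linear[OF D linear_qmat_of_col h]
  note K = smooth_on_linear[OF D linear_qmat_of_col k]
  have W: "smooth_on D (\<lambda>q. gs_residue (h q) (k q))"
    unfolding gs_residue_def
    by (intro smooth_on_diff D H K mul smooth_on_linear[OF D linear_qmat_adj])
  have "bilinear ((\<bullet>) :: qmat \<Rightarrow> qmat \<Rightarrow> real)"
    by (simp add: bilinear_conv_bounded_bilinear bounded_bilinear_inner)
  from smooth_on_bilinear[OF D this W W] have "smooth_on D (\<lambda>q. inverse (norm (gs_residue (h q) (k q))))"
    unfolding norm_eq_sqrt_inner
    by (intro smooth_on_inverse smooth_on_sqrt D) (use nz in auto)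
  then show ?thesis
    unfolding gs_frame_def
    by (intro smooth_on_add D H smooth_on_scaleR mul W smooth_on_const)
qed

lemma proj_point_mult_vec: "proj_point v *v u = ((\<Sum>s\<in>UNIV. cnj (v $ s) * u $ s) / (norm v)\<^sup>2) *s v"
  by (simp add: vec_eq_iff matrix_vector_mult_def proj_point_def sum_divide_distrib sum_distrib_left sum_distrib_right
      mult_ac)

lemma linear_matrix_vector_mult_left: "linear (\<lambda>A :: complex^4^4. A *v u)"
  by (rule linearI)
    (simp_all add: vec_eq_iff matrix_vector_mult_def sum.distrib algebra_simps scaleR_sum_right)

text \<open>Projecting a fixed vector u that spans the line f p onto the nearby lines f q gives a
  smooth vector y q in f q; it equals u at p and so is nonzero near p, where it can be
  normalised.\<close>

lemma smooth_local_unit_lift: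
  assumes S: "open S" "p \<in> S" and f: "smooth_on S f" "f ` S \<subseteq> CP3"
  shows "\<exists>D v. open D \<and> p \<in> D \<and> D \<subseteq> S \<and> smooth_on D v \<and> (\<forall>q\<in>D. norm (v q) = 1 \<and> proj_point (v q) = f q)"
proof -
  obtain u where u: "u \<noteq> 0" "f p = proj_point u" using f(2) S(2) by (auto simp: CP3_def)
  define y where "y = (\<lambda>q. f q *v u)"
  have y: "smooth_on S y" unfolding y_def by (rule smooth_on_linear[OF S(1) linear_matrix_vector_mult_left f(1)])
  define D where "D = {q \<in> S. y q \<noteq> 0}"
  have "continuous_on S y" by (rule smooth_on_continuous[OF y])
  then have "open (S \<inter> y -` (- {0}))"
    using S(1) by (intro continuous_open_preimage) auto
  then have D: "open D" by (simp add: D_def Int_def vimage_def)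
  have "(\<Sum>s\<in>UNIV. cnj (u $ s) * u $ s) = complex_of_real (\<Sum>s\<in>UNIV. (cmod (u $ s))\<^sup>2)"
    by (simp only: of_real_sum complex_norm_square mult.commute)
  also have "(\<Sum>s\<in>UNIV. (cmod (u $ s))\<^sup>2) = (norm u)\<^sup>2"
    by (simp add: norm_vec_def L2_set_def sum_nonneg)
  finally have "y p = u" using u by (simp add: y_def proj_point_mult_vec)
  then have p: "p \<in> D" using u S(2) by (simp add: D_def)
  define v where "v = (\<lambda>q. inverse (norm (y q)) *\<^sub>R y q)"
  have ne: "y q \<noteq> 0" if "q \<in> D" for q using that by (simp add: D_def)
  have yD: "smooth_on D y" using smooth_on_subset[OF y] by (simp add: D_def)
  have "bilinear ((\<bullet>) :: complex^4 \<Rightarrow> complex^4 \<Rightarrow> real)"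
    by (simp add: bilinear_conv_bounded_bilinear bounded_bilinear_inner)
  from smooth_on_bilinear[OF D this yD yD] have "smooth_on D v"
    unfolding v_def norm_eq_sqrt_inner
    by (intro smooth_on_scaleR smooth_on_inverse smooth_on_sqrt D yD) (use ne in auto)
  moreover have "norm (v q) = 1 \<and> proj_point (v q) = f q" if q: "q \<in> D" for q
  proof
    show "norm (v q) = 1" using ne[OF q] by (simp add: v_def)
    obtain w where w: "w \<noteq> 0" "f q = proj_point w" using f(2) q by (auto simp: CP3_def D_def)
    obtain c where c: "y q = c *s w" unfolding y_def w(2) proj_point_mult_vec by blast
    have v: "v q = (inverse (norm (y q)) * c) *s w"
    proof -
      have "v q $ i = (inverse (norm (y q)) * c) * w $ i" for i
        unfolding v_def vector_scaleR_component by (simp add: c scaleR_conv_of_real)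
      then show ?thesis by (simp add: vec_eq_iff)
    qed
    moreover have "v q \<noteq> 0" using \<open>norm (v q) = 1\<close> by auto
    ultimately have "inverse (norm (y q)) * c \<noteq> 0" by auto
    with v \<open>v q \<noteq> 0\<close> w show "proj_point (v q) = f q"
      using proj_point_eq_iff[of w "v q"] by metis
  qed
  ultimately show ?thesis using D p by (intro exI[of _ D] exI[of _ v]) (auto simp: D_def)
qed

lemma tangent_lift_exists:
  assumes A: "A \<in> Sp2" and v: "qcol A \<bullet> w = 0"
  shows "\<exists>M. tangent_lift (Sp2_proj A) (dproj (qcol A) w) A M \<and>
    M $ 2 $ 1 = (qmat_adj A \<otimes> qmat_of_col w) $ 2 $ 1"
proof -
  define K where "K = qmat_adj A \<otimes> qmat_of_col w"
  have "Re (fst (K $ 1 $ 1)) = qcol A \<bullet> qcol (qmat_of_col w)"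
    unfolding inner_qcol K_def qmat_mult_nth qmat_adj_nth by (simp add: Re_fst_qmult_qcnj)
  then have re: "Re (fst (K $ 1 $ 1)) = 0" using v by simp
  \<comment> \<open>The first column is prescribed by w, the (1,2) entry is forced by skewness, and
    the (2,2) entry, invisible below, is set to zero.\<close>
  define M :: qmat where "M = (\<chi> r s. if s = 1 then K $ r $ 1 else if r = 1 then - qcnj (K $ 2 $ 1) else 0)"
  have M: "M $ 1 $ 1 = K $ 1 $ 1" "M $ 2 $ 1 = K $ 2 $ 1" "M $ 1 $ 2 = - qcnj (K $ 2 $ 1)" "M $ 2 $ 2 = 0"
    by (simp_all add: M_def)
  have "qcnj (K $ 1 $ 1) = - (K $ 1 $ 1)" using re by (simp add: qcnj_def prod_eq_iff complex_eq_iff)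
  moreover have "qcnj (- x) = - qcnj x" for x by (simp add: qcnj_def)
  ultimately have sp: "M \<in> sp2_algebra" by (simp add: sp2_algebra_def qmat_eq_iff M)
  have "qcol (A \<otimes> M) = qcol (A \<otimes> K)" by (simp add: qcol_eq_iff qmat_mult_nth M)
  also have "\<dots> = w" by (simp add: K_def Sp2_mult_adj[OF A])
  finally have "tangent_lift (Sp2_proj A) (dproj (qcol A) w) A M"
    using A sp by (simp add: tangent_lift_iff dlift_def)
  then show ?thesis using M(2) K_def by blast
qed

text \<open>Unlike in \<open>adapted_frame\<close>, the domain D is named, so that the equations of
  the frame can be differentiated throughout it.\<close>

definition adapted_on :: "complex set \<Rightarrow> (complex \<Rightarrow> complex^4^4) \<Rightarrow> (complex \<Rightarrow> qmat) \<Rightarrow> bool" where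
  "adapted_on D f F \<longleftrightarrow> open D \<and> smooth_on D F \<and>
     (\<forall>q\<in>D. F q \<in> Sp2 \<and> Sp2_proj (F q) = f q \<and> (\<forall>\<xi>. \<omega>2 (pullback_mc F q \<xi>) = 0))"

text \<open>The curve seen in one chart. The condition on \<tau> is added later: it is formulated
  through adapted frames, whose existence is established here from the remaining conditions.\<close>

locale plane_curve =
  fixes S :: "complex set" and f :: "complex \<Rightarrow> complex^4^4"
  assumes open_S: "open S" and smooth_f: "smooth_on S f" and f_CP3: "f ` S \<subseteq> CP3"
    and J_hol: "\<And>p \<xi>. p \<in> S \<Longrightarrow> pderiv_dir (\<i> * \<xi>) f p = J_nk (f p) (pderiv_dir \<xi> f p)"
    and not_vertical: "\<And>p. p \<in> S \<Longrightarrow> \<exists>\<xi>. pderiv_dir \<xi> f p \<notin> vertical_space (f p)"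
    and not_horizontal: "\<And>p. p \<in> S \<Longrightarrow> \<exists>\<xi>. pderiv_dir \<xi> f p \<notin> horizontal_space (f p)"
begin

lemma lift_i:
  assumes "q \<in> S" "tangent_lift (f q) (pderiv_dir 1 f q) A M" "tangent_lift (f q) (pderiv_dir \<i> f q) A N"
  shows "\<omega>1 N = \<i> * \<omega>1 M" "\<omega>2 N = \<i> * \<omega>2 M" "\<omega>3 N = \<i> * \<omega>3 M"
  using J_nk_lift[OF assms(2), of N] assms(3) J_hol[OF assms(1), of 1] by simp_all

text \<open>If the residue vanishes at q, the x-derivative of the lift is a quaternionic multiple of
  the lift, so the image of the x-direction is vertical; by J-holomorphy so is that of the
  y-direction, against transversality.\<close>

lemma gs_residue_nonzero:
  assumes D: "open D" "D \<subseteq> S" "q \<in> D" and v: "smooth_on D v" "\<And>q. q \<in> D \<Longrightarrow> norm (v q) = 1 \<and> proj_point (v q) = f q"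
  shows "gs_residue (v q) (pderiv_dir 1 v q) \<noteq> 0"
proof
  assume W0: "gs_residue (v q) (pderiv_dir 1 v q) = 0"
  have q: "q \<in> S" using D by blast
  have vq: "norm (v q) = 1" "proj_point (v q) = f q" using v(2)[OF D(3)] by simp_all
  have "(norm (v $ 1, v $ 2))\<^sup>2 + (norm (v $ 3, v $ 4))\<^sup>2 = (norm v)\<^sup>2" for v :: "complex^4"
    using norm_qcol[of "qmat_of_col v"] by simp
  then obtain A where A: "A \<in> Sp2" "A $ 1 $ 1 = (v q $ 1, v q $ 2)" "A $ 2 $ 1 = (v q $ 3, v q $ 4)"
    using Sp2_completion vq(1) by (metis one_power2)
  then have cA: "qcol A = v q" by (simp add: vec4_eq_iff)
  have dv: "(v has_derivative (\<lambda>\<xi>. pderiv_dir \<xi> v q)) (at q)"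
    by (rule smooth_on_has_derivative[OF D(1) v(1) D(3)])
  have orth: "v q \<bullet> pderiv_dir \<xi> v q = 0" for \<xi>
  proof -
    have "pderiv_dir \<xi> (\<lambda>x. v x \<bullet> v x) q = pderiv_dir \<xi> (\<lambda>x. 1) q"
      by (rule pderiv_dir_cong[OF D(1,3)]) (use v(2) norm_eq_1 in blast)
    moreover have "pderiv_dir \<xi> (\<lambda>x. v x \<bullet> v x) q = 2 * (v q \<bullet> pderiv_dir \<xi> v q)"
      using pderiv_dir_eqI[OF has_derivative_inner[OF dv dv]] by (simp add: inner_commute)
    ultimately show ?thesis by simp
  qed
  have df: "pderiv_dir \<xi> f q = dproj (qcol A) (pderiv_dir \<xi> v q)" for \<xi>
  proof -
    have "pderiv_dir \<xi> f q = pderiv_dir \<xi> (\<lambda>x. proj_point (v x)) q"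
      by (rule pderiv_dir_cong[OF D(1,3)]) (simp add: v(2))
    also have "\<dots> = dproj (v q) (pderiv_dir \<xi> v q)"
      by (rule pderiv_dir_eqI[OF has_derivative_compose[OF dv has_derivative_proj_point[OF vq(1)]]])
    finally show ?thesis by (simp add: cA)
  qed
  have fA: "f q = Sp2_proj A" by (simp add: Sp2_proj_qcol cA vq(2))
  have ex: "\<exists>M. tangent_lift (f q) (pderiv_dir \<xi> f q) A M \<and>
      M $ 2 $ 1 = (qmat_adj A \<otimes> qmat_of_col (pderiv_dir \<xi> v q)) $ 2 $ 1" for \<xi>
    unfolding df fA using A(1) orth by (intro tangent_lift_exists) (simp_all add: cA)
  obtain M where M: "tangent_lift (f q) (pderiv_dir 1 f q) A M"
    "M $ 2 $ 1 = (qmat_adj A \<otimes> qmat_of_col (pderiv_dir 1 v q)) $ 2 $ 1" using ex by blast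
  obtain N where N: "tangent_lift (f q) (pderiv_dir \<i> f q) A N" using ex by blast
  \<comment> \<open>With zero residue the derivative is v q times some Z on the right, and the lower
    entry of \<open>qmat_adj A\<close> applied to v q is zero because v q is the first column of
    A.\<close>
  have "qmat_of_col (pderiv_dir 1 v q)
    = qmat_of_col (v q) \<otimes> (qmat_adj (qmat_of_col (v q)) \<otimes> qmat_of_col (pderiv_dir 1 v q))"
    using W0 by (simp add: gs_residue_def)
  then obtain Z where Z: "qmat_of_col (pderiv_dir 1 v q) = qmat_of_col (v q) \<otimes> Z" by blast
  have "(qmat_adj A \<otimes> qmat_of_col (v q)) $ 2 $ 1 = (qmat_adj A \<otimes> A) $ 2 $ 1"
    by (simp add: qmat_mult_nth A)
  then have "(qmat_adj A \<otimes> qmat_of_col (v q)) $ 2 $ 1 = 0" by (simp add: Sp2_adj_mult[OF A(1)])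
  moreover have "(qmat_adj A \<otimes> qmat_of_col (v q)) $ 2 $ 2 = 0" by (simp add: qmat_mult_nth)
  ultimately have "M $ 2 $ 1 = 0"
    unfolding M(2) Z qmat_mult_assoc[symmetric] by (subst qmat_mult_nth) simp
  then have M0: "\<omega>1 M = 0" "\<omega>2 M = 0" by (simp_all add: \<omega>1_def \<omega>2_def)
  then have N0: "\<omega>1 N = 0" "\<omega>2 N = 0" using lift_i[OF q M(1) N] by simp_all
  have "pderiv_dir \<xi> f q \<in> vertical_space (f q)" for \<xi>
  proof -
    have "tangent_lift (f q) (pderiv_dir \<xi> f q) A (Re \<xi> *\<^sub>R M + Im \<xi> *\<^sub>R N)"
    proof -
      have "Re \<xi> *\<^sub>R M + Im \<xi> *\<^sub>R N \<in> sp2_algebra"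
        using M(1) N by (simp add: tangent_lift_iff sp2_algebra_def linear_add[OF linear_qmat_adj]
            linear_scale[OF linear_qmat_adj])
      moreover have "pderiv_dir \<xi> f q = Re \<xi> *\<^sub>R dlift A M + Im \<xi> *\<^sub>R dlift A N"
        using M(1) N pderiv_dir_Re_Im[OF smooth_on_differentiable[OF open_S smooth_f q], of \<xi>]
        by (simp add: tangent_lift_iff)
      moreover have "\<dots> = dlift A (Re \<xi> *\<^sub>R M + Im \<xi> *\<^sub>R N)"
        by (simp add: dlift_def qmat_mult_simps bilinear_rmul[OF bilinear_qmat_mult]
            linear_add[OF linear_qcol] linear_scale[OF linear_qcol] linear_add[OF linear_dproj] linear_scale[OF linear_dproj])
      ultimately show ?thesis using A(1) fA by (simp add: tangent_lift_iff)
    qed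
    moreover have "\<omega>1 (Re \<xi> *\<^sub>R M + Im \<xi> *\<^sub>R N) = 0" "\<omega>2 (Re \<xi> *\<^sub>R M + Im \<xi> *\<^sub>R N) = 0"
      using M0 N0 by (simp_all add: linear_forms linear_add linear_scale)
    ultimately show ?thesis using vertical_space_lift by blast
  qed
  then show False using not_vertical[OF q] by blast
qed

lemma adapted_pullback:
  assumes "adapted_on D f F" "D \<subseteq> S" "q \<in> D"
  shows "pullback_mc F q \<xi> \<in> sp2_algebra" "tangent_lift (f q) (pderiv_dir \<xi> f q) (F q) (pullback_mc F q \<xi>)"
    "F differentiable (at q)"
proof -
  have D: "open D" "q \<in> D" and F: "smooth_on D F" "\<And>x. x \<in> D \<Longrightarrow> F x \<in> Sp2"
    "\<And>x. x \<in> D \<Longrightarrow> Sp2_proj (F x) = f x"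
    using assms by (auto simp: adapted_on_def)
  show dF: "F differentiable (at q)" by (rule smooth_on_differentiable[OF D(1) F(1) D(2)])
  show "pullback_mc F q \<xi> \<in> sp2_algebra" by (rule pullback_mc_sp2_algebra[OF D F(2) dF])
  show "tangent_lift (f q) (pderiv_dir \<xi> f q) (F q) (pullback_mc F q \<xi>)"
    by (rule pullback_mc_tangent_lift[OF D F(2) dF F(3)])
qed

lemma adapted_on_exists:
  assumes "p \<in> S"
  shows "\<exists>D F. p \<in> D \<and> D \<subseteq> S \<and> adapted_on D f F"
proof -
  obtain D v where D: "open D" "p \<in> D" "D \<subseteq> S" and v: "smooth_on D v"
    "\<And>q. q \<in> D \<Longrightarrow> norm (v q) = 1 \<and> proj_point (v q) = f q"
    using smooth_local_unit_lift[OF open_S assms smooth_f f_CP3] by blast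
  define F where "F = (\<lambda>q. gs_frame (v q) (pderiv_dir 1 v q))"
  note nz = gs_residue_nonzero[OF D(1,3) _ v]
  have F: "smooth_on D F"
    unfolding F_def by (rule smooth_on_gs_frame[OF D(1) v(1) smooth_on_pderiv_dir[OF D(1) v(1)] nz])
  have Sp: "F q \<in> Sp2" "qcol (F q) = v q" if "q \<in> D" for q
    unfolding F_def using gs_frame[OF _ nz[OF that]] v(2)[OF that] by blast+
  have pr: "Sp2_proj (F q) = f q" if "q \<in> D" for q
    using Sp(2)[OF that] v(2)[OF that] by (simp add: Sp2_proj_qcol)
  have w2: "\<omega>2 (pullback_mc F q \<xi>) = 0" if q: "q \<in> D" for q \<xi>
  proof -
    have dF: "F differentiable (at q)" by (rule smooth_on_differentiable[OF D(1) F q])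
    have "qcol (pderiv_dir 1 F q) = pderiv_dir 1 (\<lambda>x. qcol (F x)) q"
      using pderiv_dir_linear[OF linear_qcol dF] by simp
    also have "\<dots> = pderiv_dir 1 v q" by (rule pderiv_dir_cong[OF D(1) q Sp(2)])
    finally have "qcol (pderiv_dir 1 F q) = qcol (qmat_of_col (pderiv_dir 1 v q))" by simp
    then have "pderiv_dir 1 F q $ 1 $ 1 = qmat_of_col (pderiv_dir 1 v q) $ 1 $ 1"
      "pderiv_dir 1 F q $ 2 $ 1 = qmat_of_col (pderiv_dir 1 v q) $ 2 $ 1"
      unfolding qcol_eq_iff by blast+
    then have "pullback_mc F q 1 $ 2 $ 1 = (qmat_adj (F q) \<otimes> qmat_of_col (pderiv_dir 1 v q)) $ 2 $ 1"
      by (simp add: pullback_mc_eq qmat_mult_nth)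
    also have "\<dots> = (complex_of_real (norm (gs_residue (v q) (pderiv_dir 1 v q))), 0)"
      unfolding F_def using gs_frame(3)[OF _ nz[OF q]] v(2)[OF q] by simp
    finally have 0: "\<omega>2 (pullback_mc F q 1) = 0" by (simp add: \<omega>2_def)
    \<comment> \<open>Gram-Schmidt controls only the x-direction; J-holomorphy carries the vanishing
      of \<omega>2 to all directions.\<close>
    have "\<omega>2 (pullback_mc F q \<i>) = \<i> * \<omega>2 (pullback_mc F q 1)"
      using lift_i(2)[of q] pullback_mc_tangent_lift[OF D(1) q Sp(1) dF pr] D(3) q by blast
    from pullback_mc_complex_linear[OF dF linear_forms(2) this] show ?thesis by (simp add: 0)
  qed
  show ?thesis
    using D F Sp(1) pr w2 by (intro exI[of _ D] exI[of _ F]) (simp add: adapted_on_def)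
qed

lemma adapted_forms:
  assumes "adapted_on D f F" "D \<subseteq> S" "q \<in> D"
  shows "\<omega>1 (pullback_mc F q \<xi>) = \<omega>1 (pullback_mc F q 1) * \<xi>"
    "\<omega>3 (pullback_mc F q \<xi>) = \<omega>3 (pullback_mc F q 1) * \<xi>"
    "\<omega>1 (pullback_mc F q 1) \<noteq> 0" "\<omega>3 (pullback_mc F q 1) \<noteq> 0"
    "\<tau>_form (pullback_mc F q \<xi>) = \<tau>_form (pullback_mc F q 1) * \<xi>"
proof -
  note ap = adapted_pullback[OF assms]
  have q: "q \<in> S" using assms by blast
  have D: "open D" and F: "smooth_on D F" "\<And>x. x \<in> D \<Longrightarrow> F x \<in> Sp2" and w2: "\<And>x \<xi>. x \<in> D \<Longrightarrow> \<omega>2 (pullback_mc F x \<xi>) = 0"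
    using assms(1) by (auto simp: adapted_on_def)
  have li: "\<omega>1 (pullback_mc F q \<i>) = \<i> * \<omega>1 (pullback_mc F q 1)"
    "\<omega>3 (pullback_mc F q \<i>) = \<i> * \<omega>3 (pullback_mc F q 1)"
    by (rule lift_i[OF q ap(2)[of 1] ap(2)[of \<i>]])+
  have 1: "\<omega>1 (pullback_mc F q \<xi>) = \<omega>1 (pullback_mc F q 1) * \<xi>" for \<xi>
    by (rule pullback_mc_complex_linear[OF ap(3) linear_forms(1) li(1)])
  have 3: "\<omega>3 (pullback_mc F q \<xi>) = \<omega>3 (pullback_mc F q 1) * \<xi>" for \<xi>
    by (rule pullback_mc_complex_linear[OF ap(3) linear_forms(3) li(2)])
  show "\<omega>1 (pullback_mc F q \<xi>) = \<omega>1 (pullback_mc F q 1) * \<xi>"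
    "\<omega>3 (pullback_mc F q \<xi>) = \<omega>3 (pullback_mc F q 1) * \<xi>"
    by (rule 1, rule 3)
  obtain \<xi>1 where "pderiv_dir \<xi>1 f q \<notin> vertical_space (f q)" using not_vertical[OF q] ..
  then have "\<omega>1 (pullback_mc F q \<xi>1) \<noteq> 0"
    unfolding vertical_space_lift[OF ap(2)[of \<xi>1]] by (simp add: w2[OF assms(3)])
  then show ne1: "\<omega>1 (pullback_mc F q 1) \<noteq> 0" using 1[of \<xi>1] by simp
  obtain \<xi>3 where "pderiv_dir \<xi>3 f q \<notin> horizontal_space (f q)" using not_horizontal[OF q] ..
  then have "\<omega>3 (pullback_mc F q \<xi>3) \<noteq> 0"
    unfolding horizontal_space_lift[OF ap(2)[of \<xi>3]] .
  then show "\<omega>3 (pullback_mc F q 1) \<noteq> 0" using 3[of \<xi>3] by simp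
  let ?X = "pullback_mc F q 1" and ?Y = "pullback_mc F q \<i>"
  have dmc: "(\<lambda>x. pullback_mc F x u) differentiable (at q)" for u
    by (rule smooth_on_differentiable[OF D smooth_on_pullback_mc[OF D F(1)] assms(3)])
  \<comment> \<open>The structure equation for \<omega>2: its left side is zero as \<omega>2
    vanishes on all of D, so the equation becomes a constraint on \<tau>.\<close>
  have "\<omega>2 (?Y \<otimes> ?X - ?X \<otimes> ?Y)
    = \<omega>2 (pderiv_dir 1 (\<lambda>x. pullback_mc F x \<i>) q - pderiv_dir \<i> (\<lambda>x. pullback_mc F x 1) q)"
    by (simp only: maurer_cartan_structure_equation[OF D assms(3) F])
  also have "\<dots> = pderiv_dir 1 (\<lambda>x. \<omega>2 (pullback_mc F x \<i>)) q - pderiv_dir \<i> (\<lambda>x. \<omega>2 (pullback_mc F x 1)) q"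
    by (simp only: linear_diff[OF linear_forms(2)] pderiv_dir_linear[OF linear_forms(2) dmc])
  also have "\<dots> = 0"
  proof -
    have "pderiv_dir u (\<lambda>x. \<omega>2 (pullback_mc F x v)) q = 0" for u v
      using pderiv_dir_cong[OF D assms(3), of "\<lambda>x. \<omega>2 (pullback_mc F x v)" "\<lambda>x. 0" u] w2 by simp
    then show ?thesis by simp
  qed
  \<comment> \<open>The two terms with conjugates cancel because \<omega>1 and \<omega>3 are both of
    type (1,0); what is left is \<tau> \<and> \<omega>1 = 0.\<close>
  finally have "\<tau>_form ?Y * \<omega>1 ?X = \<tau>_form ?X * \<omega>1 ?Y"
    unfolding forms_commutator(2)[OF ap(1) w2[OF assms(3)] ap(1) w2[OF assms(3)]]
    using 1[of \<i>] 3[of \<i>] by (simp add: algebra_simps)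
  then have "\<tau>_form ?Y = \<i> * \<tau>_form ?X" using ne1 1[of \<i>] by (simp add: mult_ac)
  then show "\<tau>_form (pullback_mc F q \<xi>) = \<tau>_form (pullback_mc F q 1) * \<xi>"
    by (rule pullback_mc_complex_linear[OF ap(3) linear_forms(4)])
qed

text \<open>Common form of the three Laplace equations. The hypothesis on commutators encodes
  d\<phi> = \<i> \<eta> \<and> \<phi>; it is used with (\<omega>1, \<rho>1 - \<rho>2), (\<omega>3,
  -2\<rho>1) and (\<tau>, 2\<rho>2). The structure equation enters twice, once for \<phi> and once
  to evaluate d\<eta>.\<close>

lemma adapted_plane_lap:
  fixes \<phi> :: "qmat \<Rightarrow> complex" and \<eta> :: "qmat \<Rightarrow> real"
  assumes adapted: "adapted_on D f F" "D \<subseteq> S" "q \<in> D" and lin: "linear \<phi>" "linear \<eta>"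
    and \<phi>: "\<And>x. x \<in> D \<Longrightarrow> \<phi> (pullback_mc F x \<i>) = \<i> * \<phi> (pullback_mc F x 1)"
      "\<And>x. x \<in> D \<Longrightarrow> \<phi> (pullback_mc F x 1) \<noteq> 0"
    and comm: "\<And>X Y. X \<in> sp2_algebra \<Longrightarrow> \<omega>2 X = 0 \<Longrightarrow> Y \<in> sp2_algebra \<Longrightarrow> \<omega>2 Y = 0 \<Longrightarrow>
      \<phi> (Y \<otimes> X - X \<otimes> Y) = \<i> * (\<eta> X * \<phi> Y - \<eta> Y * \<phi> X)"
  shows "plane_lap (\<lambda>x. ln ((cmod (\<phi> (pullback_mc F x 1)))\<^sup>2)) q
    = - 2 * \<eta> (pullback_mc F q \<i> \<otimes> pullback_mc F q 1 - pullback_mc F q 1 \<otimes> pullback_mc F q \<i>)"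
proof -
  have D: "open D" and F: "smooth_on D F" "\<And>x. x \<in> D \<Longrightarrow> F x \<in> Sp2" and w2: "\<And>x \<xi>. x \<in> D \<Longrightarrow> \<omega>2 (pullback_mc F x \<xi>) = 0"
    using adapted(1) by (auto simp: adapted_on_def)
  note mc = smooth_on_pullback_mc[OF D F(1)]
  have dmc: "(\<lambda>x. pullback_mc F x u) differentiable (at x)" if "x \<in> D" for x u
    by (rule smooth_on_differentiable[OF D mc that])
  have "plane_lap (\<lambda>x. ln ((cmod (\<phi> (pullback_mc F x 1)))\<^sup>2)) q
    = - 2 * (pderiv_dir 1 (\<lambda>x. \<eta> (pullback_mc F x \<i>)) q - pderiv_dir \<i> (\<lambda>x. \<eta> (pullback_mc F x 1)) q)"
  proof (rule plane_lap_ln_cmod[OF D adapted(3)])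
    show "smooth_on D (\<lambda>x. \<phi> (pullback_mc F x 1))" "smooth_on D (\<lambda>x. \<eta> (pullback_mc F x 1))"
      "smooth_on D (\<lambda>x. \<eta> (pullback_mc F x \<i>))"
      by (rule smooth_on_linear[OF D _ mc], rule lin)+
    fix x assume x: "x \<in> D"
    show "\<phi> (pullback_mc F x 1) \<noteq> 0" by (rule \<phi>(2)[OF x])
    note sp = adapted_pullback(1)[OF adapted(1,2) x]
    have "pderiv_dir 1 (\<lambda>x. \<phi> (pullback_mc F x \<i>)) x = pderiv_dir 1 (\<lambda>x. \<i> * \<phi> (pullback_mc F x 1)) x"
      by (rule pderiv_dir_cong[OF D x \<phi>(1)])
    also have "\<dots> = \<i> * pderiv_dir 1 (\<lambda>x. \<phi> (pullback_mc F x 1)) x"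
      by (rule pderiv_dir_cmult[OF smooth_on_differentiable[OF D smooth_on_linear[OF D lin(1) mc] x]])
    finally have "\<i> * pderiv_dir 1 (\<lambda>x. \<phi> (pullback_mc F x 1)) x - pderiv_dir \<i> (\<lambda>x. \<phi> (pullback_mc F x 1)) x
      = \<phi> (pderiv_dir 1 (\<lambda>x. pullback_mc F x \<i>) x - pderiv_dir \<i> (\<lambda>x. pullback_mc F x 1) x)"
      by (simp only: linear_diff[OF lin(1)] pderiv_dir_linear[OF lin(1) dmc[OF x]])
    also have "\<dots> = \<i> * (\<eta> (pullback_mc F x 1) * \<phi> (pullback_mc F x \<i>) - \<eta> (pullback_mc F x \<i>) * \<phi> (pullback_mc F x 1))"
      by (simp only: maurer_cartan_structure_equation[OF D x F] comm[OF sp w2[OF x] sp w2[OF x]])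
    finally show "\<i> * pderiv_dir 1 (\<lambda>x. \<phi> (pullback_mc F x 1)) x - pderiv_dir \<i> (\<lambda>x. \<phi> (pullback_mc F x 1)) x
      = \<i> * (\<eta> (pullback_mc F x 1) * (\<i> * \<phi> (pullback_mc F x 1)) - \<eta> (pullback_mc F x \<i>) * \<phi> (pullback_mc F x 1))"
      by (simp only: \<phi>(1)[OF x])
  qed
  also have "pderiv_dir 1 (\<lambda>x. \<eta> (pullback_mc F x \<i>)) q - pderiv_dir \<i> (\<lambda>x. \<eta> (pullback_mc F x 1)) q
    = \<eta> (pderiv_dir 1 (\<lambda>x. pullback_mc F x \<i>) q - pderiv_dir \<i> (\<lambda>x. pullback_mc F x 1) q)"
    by (simp only: linear_diff[OF lin(2)] pderiv_dir_linear[OF lin(2) dmc[OF adapted(3)]])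
  finally show ?thesis
    by (simp only: maurer_cartan_structure_equation[OF D adapted(3) F])
qed

lemma adapted_equations:
  assumes adapted: "adapted_on D f F" "D \<subseteq> S" "q \<in> D"
    and \<tau>: "\<And>x. x \<in> D \<Longrightarrow> \<tau>_form (pullback_mc F x 1) \<noteq> 0"
  defines "a \<equiv> \<lambda>x. (cmod (\<omega>1 (pullback_mc F x 1)))\<^sup>2" and "b \<equiv> \<lambda>x. (cmod (\<omega>3 (pullback_mc F x 1)))\<^sup>2"
    and "t \<equiv> \<lambda>x. (cmod (\<tau>_form (pullback_mc F x 1)))\<^sup>2"
  shows "plane_lap (\<lambda>x. ln (a x)) q = 4 * (b q + t q - a q)"
    "plane_lap (\<lambda>x. ln (b x)) q = 4 * (a q - 2 * b q)"
    "plane_lap (\<lambda>x. ln (t x)) q = 4 * (a q - 2 * t q)"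
proof -
  let ?X = "pullback_mc F q 1" and ?Y = "pullback_mc F q \<i>"
  let ?S = "?Y \<otimes> ?X - ?X \<otimes> ?Y"
  have w2: "\<omega>2 (pullback_mc F q \<xi>) = 0" for \<xi> using adapted(1,3) by (auto simp: adapted_on_def)
  note sp = adapted_pullback(1)[OF adapted]
  have i: "\<omega>1 (pullback_mc F x \<i>) = \<i> * \<omega>1 (pullback_mc F x 1)"
    "\<omega>3 (pullback_mc F x \<i>) = \<i> * \<omega>3 (pullback_mc F x 1)"
    "\<tau>_form (pullback_mc F x \<i>) = \<i> * \<tau>_form (pullback_mc F x 1)" if "x \<in> D" for x
    using adapted_forms(1,2,5)[OF adapted(1,2) that, of \<i>] by (simp_all add: mult.commute)
  \<comment> \<open>The values of d\<rho>1 and d\<rho>2 on the coordinate fields: type (1,0) turns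
    each product of a form with a conjugate into a squared modulus.\<close>
  have r: "\<rho>1 ?S = a q - 2 * b q" "\<rho>2 ?S = 2 * t q - a q"
    unfolding forms_commutator(5,6)[OF sp w2 sp w2] i[OF adapted(3)] a_def b_def t_def cmod_power2
    by (simp_all add: power2_eq_square field_simps)
  have "plane_lap (\<lambda>x. ln (a x)) q = - 2 * (\<lambda>M. \<rho>1 M - \<rho>2 M) ?S"
    unfolding a_def
  proof (rule adapted_plane_lap[OF adapted linear_forms(1) linear_compose_sub[OF linear_forms(5,6)] i(1)])
    show "\<omega>1 (Y \<otimes> X - X \<otimes> Y) = \<i> * (complex_of_real (\<rho>1 X - \<rho>2 X) * \<omega>1 Y - complex_of_real (\<rho>1 Y - \<rho>2 Y) * \<omega>1 X)"
      if "X \<in> sp2_algebra" "\<omega>2 X = 0" "Y \<in> sp2_algebra" "\<omega>2 Y = 0" for X Y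
      by (simp add: forms_commutator(1)[OF that])
  qed (use adapted_forms(3)[OF adapted(1,2)] in auto)
  then show "plane_lap (\<lambda>x. ln (a x)) q = 4 * (b q + t q - a q)" by (simp add: r)
  have l: "linear (\<lambda>M. c * \<rho>1 M)" "linear (\<lambda>M. c * \<rho>2 M)" for c
    using linear_compose_scale_right[OF linear_forms(5)] linear_compose_scale_right[OF linear_forms(6)] by simp_all
  have "plane_lap (\<lambda>x. ln (b x)) q = - 2 * (\<lambda>M. - 2 * \<rho>1 M) ?S"
    unfolding b_def
  proof (rule adapted_plane_lap[OF adapted linear_forms(3) l(1) i(2)])
    show "\<omega>3 (Y \<otimes> X - X \<otimes> Y) = \<i> * (complex_of_real (- 2 * \<rho>1 X) * \<omega>3 Y - complex_of_real (- 2 * \<rho>1 Y) * \<omega>3 X)"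
      if "X \<in> sp2_algebra" "\<omega>2 X = 0" "Y \<in> sp2_algebra" "\<omega>2 Y = 0" for X Y
      by (simp add: forms_commutator(3)[OF that])
  qed (use adapted_forms(4)[OF adapted(1,2)] in auto)
  then show "plane_lap (\<lambda>x. ln (b x)) q = 4 * (a q - 2 * b q)" by (simp add: r)
  have "plane_lap (\<lambda>x. ln (t x)) q = - 2 * (\<lambda>M. 2 * \<rho>2 M) ?S"
    unfolding t_def
  proof (rule adapted_plane_lap[OF adapted linear_forms(4) l(2) i(3)])
    show "\<tau>_form (Y \<otimes> X - X \<otimes> Y) = \<i> * (complex_of_real (2 * \<rho>2 X) * \<tau>_form Y - complex_of_real (2 * \<rho>2 Y) * \<tau>_form X)"
      if "X \<in> sp2_algebra" "\<omega>2 X = 0" "Y \<in> sp2_algebra" "\<omega>2 Y = 0" for X Y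
      by (simp add: forms_commutator(4)[OF that])
  qed (use \<tau> in auto)
  then show "plane_lap (\<lambda>x. ln (t x)) q = 4 * (a q - 2 * t q)" by (simp add: r)
qed

lemma adapted_metrics:
  assumes "adapted_on D f F" "D \<subseteq> S" "q \<in> D"
  shows "g_hor (f q) (pderiv_dir \<xi> f q) (pderiv_dir \<eta> f q) = (cmod (\<omega>1 (pullback_mc F q 1)))\<^sup>2 * Re (\<xi> * cnj \<eta>)"
    "g_ver (f q) (pderiv_dir \<xi> f q) (pderiv_dir \<eta> f q) = (cmod (\<omega>3 (pullback_mc F q 1)))\<^sup>2 * Re (\<xi> * cnj \<eta>)"
proof -
  note ap = adapted_pullback(2)[OF assms] and fo = adapted_forms(1,2)[OF assms]
  have w2: "\<omega>2 (pullback_mc F q \<xi>) = 0" for \<xi> using assms by (auto simp: adapted_on_def)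
  have *: "Re (a * \<xi> * cnj (a * \<eta>)) = (cmod a)\<^sup>2 * Re (\<xi> * cnj \<eta>)" for a
    unfolding cmod_power2 by (simp add: power2_eq_square algebra_simps)
  show "g_hor (f q) (pderiv_dir \<xi> f q) (pderiv_dir \<eta> f q) = (cmod (\<omega>1 (pullback_mc F q 1)))\<^sup>2 * Re (\<xi> * cnj \<eta>)"
    unfolding g_hor_lift[OF ap ap] fo(1)[of \<xi>] fo(1)[of \<eta>] * by (simp add: w2)
  show "g_ver (f q) (pderiv_dir \<xi> f q) (pderiv_dir \<eta> f q) = (cmod (\<omega>3 (pullback_mc F q 1)))\<^sup>2 * Re (\<xi> * cnj \<eta>)"
    unfolding g_ver_lift[OF ap ap] fo(2)[of \<xi>] fo(2)[of \<eta>] * ..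
qed

end

text \<open>The difference G of two adapted frames takes values in U(1) x U(1), because \<omega>2 =
  0 in both and \<omega>1 is nonzero. Then \<omega>1 changes by a phase, and \<tau>, although part
  of the connection, changes only by the square of a phase. An open domain is needed because G is
  differentiated.\<close>

lemma adapted_frames_compare:
  assumes D: "open D" "q \<in> D"
    and F: "\<And>x. x \<in> D \<Longrightarrow> F differentiable (at x)" "\<And>x. x \<in> D \<Longrightarrow> F x \<in> Sp2"
      "\<And>x \<xi>. x \<in> D \<Longrightarrow> \<omega>2 (pullback_mc F x \<xi>) = 0" "\<And>x. x \<in> D \<Longrightarrow> \<exists>\<xi>. \<omega>1 (pullback_mc F x \<xi>) \<noteq> 0"
    and F': "\<And>x. x \<in> D \<Longrightarrow> F' differentiable (at x)" "\<And>x. x \<in> D \<Longrightarrow> F' x \<in> Sp2"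
      "\<And>x \<xi>. x \<in> D \<Longrightarrow> \<omega>2 (pullback_mc F' x \<xi>) = 0"
    and eq: "\<And>x. x \<in> D \<Longrightarrow> Sp2_proj (F x) = Sp2_proj (F' x)"
  shows "cmod (\<omega>1 (pullback_mc F' q \<xi>)) = cmod (\<omega>1 (pullback_mc F q \<xi>))"
    "cmod (\<tau>_form (pullback_mc F' q \<xi>)) = cmod (\<tau>_form (pullback_mc F q \<xi>))"
proof -
  define G where "G = (\<lambda>x. qmat_adj (F x) \<otimes> F' x)"
  have G: "G x $ 1 $ 2 = 0 \<and> G x $ 2 $ 1 = 0 \<and> snd (G x $ 2 $ 2) = 0 \<and> cmod (fst (G x $ 2 $ 2)) = 1 \<and>
      cmod (\<omega>1 (pullback_mc F' x \<xi>)) = cmod (\<omega>1 (pullback_mc F x \<xi>))" if x: "x \<in> D" for x \<xi>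
  proof -
    obtain c k where ck: "cmod c = 1" "norm k = 1" "qmat_adj (F x) \<otimes> F' x = qdiag (c, 0) k"
      "F' x = F x \<otimes> qdiag (c, 0) k" "qcol (F' x) = c *s qcol (F x)"
      by (rule Sp2_fibre[OF F(2)[OF x] F'(2)[OF x] eq[OF x]])
    let ?G = "qdiag (c, 0) k"
    have rel: "(\<omega>1 (pullback_mc F x \<xi>), 0) = qmult (qmult k (\<omega>1 (pullback_mc F' x \<xi>), 0)) (cnj c, 0)" for \<xi>
    proof -
      let ?M = "pullback_mc F x \<xi>" and ?M' = "pullback_mc F' x \<xi>"
      have M: "tangent_lift (Sp2_proj (F x)) (pderiv_dir \<xi> (\<lambda>y. Sp2_proj (F y)) x) (F x) ?M"
        by (rule pullback_mc_tangent_lift[OF D(1) x F(2) F(1)[OF x]]) simp_all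
      have M': "tangent_lift (Sp2_proj (F x)) (pderiv_dir \<xi> (\<lambda>y. Sp2_proj (F y)) x) (F' x) ?M'"
        using pullback_mc_tangent_lift[OF D(1) x F'(2) F'(1)[OF x], of "\<lambda>y. Sp2_proj (F y)"] eq by simp
      have "tangent_lift (Sp2_proj (F x)) (pderiv_dir \<xi> (\<lambda>y. Sp2_proj (F y)) x) (F x) (?G \<otimes> ?M' \<otimes> qmat_adj ?G)"
        using M' F(2)[OF x] dlift_change_frame[OF ck(1,2,4,5)]
        by (simp add: tangent_lift_iff sp2_algebra_conj)
      from tangent_lift_unique[OF M this] show ?thesis
        using forms_conj(2)[of c k ?M'] F(3)[OF x] F'(3)[OF x] by simp
    qed
    obtain \<xi>0 where "\<omega>1 (pullback_mc F x \<xi>0) \<noteq> 0" using F(4)[OF x] ..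
    then have "\<omega>1 (pullback_mc F' x \<xi>0) \<noteq> 0" "c \<noteq> 0"
      using rel[of \<xi>0] ck(1) by (auto simp: qmult_def)
    \<comment> \<open>The j-component of \<open>rel\<close> says that snd k times a nonzero value of
      \<omega>1 times \<open>cnj c\<close> is zero.\<close>
    then have "snd k = 0" using rel[of \<xi>0] by (auto simp: qmult_def)
    moreover from this have "cmod (fst k) = 1" using ck(2) by (cases k) (simp add: norm_prod_def)
    moreover have "cmod (\<omega>1 (pullback_mc F x \<xi>)) = cmod (fst k) * cmod (\<omega>1 (pullback_mc F' x \<xi>)) * cmod c"
    proof -
      have "\<omega>1 (pullback_mc F x \<xi>) = fst k * \<omega>1 (pullback_mc F' x \<xi>) * cnj c"
        using rel[of \<xi>] \<open>snd k = 0\<close> by (simp add: qmult_def)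
      then show ?thesis by (simp add: norm_mult)
    qed
    ultimately show ?thesis using ck(1) by (simp add: G_def ck(3))
  qed
  show "cmod (\<omega>1 (pullback_mc F' q \<xi>)) = cmod (\<omega>1 (pullback_mc F q \<xi>))" using G[OF D(2)] by blast
  note dF = F(1)[OF D(2)] and dF' = F'(1)[OF D(2)]
  have adj: "(\<lambda>x. qmat_adj (F x)) differentiable (at q)"
    using bounded_linear.has_derivative[OF linear_conv_bounded_linear[THEN iffD1, OF linear_qmat_adj]] dF
    by (auto simp: differentiable_def)
  have dG: "G differentiable (at q)"
    unfolding G_def using adj dF'
      bounded_bilinear.FDERIV[OF bilinear_qmat_mult[unfolded bilinear_conv_bounded_bilinear]]
    by (fastforce simp: differentiable_def)
  define dg where "dg = pderiv_dir \<xi> G q"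
  have entry: "linear (\<lambda>A::qmat. A $ 1 $ 2)" "linear (\<lambda>A::qmat. snd (A $ 2 $ 2))"
    by (rule linearI; simp)+
  have "dg $ 1 $ 2 = pderiv_dir \<xi> (\<lambda>x. G x $ 1 $ 2) q"
    unfolding dg_def by (rule pderiv_dir_linear[OF entry(1) dG, symmetric])
  also have "\<dots> = pderiv_dir \<xi> (\<lambda>x. 0) q"
    by (rule pderiv_dir_cong[OF D]) (use G in blast)
  finally have dg12: "dg $ 1 $ 2 = 0" by simp
  have "snd (dg $ 2 $ 2) = pderiv_dir \<xi> (\<lambda>x. snd (G x $ 2 $ 2)) q"
    unfolding dg_def by (rule pderiv_dir_linear[OF entry(2) dG, symmetric])
  also have "\<dots> = pderiv_dir \<xi> (\<lambda>x. 0) q"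
    by (rule pderiv_dir_cong[OF D]) (use G in blast)
  finally have dg22: "snd (dg $ 2 $ 2) = 0" by simp
  have FG: "F' x = F x \<otimes> G x" if "x \<in> D" for x using F(2)[OF that] by (simp add: G_def Sp2_mult_adj)
  have "pderiv_dir \<xi> F' q = pderiv_dir \<xi> (\<lambda>x. F x \<otimes> G x) q"
    by (rule pderiv_dir_cong[OF D FG])
  also have "\<dots> = F q \<otimes> dg + pderiv_dir \<xi> F q \<otimes> G q"
    unfolding dg_def by (rule pderiv_dir_bilinear[OF bilinear_qmat_mult dF dG])
  \<comment> \<open>The gauge transformation law. Its inhomogeneous first term has no j-component in
    the (2,2) entry, and conjugating j t by the phase k gives j (k t k).\<close>
  finally have "pullback_mc F' q \<xi> = qmat_adj (G q) \<otimes> dg + qmat_adj (G q) \<otimes> pullback_mc F q \<xi> \<otimes> G q"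
    by (simp add: pullback_mc_eq FG[OF D(2)] qmat_adj_mult qmat_mult_simps qmat_mult_assoc Sp2_adj_mult F(2)[OF D(2)])
  moreover obtain k where k: "G q $ 2 $ 2 = (k, 0)" "cmod k = 1" using G[OF D(2)] by (metis prod.collapse)
  ultimately have "\<tau>_form (pullback_mc F' q \<xi>) = k * \<tau>_form (pullback_mc F q \<xi>) * k"
    using G[OF D(2)] dg12 dg22
    by (simp add: \<tau>_form_def qmat_mult_nth qmult_def qcnj_def zero_prod_def)
  then show "cmod (\<tau>_form (pullback_mc F' q \<xi>)) = cmod (\<tau>_form (pullback_mc F q \<xi>))"
    using k(2) by (simp add: norm_mult)
qed

section \<open>Charts\<close>

lemma chartD:
  assumes "riemann_surface X \<A>" "c \<in> \<A>"
  shows "open (chart_range c)" "inj_on (snd c) (fst c)" "fst c \<subseteq> topspace X"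
    "homeomorphic_map (subtopology X (fst c)) (top_of_set (chart_range c)) (snd c)" "openin X (fst c)"
proof -
  obtain U z where c: "c = (U, z)" by (cases c)
  have *: "openin X U \<and> open (z ` U) \<and> homeomorphic_map (subtopology X U) (top_of_set (z ` U)) z"
    using assms unfolding riemann_surface_def c by fast
  then show "open (chart_range c)" "openin X (fst c)"
    "homeomorphic_map (subtopology X (fst c)) (top_of_set (chart_range c)) (snd c)"
    by (simp_all add: c chart_range_def)
  show "fst c \<subseteq> topspace X" using * by (simp add: c openin_subset)
  have "topspace (subtopology X U) = U" using * openin_subset by (fastforce simp: topspace_subtopology)
  then show "inj_on (snd c) (fst c)" using * homeomorphic_imp_injective_map by (fastforce simp: c)
qed

lemma coord_rep_at:
  assumes "riemann_surface X \<A>" "c \<in> \<A>" "x \<in> fst c"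
  shows "coord_rep c h (snd c x) = h x" "snd c x \<in> chart_range c"
  using chartD(2)[OF assms(1,2)] assms(3) by (simp_all add: coord_rep_def chart_range_def)

lemma chart_point:
  assumes "riemann_surface X \<A>" "c \<in> \<A>" "p \<in> chart_range c"
  obtains x where "x \<in> fst c" "snd c x = p" "x \<in> topspace X" "\<And>h. coord_rep c h p = h x"
proof -
  obtain x where x: "x \<in> fst c" "snd c x = p" using assms(3) by (auto simp: chart_range_def)
  then show ?thesis
    using that[of x] chartD(3)[OF assms(1,2)] coord_rep_at(1)[OF assms(1,2) x(1)] by (metis subsetD)
qed

text \<open>The overlap has open image since charts are homeomorphisms onto open sets. There T is
  holomorphic, so its derivative is multiplication by a number, nonzero because the reverse
  transition inverts T. This common factor cancels in every ratio of (1,0)-forms.\<close>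

lemma chart_transition:
  assumes X: "riemann_surface X \<A>" and c: "c \<in> \<A>" and c': "c' \<in> \<A>" and x: "x \<in> fst c" "x \<in> fst c'"
  obtains E T k where "open E" "snd c' x \<in> E" "E \<subseteq> chart_range c'" "T (snd c' x) = snd c x"
    "\<And>p. p \<in> E \<Longrightarrow> T p \<in> chart_range c" "\<And>p. p \<in> E \<Longrightarrow> (T has_derivative (*) (k p)) (at p)"
    "\<And>p. p \<in> E \<Longrightarrow> k p \<noteq> 0" "\<And>p (h :: 'a \<Rightarrow> 'b). p \<in> E \<Longrightarrow> coord_rep c' h p = coord_rep c h (T p)"
proof -
  obtain U z where cU: "c = (U, z)" by (cases c)
  obtain V w where cV: "c' = (V, w)" by (cases c')
  define T where "T = z \<circ> inv_into V w"
  define T' where "T' = w \<circ> inv_into U z"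
  have hol: "\<forall>(U, z)\<in>\<A>. \<forall>(V, w)\<in>\<A>. (w \<circ> inv_into U z) holomorphic_on (z ` (U \<inter> V))"
    using X by (simp add: riemann_surface_def)
  have T: "T holomorphic_on w ` (V \<inter> U)" and T': "T' holomorphic_on z ` (U \<inter> V)"
    using hol c c' unfolding cU cV T_def T'_def by fast+
  have op: "open (w ` (V \<inter> U))" if "(V, w) \<in> \<A>" "(U, z) \<in> \<A>" for U V and w z :: "'a \<Rightarrow> complex"
  proof -
    have "open_map (subtopology X V) (top_of_set (w ` V)) w"
      using homeomorphic_imp_open_map chartD(4)[OF X that(1)] by (fastforce simp: chart_range_def)
    moreover have "openin (subtopology X V) (V \<inter> U)"
      using chartD(5)[OF X that(2)] by (auto simp: openin_subtopology)
    ultimately have "openin (top_of_set (w ` V)) (w ` (V \<inter> U))" by (simp add: open_map_def)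
    moreover have "open (w ` V)" using chartD(1)[OF X that(1)] by (simp add: chart_range_def)
    ultimately show ?thesis by (simp add: openin_open_eq)
  qed
  have inj: "inj_on z U" "inj_on w V" using chartD(2)[OF X] c c' cU cV by fastforce+
  define E where "E = w ` (V \<inter> U)"
  have E: "open E" unfolding E_def using op c c' cU cV by blast
  have E': "open (z ` (U \<inter> V))" using op c c' cU cV by blast
  have der: "(T has_field_derivative deriv T p) (at p)" if "p \<in> E" for p
    using holomorphic_derivI[OF T op[of V w U z] ] that c c' cU cV by (auto simp: E_def)
  have Tw: "T (w y) = z y" if "y \<in> V" for y using inj that by (simp add: T_def)
  have T'z: "T' (z y) = w y" if "y \<in> U" for y using inj that by (simp add: T'_def)
  have ne: "deriv T p \<noteq> 0" if p: "p \<in> E" for p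
  proof -
    obtain y where y: "y \<in> V" "y \<in> U" "p = w y" using p by (auto simp: E_def)
    have "(T' has_field_derivative deriv T' (T p)) (at (T p))"
      using holomorphic_derivI[OF T' E'] y Tw by auto
    then have "(T' \<circ> T has_field_derivative deriv T' (T p) * deriv T p) (at p)"
      by (rule DERIV_chain[OF _ der[OF p]])
    moreover have "(T' \<circ> T has_field_derivative 1) (at p)"
      by (rule has_field_derivative_transform_within_open[OF DERIV_ident E p])
        (auto simp: E_def Tw T'z)
    ultimately have "deriv T' (T p) * deriv T p = 1" by (rule DERIV_unique)
    then show ?thesis by auto
  qed
  show ?thesis
  proof (rule that[of E T "deriv T"])
    show "snd c' x \<in> E" "E \<subseteq> chart_range c'" "T (snd c' x) = snd c x"
      using x Tw by (auto simp: E_def cU cV chart_range_def)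
    show "T p \<in> chart_range c" if "p \<in> E" for p
      using that Tw by (auto simp: E_def cU chart_range_def)
    show "coord_rep c' h p = coord_rep c h (T p)" if "p \<in> E" for p and h :: "'a \<Rightarrow> 'b"
      using that inj Tw by (auto simp: E_def cU cV coord_rep_def)
  qed (use E ne der in \<open>auto simp: has_field_derivative_def\<close>)
qed

lemma coord_rep_transition_deriv:
  assumes "open E" "p \<in> E" "(T has_derivative (*) k) (at p)" "\<And>p. p \<in> E \<Longrightarrow> f' p = f (T p)"
    "f differentiable (at (T p))"
  shows "pderiv_dir \<xi> f' p = pderiv_dir (k * \<xi>) f (T p)" "f' differentiable (at p)"
proof -
  have "(f has_derivative (\<lambda>\<xi>. pderiv_dir \<xi> f (T p))) (at (T p))"
    using assms(5) by (simp add: pderiv_dir_def frechet_derivative_works)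
  from has_derivative_compose[OF assms(3) this]
  have "(f' has_derivative (\<lambda>\<xi>. pderiv_dir (k * \<xi>) f (T p))) (at p)"
    by (rule has_derivative_transform_within_open[OF _ assms(1,2)]) (simp add: assms(4))
  then show "pderiv_dir \<xi> f' p = pderiv_dir (k * \<xi>) f (T p)" "f' differentiable (at p)"
    by (auto simp: differentiable_def intro: pderiv_dir_eqI)
qed

section \<open>The angle functions\<close>

locale transverse_J_curve =
  fixes X :: "'a topology" and \<A> :: "'a chart set" and \<phi> :: "'a \<Rightarrow> complex^4^4"
  assumes X: "riemann_surface X \<A>" and J: "J_holomorphic_curve X \<A> \<phi>" and tr: "transverse_curve \<A> \<phi>"
begin

lemma plane_curve_chart:
  assumes c: "c \<in> \<A>"
  shows "plane_curve (chart_range c) (coord_rep c \<phi>)"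
proof
  show "open (chart_range c)" by (rule chartD(1)[OF X c])
  show "smooth_on (chart_range c) (coord_rep c \<phi>)"
    using J c by (simp add: J_holomorphic_curve_def smooth_fun_def)
  show "coord_rep c \<phi> ` chart_range c \<subseteq> CP3"
  proof
    fix P assume "P \<in> coord_rep c \<phi> ` chart_range c"
    then obtain p where p: "p \<in> chart_range c" "P = coord_rep c \<phi> p" by blast
    obtain x where "x \<in> topspace X" "coord_rep c \<phi> p = \<phi> x" using chart_point[OF X c p(1)] by metis
    then show "P \<in> CP3" using J p(2) by (auto simp: J_holomorphic_curve_def)
  qed
  fix p assume p: "p \<in> chart_range c"
  show "pderiv_dir (\<i> * \<xi>) (coord_rep c \<phi>) p = J_nk (coord_rep c \<phi> p) (pderiv_dir \<xi> (coord_rep c \<phi>) p)" for \<xi>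
    using J c p by (simp add: J_holomorphic_curve_def curve_deriv_def pderiv_dir_def)
  show "\<exists>\<xi>. pderiv_dir \<xi> (coord_rep c \<phi>) p \<notin> vertical_space (coord_rep c \<phi> p)"
    "\<exists>\<xi>. pderiv_dir \<xi> (coord_rep c \<phi>) p \<notin> horizontal_space (coord_rep c \<phi> p)"
    using tr c p by (auto simp: transverse_curve_def curve_deriv_def pderiv_dir_def image_subset_iff)
qed

lemma adapted_frame_iff:
  "adapted_frame c \<phi> p F \<longleftrightarrow> (\<exists>D. p \<in> D \<and> D \<subseteq> chart_range c \<and> adapted_on D (coord_rep c \<phi>) F)"
  by (auto simp: adapted_frame_def adapted_on_def)

lemma tau_nonzero:
  assumes c: "c \<in> \<A>" and F: "adapted_on D (coord_rep c \<phi>) F" "D \<subseteq> chart_range c" "q \<in> D"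
  shows "\<tau>_form (pullback_mc F q 1) \<noteq> 0"
proof -
  have "adapted_frame c \<phi> q F" using F by (auto simp: adapted_frame_iff)
  then obtain \<xi> where "\<tau>_form (pullback_mc F q \<xi>) \<noteq> 0"
    using tr c F unfolding transverse_curve_def by blast
  then show ?thesis using plane_curve.adapted_forms(5)[OF plane_curve_chart[OF c] F, of \<xi>] by auto
qed

text \<open>The description ranges over all charts around x and all \<xi>. A change of chart
  replaces \<xi> by k \<xi>, and |k \<xi>| cancels since both metrics are conformal in the
  chart.\<close>

lemma alpha_minus_adapted:
  assumes c: "c \<in> \<A>" "x \<in> fst c" and F: "adapted_on D (coord_rep c \<phi>) F" "D \<subseteq> chart_range c" "snd c x \<in> D"
  shows "alpha_minus \<A> \<phi> x
    = cmod (\<omega>3 (pullback_mc F (snd c x) 1)) / cmod (\<omega>1 (pullback_mc F (snd c x) 1))" (is "_ = ?r")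
  unfolding alpha_minus_def
proof (rule the_equality)
  interpret C: plane_curve "chart_range c" "coord_rep c \<phi>" by (rule plane_curve_chart[OF c(1)])
  have dphi: "coord_rep c \<phi> differentiable (at (snd c x))"
    by (rule smooth_on_differentiable[OF C.open_S C.smooth_f coord_rep_at(2)[OF X c]])
  have ratio: "sqrt (a\<^sup>2 * Re (\<eta> * cnj \<eta>)) / sqrt (b\<^sup>2 * Re (\<eta> * cnj \<eta>)) = a / b"
    if "\<eta> \<noteq> 0" "a \<ge> 0" "b \<ge> 0" for a b :: real and \<eta>
  proof -
    have "Re (\<eta> * cnj \<eta>) = (cmod \<eta>)\<^sup>2" unfolding cmod_power2 by (simp add: power2_eq_square)
    then show ?thesis using that by (simp add: real_sqrt_mult)
  qed
  show "\<forall>c'\<in>\<A>. x \<in> fst c' \<longrightarrow> (\<forall>\<xi>. \<xi> \<noteq> 0 \<longrightarrow> ?r =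
    sqrt (pullback_g_ver \<phi> c' (snd c' x) \<xi> \<xi>) / sqrt (pullback_g_hor \<phi> c' (snd c' x) \<xi> \<xi>))"
  proof (intro ballI impI allI)
    fix c' \<xi> assume c': "c' \<in> \<A>" "x \<in> fst c'" and \<xi>: "\<xi> \<noteq> (0 :: complex)"
    obtain E T k where T: "open E" "snd c' x \<in> E" "E \<subseteq> chart_range c'" "T (snd c' x) = snd c x"
      "\<And>p. p \<in> E \<Longrightarrow> T p \<in> chart_range c" "\<And>p. p \<in> E \<Longrightarrow> (T has_derivative (*) (k p)) (at p)"
      "\<And>p. p \<in> E \<Longrightarrow> k p \<noteq> 0" "\<And>p (h :: 'a \<Rightarrow> complex^4^4). p \<in> E \<Longrightarrow> coord_rep c' h p = coord_rep c h (T p)"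
      using chart_transition[OF X c(1) c'(1) c(2) c'(2), where 'b = "complex^4^4"] by metis
    let ?p = "snd c' x"
    have "pderiv_dir \<xi> (coord_rep c' \<phi>) ?p = pderiv_dir (k ?p * \<xi>) (coord_rep c \<phi>) (snd c x)"
      using coord_rep_transition_deriv(1)[OF T(1,2) T(6)[OF T(2)], of "coord_rep c' \<phi>" "coord_rep c \<phi>"]
        T(4,8) dphi by simp
    moreover have "coord_rep c' \<phi> ?p = coord_rep c \<phi> (snd c x)" using T(8)[OF T(2)] T(4) by simp
    ultimately have "pullback_g_ver \<phi> c' ?p \<xi> \<xi> = (cmod (\<omega>3 (pullback_mc F (snd c x) 1)))\<^sup>2 * Re ((k ?p * \<xi>) * cnj (k ?p * \<xi>))"
      "pullback_g_hor \<phi> c' ?p \<xi> \<xi> = (cmod (\<omega>1 (pullback_mc F (snd c x) 1)))\<^sup>2 * Re ((k ?p * \<xi>) * cnj (k ?p * \<xi>))"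
      using C.adapted_metrics[OF F, of "k ?p * \<xi>" "k ?p * \<xi>"]
      by (simp_all add: pullback_g_ver_def pullback_g_hor_def curve_deriv_def pderiv_dir_def)
    then show "?r = sqrt (pullback_g_ver \<phi> c' ?p \<xi> \<xi>) / sqrt (pullback_g_hor \<phi> c' ?p \<xi> \<xi>)"
      using ratio[of "k ?p * \<xi>"] \<xi> T(7)[OF T(2)] by simp
  qed
  then show "r = ?r" if "\<forall>c\<in>\<A>. x \<in> fst c \<longrightarrow> (\<forall>\<xi>. \<xi> \<noteq> 0 \<longrightarrow> r =
    sqrt (pullback_g_ver \<phi> c (snd c x) \<xi> \<xi>) / sqrt (pullback_g_hor \<phi> c (snd c x) \<xi> \<xi>))" for r
    using that c by (metis zero_neq_one)
qed

text \<open>The description also ranges over all adapted frames in all charts around x. The given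
  frame is transported to the other chart by composition with T and compared there with the other
  frame.\<close>

lemma alpha_plus_adapted:
  assumes c: "c \<in> \<A>" "x \<in> fst c" and F: "adapted_on D (coord_rep c \<phi>) F" "D \<subseteq> chart_range c" "snd c x \<in> D"
  shows "alpha_plus \<A> \<phi> x
    = cmod (\<tau>_form (pullback_mc F (snd c x) 1)) / cmod (\<omega>1 (pullback_mc F (snd c x) 1))" (is "_ = ?r")
  unfolding alpha_plus_def
proof (rule the_equality)
  interpret C: plane_curve "chart_range c" "coord_rep c \<phi>" by (rule plane_curve_chart[OF c(1)])
  show *: "\<forall>c'\<in>\<A>. x \<in> fst c' \<longrightarrow> (\<forall>F'. adapted_frame c' \<phi> (snd c' x) F' \<longrightarrow> (\<forall>\<xi>. \<xi> \<noteq> 0 \<longrightarrow> ?r =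
    cmod (\<tau>_form (pullback_mc F' (snd c' x) \<xi>)) / cmod (\<omega>1 (pullback_mc F' (snd c' x) \<xi>))))"
  proof (intro ballI impI allI)
    fix c' F' \<xi> assume c': "c' \<in> \<A>" "x \<in> fst c'" and "adapted_frame c' \<phi> (snd c' x) F'" and \<xi>: "\<xi> \<noteq> (0 :: complex)"
    then obtain D' where D': "snd c' x \<in> D'" "D' \<subseteq> chart_range c'" "adapted_on D' (coord_rep c' \<phi>) F'"
      by (auto simp: adapted_frame_iff)
    obtain E T k where T: "open E" "snd c' x \<in> E" "E \<subseteq> chart_range c'" "T (snd c' x) = snd c x"
      "\<And>p. p \<in> E \<Longrightarrow> T p \<in> chart_range c" "\<And>p. p \<in> E \<Longrightarrow> (T has_derivative (*) (k p)) (at p)"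
      "\<And>p. p \<in> E \<Longrightarrow> k p \<noteq> 0" "\<And>p (h :: 'a \<Rightarrow> complex^4^4). p \<in> E \<Longrightarrow> coord_rep c' h p = coord_rep c h (T p)"
      using chart_transition[OF X c(1) c'(1) c(2) c'(2), where 'b = "complex^4^4"] by metis
    have oD: "open D" and sF: "smooth_on D F" and F0: "\<And>y. y \<in> D \<Longrightarrow> F y \<in> Sp2 \<and> Sp2_proj (F y) = coord_rep c \<phi> y \<and> (\<forall>\<xi>. \<omega>2 (pullback_mc F y \<xi>) = 0)"
      using F(1) by (auto simp: adapted_on_def)
    have oD': "open D'" and sF': "smooth_on D' F'" and F0': "\<And>y. y \<in> D' \<Longrightarrow> F' y \<in> Sp2 \<and> Sp2_proj (F' y) = coord_rep c' \<phi> y \<and> (\<forall>\<xi>. \<omega>2 (pullback_mc F' y \<xi>) = 0)"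
      using D'(3) by (auto simp: adapted_on_def)
    \<comment> \<open>The open set on which both the transported frame and the other frame are
      defined.\<close>
    define B where "B = (E \<inter> T -` D) \<inter> D'"
    have "continuous_on E T"
      using T(6) has_derivative_continuous by (blast intro: continuous_at_imp_continuous_on)
    then have B: "open B" unfolding B_def by (intro open_Int oD' continuous_open_preimage T(1) oD)
    let ?p = "snd c' x"
    have p: "?p \<in> B" using T(2,4) D'(1) F(3) by (simp add: B_def)
    have dF: "F differentiable (at (T y))" if "y \<in> B" for y
      using smooth_on_differentiable[OF oD sF] that by (simp add: B_def)
    have dFT: "(\<lambda>y. F (T y)) differentiable (at y)" "pullback_mc (\<lambda>y. F (T y)) y \<zeta> = pullback_mc F (T y) (k y * \<zeta>)"
      if y: "y \<in> B" for y \<zeta>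
    proof -
      have "(T has_derivative (*) (k y)) (at y)" using T(6) y by (simp add: B_def)
      note tD = coord_rep_transition_deriv[OF B y this, of "\<lambda>y. F (T y)" F, OF refl dF[OF y]]
      show "(\<lambda>y. F (T y)) differentiable (at y)" by (rule tD(2))
      show "pullback_mc (\<lambda>y. F (T y)) y \<zeta> = pullback_mc F (T y) (k y * \<zeta>)"
        by (simp add: pullback_mc_eq tD(1))
    qed
    have cmp: "cmod (\<omega>1 (pullback_mc F' ?p \<xi>)) = cmod (\<omega>1 (pullback_mc (\<lambda>y. F (T y)) ?p \<xi>))"
      "cmod (\<tau>_form (pullback_mc F' ?p \<xi>)) = cmod (\<tau>_form (pullback_mc (\<lambda>y. F (T y)) ?p \<xi>))"
    proof -
      have 1: "F (T y) \<in> Sp2" "\<omega>2 (pullback_mc (\<lambda>y. F (T y)) y \<zeta>) = 0" "Sp2_proj (F (T y)) = Sp2_proj (F' y)"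
        "F' differentiable (at y)" "F' y \<in> Sp2" "\<omega>2 (pullback_mc F' y \<zeta>) = 0"
        "\<exists>\<zeta>. \<omega>1 (pullback_mc (\<lambda>y. F (T y)) y \<zeta>) \<noteq> 0" if y: "y \<in> B" for y \<zeta>
      proof -
        have yy: "y \<in> E" "T y \<in> D" "y \<in> D'" using y by (auto simp: B_def)
        show "F (T y) \<in> Sp2" "\<omega>2 (pullback_mc (\<lambda>y. F (T y)) y \<zeta>) = 0" "Sp2_proj (F (T y)) = Sp2_proj (F' y)"
          "F' y \<in> Sp2" "\<omega>2 (pullback_mc F' y \<zeta>) = 0"
          using F0[OF yy(2)] F0'[OF yy(3)] T(8)[OF yy(1), of \<phi>] dFT(2)[OF y] by auto
        show "F' differentiable (at y)" by (rule smooth_on_differentiable[OF oD' sF' yy(3)])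
        show "\<exists>\<zeta>. \<omega>1 (pullback_mc (\<lambda>y. F (T y)) y \<zeta>) \<noteq> 0"
          using C.adapted_forms(1,3)[OF F(1,2) yy(2)] T(7)[OF yy(1)] dFT(2)[OF y]
          by (intro exI[of _ 1]) (metis mult_1_right mult_eq_0_iff)
      qed
      show "cmod (\<omega>1 (pullback_mc F' ?p \<xi>)) = cmod (\<omega>1 (pullback_mc (\<lambda>y. F (T y)) ?p \<xi>))"
        "cmod (\<tau>_form (pullback_mc F' ?p \<xi>)) = cmod (\<tau>_form (pullback_mc (\<lambda>y. F (T y)) ?p \<xi>))"
        using adapted_frames_compare[OF B p, of "\<lambda>y. F (T y)" F' \<xi>] dFT(1) 1 by blast+
    qed
    have "\<omega>1 (pullback_mc F (snd c x) (k ?p * \<xi>)) = \<omega>1 (pullback_mc F (snd c x) 1) * (k ?p * \<xi>)"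
      "\<tau>_form (pullback_mc F (snd c x) (k ?p * \<xi>)) = \<tau>_form (pullback_mc F (snd c x) 1) * (k ?p * \<xi>)"
      by (rule C.adapted_forms(1,5)[OF F])+
    then show "?r = cmod (\<tau>_form (pullback_mc F' ?p \<xi>)) / cmod (\<omega>1 (pullback_mc F' ?p \<xi>))"
      unfolding cmp dFT(2)[OF p] T(4) using T(7)[OF T(2)] \<xi> by (simp add: norm_mult)
  qed
  have "adapted_frame c \<phi> (snd c x) F" using F by (auto simp: adapted_frame_iff)
  then show "r = ?r" if "\<forall>c\<in>\<A>. x \<in> fst c \<longrightarrow> (\<forall>F. adapted_frame c \<phi> (snd c x) F \<longrightarrow> (\<forall>\<xi>. \<xi> \<noteq> 0 \<longrightarrow> r =
    cmod (\<tau>_form (pullback_mc F (snd c x) \<xi>)) / cmod (\<omega>1 (pullback_mc F (snd c x) \<xi>))))" for r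
    using that c by (metis zero_neq_one)
qed

end

lemma smooth_on_cmod_square:
  assumes "open S" "smooth_on S (f :: complex \<Rightarrow> complex)"
  shows "smooth_on S (\<lambda>p. (cmod (f p))\<^sup>2)"
proof -
  have "bilinear ((\<bullet>) :: complex \<Rightarrow> complex \<Rightarrow> real)"
    by (simp add: bilinear_conv_bounded_bilinear bounded_bilinear_inner)
  from smooth_on_bilinear[OF assms(1) this assms(2,2)] show ?thesis
    by (simp add: power2_norm_eq_inner)
qed

section \<open>Smoothness of the angle functions, the Laplace equations and curvature in
  charts\<close>

context transverse_J_curve
begin

abbreviation "\<alpha>m \<equiv> alpha_minus \<A> \<phi>"
abbreviation "\<alpha>p \<equiv> alpha_plus \<A> \<phi>"

text \<open>Equals |\<omega>1|^2 on the x-direction for each adapted frame, but is defined on the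
  whole chart without choosing one.\<close>

definition conformal_factor :: "'a chart \<Rightarrow> complex \<Rightarrow> real" where
  "conformal_factor c p = pullback_g_hor \<phi> c p 1 1"

lemma adapted_chart:
  assumes c: "c \<in> \<A>" and F: "adapted_on D (coord_rep c \<phi>) F" "D \<subseteq> chart_range c" "q \<in> D"
  shows "conformal_factor c q = (cmod (\<omega>1 (pullback_mc F q 1)))\<^sup>2"
    "pullback_g_hor \<phi> c q \<xi> \<eta> = conformal_factor c q * Re (\<xi> * cnj \<eta>)"
    "(coord_rep c \<alpha>m q)\<^sup>2 = (cmod (\<omega>3 (pullback_mc F q 1)))\<^sup>2 / conformal_factor c q"
    "(coord_rep c \<alpha>p q)\<^sup>2 = (cmod (\<tau>_form (pullback_mc F q 1)))\<^sup>2 / conformal_factor c q"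
    "coord_rep c \<alpha>m q > 0" "coord_rep c \<alpha>p q > 0" "conformal_factor c q > 0"
proof -
  interpret C: plane_curve "chart_range c" "coord_rep c \<phi>" by (rule plane_curve_chart[OF c])
  note m = C.adapted_metrics(1)[OF F]
  show l: "conformal_factor c q = (cmod (\<omega>1 (pullback_mc F q 1)))\<^sup>2"
    using m[of 1 1] by (simp add: conformal_factor_def pullback_g_hor_def curve_deriv_def pderiv_dir_def)
  show "pullback_g_hor \<phi> c q \<xi> \<eta> = conformal_factor c q * Re (\<xi> * cnj \<eta>)"
    using m[of \<xi> \<eta>] by (simp add: l pullback_g_hor_def curve_deriv_def pderiv_dir_def)
  have "q \<in> chart_range c" using F by blast
  then obtain x where x: "x \<in> fst c" "snd c x = q" by (auto simp: chart_range_def)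
  have v: "coord_rep c \<alpha>m q = \<alpha>m x" "coord_rep c \<alpha>p q = \<alpha>p x"
    using coord_rep_at(1)[OF X c x(1)] x(2) by metis+
  have e: "coord_rep c \<alpha>m q = cmod (\<omega>3 (pullback_mc F q 1)) / cmod (\<omega>1 (pullback_mc F q 1))"
    "coord_rep c \<alpha>p q = cmod (\<tau>_form (pullback_mc F q 1)) / cmod (\<omega>1 (pullback_mc F q 1))"
    using alpha_minus_adapted[OF c x(1) F(1,2)] alpha_plus_adapted[OF c x(1) F(1,2)] F(3) x(2) v by simp_all
  then show "(coord_rep c \<alpha>m q)\<^sup>2 = (cmod (\<omega>3 (pullback_mc F q 1)))\<^sup>2 / conformal_factor c q"
    "(coord_rep c \<alpha>p q)\<^sup>2 = (cmod (\<tau>_form (pullback_mc F q 1)))\<^sup>2 / conformal_factor c q"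
    by (simp_all add: l power_divide)
  show "coord_rep c \<alpha>m q > 0" "coord_rep c \<alpha>p q > 0" "conformal_factor c q > 0"
    using C.adapted_forms(3,4)[OF F] tau_nonzero[OF c F] by (simp_all add: e l)
qed

text \<open>The squares of the angle functions are quotients of squared moduli of frame
  coefficients, hence smooth, and positivity allows taking roots. This is done on the domain of a
  frame and then localised.\<close>

lemma smooth_chart_functions:
  assumes c: "c \<in> \<A>"
  shows "smooth_on (chart_range c) (conformal_factor c)"
    "smooth_on (chart_range c) (coord_rep c \<alpha>m)" "smooth_on (chart_range c) (coord_rep c \<alpha>p)"
proof -
  interpret C: plane_curve "chart_range c" "coord_rep c \<phi>" by (rule plane_curve_chart[OF c])
  have ex: "\<exists>D. open D \<and> p \<in> D \<and> D \<subseteq> chart_range c \<and> smooth_on D (conformal_factor c) \<and>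
      smooth_on D (coord_rep c \<alpha>m) \<and> smooth_on D (coord_rep c \<alpha>p)" if p: "p \<in> chart_range c" for p
  proof -
    obtain D F where F: "p \<in> D" "D \<subseteq> chart_range c" "adapted_on D (coord_rep c \<phi>) F"
      using C.adapted_on_exists[OF p] by blast
    have D: "open D" "smooth_on D F" using F(3) by (auto simp: adapted_on_def)
    note ac = adapted_chart[OF c F(3,2)]
    have sq: "smooth_on D (\<lambda>q. (cmod (\<psi> (pullback_mc F q 1)))\<^sup>2)" if "linear \<psi>" for \<psi> :: "qmat \<Rightarrow> complex"
      by (rule smooth_on_cmod_square[OF D(1) smooth_on_linear[OF D(1) that smooth_on_pullback_mc[OF D]]])
    have l: "smooth_on D (conformal_factor c)"
      by (rule smooth_on_cong[OF D(1) ac(1)[symmetric] sq[OF linear_forms(1)]])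
    have root: "smooth_on D h" if "linear \<psi>" "\<And>q. q \<in> D \<Longrightarrow> h q > 0"
      "\<And>q. q \<in> D \<Longrightarrow> (h q)\<^sup>2 = (cmod (\<psi> (pullback_mc F q 1)))\<^sup>2 / conformal_factor c q" for \<psi> and h :: "complex \<Rightarrow> real"
    proof (rule smooth_on_cong[OF D(1)])
      have "smooth_on D (\<lambda>q. (cmod (\<psi> (pullback_mc F q 1)))\<^sup>2 * inverse (conformal_factor c q))"
        using ac(7) by (intro smooth_on_mult smooth_on_inverse D(1) sq[OF that(1)] l) fastforce
      then show "smooth_on D (\<lambda>q. sqrt ((cmod (\<psi> (pullback_mc F q 1)))\<^sup>2 * inverse (conformal_factor c q)))"
        by (rule smooth_on_sqrt[OF D(1), rotated])
          (use that(2,3) in \<open>metis divide_inverse zero_less_power\<close>)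
      show "sqrt ((cmod (\<psi> (pullback_mc F q 1)))\<^sup>2 * inverse (conformal_factor c q)) = h q" if "q \<in> D" for q
        using \<open>\<And>q. q \<in> D \<Longrightarrow> h q > 0\<close>[OF that]
          \<open>\<And>q. q \<in> D \<Longrightarrow> (h q)\<^sup>2 = (cmod (\<psi> (pullback_mc F q 1)))\<^sup>2 / conformal_factor c q\<close>[OF that]
        by (simp add: divide_inverse[symmetric] real_sqrt_unique)
    qed
    show ?thesis
      using D(1) F l root[OF linear_forms(3) ac(5,3)] root[OF linear_forms(4) ac(6,4)] by blast
  qed
  show "smooth_on (chart_range c) (conformal_factor c)"
    "smooth_on (chart_range c) (coord_rep c \<alpha>m)" "smooth_on (chart_range c) (coord_rep c \<alpha>p)"
    by (rule smooth_on_local[OF C.open_S], drule ex, blast)+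
qed

text \<open>The frame equations rewritten in frame-free quantities: with b and t divided by a, the
  logarithms subtract, and so do their Laplacians.\<close>

lemma chart_functions:
  assumes c: "c \<in> \<A>" and p: "p \<in> chart_range c"
  shows "pullback_g_hor \<phi> c p \<xi> \<eta> = conformal_factor c p * Re (\<xi> * cnj \<eta>)"
    "coord_rep c \<alpha>m p > 0" "coord_rep c \<alpha>p p > 0" "conformal_factor c p > 0"
    "plane_lap (\<lambda>q. ln (conformal_factor c q)) p
      = 4 * conformal_factor c p * ((coord_rep c \<alpha>m p)\<^sup>2 + (coord_rep c \<alpha>p p)\<^sup>2 - 1)"
    "plane_lap (\<lambda>q. ln ((coord_rep c \<alpha>m q)\<^sup>2)) p
      = - 4 * conformal_factor c p * (3 * (coord_rep c \<alpha>m p)\<^sup>2 + (coord_rep c \<alpha>p p)\<^sup>2 - 2)"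
    "plane_lap (\<lambda>q. ln ((coord_rep c \<alpha>p q)\<^sup>2)) p
      = - 4 * conformal_factor c p * (3 * (coord_rep c \<alpha>p p)\<^sup>2 + (coord_rep c \<alpha>m p)\<^sup>2 - 2)"
proof -
  interpret C: plane_curve "chart_range c" "coord_rep c \<phi>" by (rule plane_curve_chart[OF c])
  obtain D F where F: "p \<in> D" "D \<subseteq> chart_range c" "adapted_on D (coord_rep c \<phi>) F"
    using C.adapted_on_exists[OF p] by blast
  have D: "open D" "smooth_on D F" using F(3) by (auto simp: adapted_on_def)
  note ac = adapted_chart[OF c F(3,2)]
  show "pullback_g_hor \<phi> c p \<xi> \<eta> = conformal_factor c p * Re (\<xi> * cnj \<eta>)"
    "coord_rep c \<alpha>m p > 0" "coord_rep c \<alpha>p p > 0" "conformal_factor c p > 0"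
    using ac(2,5,6,7)[OF F(1)] by blast+
  define a b t where "a = (\<lambda>q. (cmod (\<omega>1 (pullback_mc F q 1)))\<^sup>2)" and "b = (\<lambda>q. (cmod (\<omega>3 (pullback_mc F q 1)))\<^sup>2)"
    and "t = (\<lambda>q. (cmod (\<tau>_form (pullback_mc F q 1)))\<^sup>2)"
  have sq: "smooth_on D (\<lambda>q. (cmod (\<psi> (pullback_mc F q 1)))\<^sup>2)" if "linear \<psi>" for \<psi> :: "qmat \<Rightarrow> complex"
    by (rule smooth_on_cmod_square[OF D(1) smooth_on_linear[OF D(1) that smooth_on_pullback_mc[OF D]]])
  have s: "smooth_on D a" "smooth_on D b" "smooth_on D t"
    using sq linear_forms unfolding a_def b_def t_def by blast+
  have pos: "a q > 0" "b q > 0" "t q > 0" if "q \<in> D" for q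
    using C.adapted_forms(3,4)[OF F(3,2) that] tau_nonzero[OF c F(3,2) that] by (simp_all add: a_def b_def t_def)
  note ln_s = smooth_on_ln[OF D(1) pos(1) s(1)] smooth_on_ln[OF D(1) pos(2) s(2)] smooth_on_ln[OF D(1) pos(3) s(3)]
  have eqs: "plane_lap (\<lambda>q. ln (a q)) p = 4 * (b p + t p - a p)"
    "plane_lap (\<lambda>q. ln (b q)) p = 4 * (a p - 2 * b p)"
    "plane_lap (\<lambda>q. ln (t q)) p = 4 * (a p - 2 * t p)"
    unfolding a_def b_def t_def
    by (rule C.adapted_equations[OF F(3,2,1) tau_nonzero[OF c F(3,2)]], assumption)+
  have l: "conformal_factor c q = a q" "(coord_rep c \<alpha>m q)\<^sup>2 = b q / a q" "(coord_rep c \<alpha>p q)\<^sup>2 = t q / a q" if "q \<in> D" for q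
    using ac(1,3,4)[OF that] by (simp_all add: a_def b_def t_def)
  have quot: "plane_lap (\<lambda>q. ln (g q / a q)) p = plane_lap (\<lambda>q. ln (g q)) p - plane_lap (\<lambda>q. ln (a q)) p"
    if g: "\<And>q. q \<in> D \<Longrightarrow> g q > 0" "smooth_on D (\<lambda>q. ln (g q))" for g
  proof -
    have "plane_lap (\<lambda>q. ln (g q / a q)) p = plane_lap (\<lambda>q. 0 + 1 * ln (g q) + - 1 * ln (a q)) p"
    proof (rule plane_lap_cong[OF D(1) F(1)])
      show "ln (g q / a q) = 0 + 1 * ln (g q) + - 1 * ln (a q)" if q: "q \<in> D" for q
        using g(1)[OF q] pos(1)[OF q] by (simp add: ln_div)
    qed
    also have "\<dots> = 1 * plane_lap (\<lambda>q. ln (g q)) p + - 1 * plane_lap (\<lambda>q. ln (a q)) p"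
      by (rule plane_lap_lincomb[OF D(1) F(1) g(2) ln_s(1)])
    finally show ?thesis by simp
  qed
  note A = pos(1)[OF F(1)]
  have "plane_lap (\<lambda>q. ln (conformal_factor c q)) p = plane_lap (\<lambda>q. ln (a q)) p"
    by (rule plane_lap_cong[OF D(1) F(1)]) (simp add: l)
  also have "\<dots> = 4 * (b p + t p - a p)" by (rule eqs(1))
  finally have ec: "plane_lap (\<lambda>q. ln (conformal_factor c q)) p = 4 * (b p + t p - a p)" .
  show "plane_lap (\<lambda>q. ln (conformal_factor c q)) p
      = 4 * conformal_factor c p * ((coord_rep c \<alpha>m p)\<^sup>2 + (coord_rep c \<alpha>p p)\<^sup>2 - 1)"
    unfolding ec using A by (simp add: l[OF F(1)] field_simps)
  have "plane_lap (\<lambda>q. ln ((coord_rep c \<alpha>m q)\<^sup>2)) p = plane_lap (\<lambda>q. ln (b q / a q)) p"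
    by (rule plane_lap_cong[OF D(1) F(1)]) (simp add: l)
  also have "\<dots> = plane_lap (\<lambda>q. ln (b q)) p - plane_lap (\<lambda>q. ln (a q)) p"
    by (rule quot[OF pos(2) ln_s(2)])
  also have "\<dots> = 4 * (a p - 2 * b p) - 4 * (b p + t p - a p)" by (simp only: eqs)
  finally have em: "plane_lap (\<lambda>q. ln ((coord_rep c \<alpha>m q)\<^sup>2)) p
    = 4 * (a p - 2 * b p) - 4 * (b p + t p - a p)" .
  show "plane_lap (\<lambda>q. ln ((coord_rep c \<alpha>m q)\<^sup>2)) p
      = - 4 * conformal_factor c p * (3 * (coord_rep c \<alpha>m p)\<^sup>2 + (coord_rep c \<alpha>p p)\<^sup>2 - 2)"
    unfolding em using A by (simp add: l[OF F(1)] field_simps)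
  have "plane_lap (\<lambda>q. ln ((coord_rep c \<alpha>p q)\<^sup>2)) p = plane_lap (\<lambda>q. ln (t q / a q)) p"
    by (rule plane_lap_cong[OF D(1) F(1)]) (simp add: l)
  also have "\<dots> = plane_lap (\<lambda>q. ln (t q)) p - plane_lap (\<lambda>q. ln (a q)) p"
    by (rule quot[OF pos(3) ln_s(3)])
  also have "\<dots> = 4 * (a p - 2 * t p) - 4 * (b p + t p - a p)" by (simp only: eqs)
  finally have ep: "plane_lap (\<lambda>q. ln ((coord_rep c \<alpha>p q)\<^sup>2)) p
    = 4 * (a p - 2 * t p) - 4 * (b p + t p - a p)" .
  show "plane_lap (\<lambda>q. ln ((coord_rep c \<alpha>p q)\<^sup>2)) p
      = - 4 * conformal_factor c p * (3 * (coord_rep c \<alpha>p p)\<^sup>2 + (coord_rep c \<alpha>m p)\<^sup>2 - 2)"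
    unfolding ep using A by (simp add: l[OF F(1)] field_simps)
qed

text \<open>The conformal factor of \<gamma>^(-2) times the horizontal metric, as \<gamma>^2 = 1 /
  \<open>sqrt\<close> (\<alpha>_- \<alpha>_+).\<close>

definition flat_factor :: "'a chart \<Rightarrow> complex \<Rightarrow> real" where
  "flat_factor c p = conformal_factor c p * sqrt (coord_rep c \<alpha>m p * coord_rep c \<alpha>p p)"

lemma conformal_on_charts:
  assumes c: "c \<in> \<A>"
  shows "conformal_on (chart_range c) (conformal_factor c) (pullback_g_hor \<phi> c)"
    "conformal_on (chart_range c) (flat_factor c) (rescaled_metric \<A> \<phi> c)"
proof -
  note S = chartD(1)[OF X c] and sm = smooth_chart_functions[OF c] and cf = chart_functions[OF c]
  show "conformal_on (chart_range c) (conformal_factor c) (pullback_g_hor \<phi> c)"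
    using sm cf by (simp add: conformal_on_def)
  have "smooth_on (chart_range c) (\<lambda>p. sqrt (coord_rep c \<alpha>m p * coord_rep c \<alpha>p p))"
    using cf(2,3) by (intro smooth_on_sqrt smooth_on_mult S sm) simp
  then have "smooth_on (chart_range c) (flat_factor c)"
    unfolding flat_factor_def[abs_def] by (intro smooth_on_mult S sm)
  then show "conformal_on (chart_range c) (flat_factor c) (rescaled_metric \<A> \<phi> c)"
    using cf by (simp add: conformal_on_def rescaled_metric_def flat_factor_def gamma_factor_square)
qed

text \<open>The root contributes a quarter of each logarithm of a squared angle function. The sum of
  their two Laplacians is -16 l (\<alpha>_-^2 + \<alpha>_+^2 - 1), where l is
  \<open>conformal_factor\<close>; a quarter of it cancels the Laplacian of ln l.\<close>

lemma flat_factor_harmonic: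
  assumes c: "c \<in> \<A>" and p: "p \<in> chart_range c"
  shows "plane_lap (\<lambda>q. ln (flat_factor c q)) p = 0"
proof -
  note S = chartD(1)[OF X c] and sm = smooth_chart_functions[OF c] and cf = chart_functions[OF c]
  let ?a = "\<lambda>q. ln ((coord_rep c \<alpha>m q)\<^sup>2)" and ?b = "\<lambda>q. ln ((coord_rep c \<alpha>p q)\<^sup>2)"
  have s: "smooth_on (chart_range c) ?a" "smooth_on (chart_range c) ?b"
    using cf(2,3) unfolding power2_eq_square by (intro smooth_on_ln smooth_on_mult S sm; force)+
  have sl: "smooth_on (chart_range c) (\<lambda>q. ln (conformal_factor c q))"
    using cf(4) by (intro smooth_on_ln S sm) simp
  have sab: "smooth_on (chart_range c) (\<lambda>q. 0 + 1/4 * ?a q + 1/4 * ?b q)"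
    by (intro smooth_on_add smooth_on_mult smooth_on_const s S)
  have "plane_lap (\<lambda>q. ln (flat_factor c q)) p
    = plane_lap (\<lambda>q. 0 + 1 * ln (conformal_factor c q) + 1 * (0 + 1/4 * ?a q + 1/4 * ?b q)) p"
  proof (rule plane_lap_cong[OF S p])
    fix q assume "q \<in> chart_range c"
    then show "ln (flat_factor c q) = 0 + 1 * ln (conformal_factor c q) + 1 * (0 + 1/4 * ?a q + 1/4 * ?b q)"
      using cf(2-4)[of q] by (simp add: flat_factor_def ln_mult ln_sqrt ln_realpow)
  qed
  also have "\<dots> = 1 * plane_lap (\<lambda>q. ln (conformal_factor c q)) p + 1 * (1/4 * plane_lap ?a p + 1/4 * plane_lap ?b p)"
    by (simp only: plane_lap_lincomb[OF S p sl sab] plane_lap_lincomb[OF S p s])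
  also have "\<dots> = 0" by (simp add: cf(5-7)[OF p] algebra_simps)
  finally show ?thesis .
qed

lemma smooth_positive_alpha: "smooth_positive X \<A> \<alpha>m" "smooth_positive X \<A> \<alpha>p"
proof -
  have pos: "\<alpha>m x > 0 \<and> \<alpha>p x > 0" if "x \<in> topspace X" for x
  proof -
    have "topspace X = (\<Union>(U, z)\<in>\<A>. U)" using X by (simp add: riemann_surface_def)
    with that have "x \<in> (\<Union>(U, z)\<in>\<A>. U)" by simp
    then obtain U z where "(U, z) \<in> \<A>" "x \<in> U" by auto
    then have c: "(U, z) \<in> \<A>" "x \<in> fst (U, z)" by simp_all
    show ?thesis
      using chart_functions(2,3)[OF c(1) coord_rep_at(2)[OF X c]] unfolding coord_rep_at(1)[OF X c] by simp
  qed
  show "smooth_positive X \<A> \<alpha>m" "smooth_positive X \<A> \<alpha>p"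
    unfolding smooth_positive_def smooth_fun_def using pos smooth_chart_functions by simp_all
qed

lemma flat_rescaled_metric:
  assumes c: "c \<in> \<A>"
  shows "flat_metric_on (chart_range c) (rescaled_metric \<A> \<phi> c)"
  using riemannian_metric_on_conformal[OF chartD(1)[OF X c] conformal_on_charts(2)[OF c]]
    gauss_curvature_conformal[OF chartD(1)[OF X c] _ conformal_on_charts(2)[OF c]] flat_factor_harmonic[OF c]
  by (simp add: flat_metric_on_def)

lemma angle_system_alpha: "angle_system \<A> (rescaled_metric \<A> \<phi>) \<alpha>m \<alpha>p"
  unfolding angle_system_def
proof (intro ballI)
  fix c x assume c: "c \<in> \<A>" "x \<in> fst c"
  let ?p = "snd c x"
  have p: "?p \<in> chart_range c" by (rule coord_rep_at(2)[OF X c])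
  have v: "coord_rep c \<alpha>m ?p = \<alpha>m x" "coord_rep c \<alpha>p ?p = \<alpha>p x" by (rule coord_rep_at(1)[OF X c])+
  note cf = chart_functions[OF c(1) p, unfolded v]
  note L = laplacian_conformal[OF chartD(1)[OF X c(1)] p conformal_on_charts(2)[OF c(1)]]
  have "sqrt (\<alpha>m x * \<alpha>p x) > 0" using cf by simp
  \<comment> \<open>Passing from the coordinate Laplacian to that of the flat metric replaces the
    conformal factor by \<gamma>^2.\<close>
  then have r: "(- 4 * conformal_factor c ?p * y) / flat_factor c ?p = - 4 * y * (gamma_factor (\<alpha>m x) (\<alpha>p x))\<^sup>2" for y
    using cf(2-4) by (simp add: flat_factor_def gamma_factor_square v field_simps)
  have "laplacian_at (rescaled_metric \<A> \<phi>) c (\<lambda>y. ln ((\<alpha>m y)\<^sup>2)) x = plane_lap (\<lambda>q. ln ((coord_rep c \<alpha>m q)\<^sup>2)) ?p / flat_factor c ?p"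
    "laplacian_at (rescaled_metric \<A> \<phi>) c (\<lambda>y. ln ((\<alpha>p y)\<^sup>2)) x = plane_lap (\<lambda>q. ln ((coord_rep c \<alpha>p q)\<^sup>2)) ?p / flat_factor c ?p"
    unfolding laplacian_at_def L by (simp_all add: coord_rep_def[abs_def])
  then show "laplacian_at (rescaled_metric \<A> \<phi>) c (\<lambda>y. ln ((\<alpha>m y)\<^sup>2)) x
      = - 4 * (3 * (\<alpha>m x)\<^sup>2 + (\<alpha>p x)\<^sup>2 - 2) * (gamma_factor (\<alpha>m x) (\<alpha>p x))\<^sup>2 \<and>
     laplacian_at (rescaled_metric \<A> \<phi>) c (\<lambda>y. ln ((\<alpha>p y)\<^sup>2)) x
      = - 4 * (3 * (\<alpha>p x)\<^sup>2 + (\<alpha>m x)\<^sup>2 - 2) * (gamma_factor (\<alpha>m x) (\<alpha>p x))\<^sup>2"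
    unfolding cf(6,7) r by blast
qed

text \<open>The two values differ by the ratio \<gamma>^2 of the area densities: the first is the
  curvature of the horizontal metric itself, the second its curvature 2-form measured against the
  flat area form.\<close>

lemma gauss_curvature_g_hor:
  assumes c: "c \<in> \<A>" "x \<in> fst c"
  shows "gauss_curvature (pullback_g_hor \<phi> c) (snd c x) = 2 * (1 - (\<alpha>m x)\<^sup>2 - (\<alpha>p x)\<^sup>2)"
    "curvature_density (rescaled_metric \<A> \<phi> c) (pullback_g_hor \<phi> c) (snd c x)
      = 2 / sqrt (\<alpha>m x * \<alpha>p x) * (1 - (\<alpha>m x)\<^sup>2 - (\<alpha>p x)\<^sup>2)"
proof -
  let ?p = "snd c x"
  have p: "?p \<in> chart_range c" by (rule coord_rep_at(2)[OF X c])
  have v: "coord_rep c \<alpha>m ?p = \<alpha>m x" "coord_rep c \<alpha>p ?p = \<alpha>p x" by (rule coord_rep_at(1)[OF X c])+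
  note cf = chart_functions[OF c(1) p, unfolded v] and cc = conformal_on_charts[OF c(1)]
  show K: "gauss_curvature (pullback_g_hor \<phi> c) ?p = 2 * (1 - (\<alpha>m x)\<^sup>2 - (\<alpha>p x)\<^sup>2)"
    unfolding gauss_curvature_conformal[OF chartD(1)[OF X c(1)] p cc(1)] cf(5)
    using cf(4) by (simp add: field_simps)
  show "curvature_density (rescaled_metric \<A> \<phi> c) (pullback_g_hor \<phi> c) ?p
      = 2 / sqrt (\<alpha>m x * \<alpha>p x) * (1 - (\<alpha>m x)\<^sup>2 - (\<alpha>p x)\<^sup>2)"
    unfolding curvature_density_def K conformal_on_metric_det(2)[OF cc(1) p] conformal_on_metric_det(2)[OF cc(2) p]
    using cf(2-4) by (simp add: flat_factor_def v)
qed

text \<open>Linearity of the Laplacian in ln a and ln b reduces each equivalence to the pointwise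
  algebra of \<open>rescaled_angle_equations\<close> and \<open>toda_equations\<close>, so it holds
  for arbitrary positive unknowns over the flat metric of the curve.\<close>

lemma toda_equivalence:
  assumes a: "smooth_positive X \<A> a" and b: "smooth_positive X \<A> b"
  defines "g \<equiv> rescaled_metric \<A> \<phi>"
  shows "smooth_fun \<A> (\<lambda>x. fst (toda_unknowns (a x) (b x)))" "smooth_fun \<A> (\<lambda>x. snd (toda_unknowns (a x) (b x)))"
    "angle_system \<A> g a b \<longleftrightarrow>
      rescaled_angle_system \<A> g (\<lambda>x. gamma_factor (a x) (b x) * a x) (\<lambda>x. gamma_factor (a x) (b x) * b x)"
    "angle_system \<A> g a b \<longleftrightarrow>
      toda_system \<A> g (\<lambda>x. fst (toda_unknowns (a x) (b x))) (\<lambda>x. snd (toda_unknowns (a x) (b x)))"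
proof -
  have sab: "smooth_on (chart_range c) (coord_rep c a)" "smooth_on (chart_range c) (coord_rep c b)" if "c \<in> \<A>" for c
    using a b that by (auto simp: smooth_positive_def smooth_fun_def)
  have pos: "coord_rep c a p > 0" "coord_rep c b p > 0" if c: "c \<in> \<A>" and p: "p \<in> chart_range c" for c p
  proof -
    obtain x where "x \<in> topspace X" "\<And>h. coord_rep c h p = (h x :: real)" using chart_point[OF X c p] by metis
    then show "coord_rep c a p > 0" "coord_rep c b p > 0" using a b by (auto simp: smooth_positive_def)
  qed
  show "smooth_fun \<A> (\<lambda>x. fst (toda_unknowns (a x) (b x)))" "smooth_fun \<A> (\<lambda>x. snd (toda_unknowns (a x) (b x)))"
    using smooth_on_toda_unknowns[OF chartD(1)[OF X] sab(1) pos(1) sab(2) pos(2)]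
    by (simp_all add: smooth_fun_def coord_rep_def[abs_def])
  have L: "laplacian_at g c (\<lambda>x. ln ((gamma_factor (a x) (b x) * a x)\<^sup>2)) x
      = 3/4 * laplacian_at g c (\<lambda>x. ln ((a x)\<^sup>2)) x - 1/4 * laplacian_at g c (\<lambda>x. ln ((b x)\<^sup>2)) x"
    "laplacian_at g c (\<lambda>x. ln ((gamma_factor (a x) (b x) * b x)\<^sup>2)) x
      = 3/4 * laplacian_at g c (\<lambda>x. ln ((b x)\<^sup>2)) x - 1/4 * laplacian_at g c (\<lambda>x. ln ((a x)\<^sup>2)) x"
    "laplacian_at g c (\<lambda>x. fst (toda_unknowns (a x) (b x))) x
      = 3/4 * laplacian_at g c (\<lambda>x. ln ((a x)\<^sup>2)) x - 1/4 * laplacian_at g c (\<lambda>x. ln ((b x)\<^sup>2)) x"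
    "laplacian_at g c (\<lambda>x. snd (toda_unknowns (a x) (b x))) x
      = - (3/4 * laplacian_at g c (\<lambda>x. ln ((b x)\<^sup>2)) x - 1/4 * laplacian_at g c (\<lambda>x. ln ((a x)\<^sup>2)) x)"
    and pos': "a x > 0" "b x > 0" if c: "c \<in> \<A>" and x: "x \<in> fst c" for c x
  proof -
    have p: "snd c x \<in> chart_range c" by (rule coord_rep_at(2)[OF X c x])
    have cr: "coord_rep c (\<lambda>x. h (a x) (b x)) = (\<lambda>q. h (coord_rep c a q) (coord_rep c b q))" for h :: "real \<Rightarrow> real \<Rightarrow> real"
      by (simp add: coord_rep_def[abs_def])
    note la = laplacian_angle_functions[OF chartD(1)[OF X c] p conformal_on_charts(2)[OF c]
        sab(1)[OF c] pos(1)[OF c] sab(2)[OF c] pos(2)[OF c]]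
    show "laplacian_at g c (\<lambda>x. ln ((gamma_factor (a x) (b x) * a x)\<^sup>2)) x
      = 3/4 * laplacian_at g c (\<lambda>x. ln ((a x)\<^sup>2)) x - 1/4 * laplacian_at g c (\<lambda>x. ln ((b x)\<^sup>2)) x"
    "laplacian_at g c (\<lambda>x. ln ((gamma_factor (a x) (b x) * b x)\<^sup>2)) x
      = 3/4 * laplacian_at g c (\<lambda>x. ln ((b x)\<^sup>2)) x - 1/4 * laplacian_at g c (\<lambda>x. ln ((a x)\<^sup>2)) x"
    "laplacian_at g c (\<lambda>x. fst (toda_unknowns (a x) (b x))) x
      = 3/4 * laplacian_at g c (\<lambda>x. ln ((a x)\<^sup>2)) x - 1/4 * laplacian_at g c (\<lambda>x. ln ((b x)\<^sup>2)) x"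
    "laplacian_at g c (\<lambda>x. snd (toda_unknowns (a x) (b x))) x
      = - (3/4 * laplacian_at g c (\<lambda>x. ln ((b x)\<^sup>2)) x - 1/4 * laplacian_at g c (\<lambda>x. ln ((a x)\<^sup>2)) x)"
      using la by (simp_all add: laplacian_at_def g_def coord_rep_def[abs_def])
    show "a x > 0" "b x > 0" using pos[OF c p] by (simp_all add: coord_rep_at(1)[OF X c x])
  qed
  show "angle_system \<A> g a b \<longleftrightarrow>
      rescaled_angle_system \<A> g (\<lambda>x. gamma_factor (a x) (b x) * a x) (\<lambda>x. gamma_factor (a x) (b x) * b x)"
    unfolding angle_system_def rescaled_angle_system_def
    by (intro ball_cong refl) (simp only: L rescaled_angle_equations[OF pos'])
  show "angle_system \<A> g a b \<longleftrightarrow>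
      toda_system \<A> g (\<lambda>x. fst (toda_unknowns (a x) (b x))) (\<lambda>x. snd (toda_unknowns (a x) (b x)))"
    unfolding angle_system_def toda_system_def
    by (intro ball_cong refl) (simp only: L toda_equations[OF pos'])
qed

text \<open>The explicit inverse of the change of unknowns is exponential in an affine expression,
  so smooth Toda unknowns come from smooth positive functions.\<close>

lemma toda_unknowns_surjective:
  assumes "smooth_fun \<A> \<Omega>1" "smooth_fun \<A> \<Omega>2"
  shows "\<exists>a b. smooth_positive X \<A> a \<and> smooth_positive X \<A> b \<and> (\<forall>x. toda_unknowns (a x) (b x) = (\<Omega>1 x, \<Omega>2 x))"
proof -
  have sp: "smooth_positive X \<A> (\<lambda>x. exp (k + c1 * \<Omega>1 x + c2 * \<Omega>2 x))" for k c1 c2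
    unfolding smooth_positive_def smooth_fun_def
  proof (intro conjI ballI)
    fix c assume c: "c \<in> \<A>"
    have "smooth_on (chart_range c) (\<lambda>p. exp (k + c1 * coord_rep c \<Omega>1 p + c2 * coord_rep c \<Omega>2 p))"
      using assms c chartD(1)[OF X c]
      by (intro smooth_on_exp smooth_on_add smooth_on_mult smooth_on_const) (auto simp: smooth_fun_def)
    then show "smooth_on (chart_range c) (coord_rep c (\<lambda>x. exp (k + c1 * \<Omega>1 x + c2 * \<Omega>2 x)))"
      by (simp add: coord_rep_def[abs_def])
  qed simp
  have "toda_unknowns (exp (- ln (sqrt 2) + 3/4 * x + - 1/4 * y)) (exp (- ln (sqrt 2) + 1/4 * x + - 3/4 * y)) = (x, y)" for x y
    by (simp add: toda_unknowns_ln field_simps)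
  then show ?thesis using sp by blast
qed

end

theorem theorem4p7:
  fixes X :: "'a topology" and \<A> :: "'a chart set" and \<phi> :: "'a \<Rightarrow> complex^4^4"
    and \<alpha>m \<alpha>p :: "'a \<Rightarrow> real" and g\<^sub>H g\<^sub>0 :: "'a surface_metric"
  assumes "riemann_surface X \<A>"
    and "J_holomorphic_curve X \<A> \<phi>"
    and "transverse_curve \<A> \<phi>"
    and "\<alpha>m = alpha_minus \<A> \<phi>" and "\<alpha>p = alpha_plus \<A> \<phi>"
    and "g\<^sub>H = pullback_g_hor \<phi>"
    and "g\<^sub>0 = rescaled_metric \<A> \<phi>"
  shows
    "smooth_positive X \<A> \<alpha>m \<and> smooth_positive X \<A> \<alpha>p \<and>
     (\<forall>c\<in>\<A>. riemannian_metric_on (chart_range c) (g\<^sub>H c) \<and> flat_metric_on (chart_range c) (g\<^sub>0 c)) \<and>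
     angle_system \<A> g\<^sub>0 \<alpha>m \<alpha>p \<and>
     bij_betw (\<lambda>(a, b). toda_unknowns a b) ({0<..} \<times> {0<..}) UNIV \<and>
     (\<forall>a b. smooth_positive X \<A> a \<and> smooth_positive X \<A> b \<longrightarrow>
        smooth_fun \<A> (\<lambda>x. fst (toda_unknowns (a x) (b x))) \<and>
        smooth_fun \<A> (\<lambda>x. snd (toda_unknowns (a x) (b x))) \<and>
        (angle_system \<A> g\<^sub>0 a b \<longleftrightarrow>
           rescaled_angle_system \<A> g\<^sub>0 (\<lambda>x. gamma_factor (a x) (b x) * a x)
                                       (\<lambda>x. gamma_factor (a x) (b x) * b x)) \<and>
        (angle_system \<A> g\<^sub>0 a b \<longleftrightarrow>
           toda_system \<A> g\<^sub>0 (\<lambda>x. fst (toda_unknowns (a x) (b x)))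
                             (\<lambda>x. snd (toda_unknowns (a x) (b x))))) \<and>
     (\<forall>\<Omega>1 \<Omega>2. smooth_fun \<A> \<Omega>1 \<and> smooth_fun \<A> \<Omega>2 \<longrightarrow>
        (\<exists>a b. smooth_positive X \<A> a \<and> smooth_positive X \<A> b \<and>
           (\<forall>x\<in>topspace X. toda_unknowns (a x) (b x) = (\<Omega>1 x, \<Omega>2 x)))) \<and>
     (\<forall>c\<in>\<A>. \<forall>x\<in>fst c.
        curvature_density (g\<^sub>0 c) (g\<^sub>H c) (snd c x)
          = 2 / sqrt (\<alpha>m x * \<alpha>p x) * (1 - (\<alpha>m x)\<^sup>2 - (\<alpha>p x)\<^sup>2) \<and>
        gauss_curvature (g\<^sub>H c) (snd c x) = 2 * (1 - (\<alpha>m x)\<^sup>2 - (\<alpha>p x)\<^sup>2))"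
proof -
  interpret transverse_J_curve X \<A> \<phi>
    by (rule transverse_J_curve.intro) (fact assms)+
  have riem: "riemannian_metric_on (chart_range c) (pullback_g_hor \<phi> c)" if "c \<in> \<A>" for c
    by (rule riemannian_metric_on_conformal[OF chartD(1)[OF X that] conformal_on_charts(1)[OF that]])
  show ?thesis
    unfolding assms(4-7)
  proof (intro conjI allI impI ballI)
    fix a b assume "smooth_positive X \<A> a \<and> smooth_positive X \<A> b"
    then have ab: "smooth_positive X \<A> a" "smooth_positive X \<A> b" by simp_all
    note te = toda_equivalence[OF ab]
    show "smooth_fun \<A> (\<lambda>x. fst (toda_unknowns (a x) (b x)))" by (rule te(1))
    show "smooth_fun \<A> (\<lambda>x. snd (toda_unknowns (a x) (b x)))" by (rule te(2))
    show "angle_system \<A> (rescaled_metric \<A> \<phi>) a b \<longleftrightarrow> rescaled_angle_system \<A> (rescaled_metric \<A> \<phi>)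
      (\<lambda>x. gamma_factor (a x) (b x) * a x) (\<lambda>x. gamma_factor (a x) (b x) * b x)" by (rule te(3))
    show "angle_system \<A> (rescaled_metric \<A> \<phi>) a b \<longleftrightarrow> toda_system \<A> (rescaled_metric \<A> \<phi>)
      (\<lambda>x. fst (toda_unknowns (a x) (b x))) (\<lambda>x. snd (toda_unknowns (a x) (b x)))" by (rule te(4))
  next
    fix \<Omega>1 \<Omega>2 :: "'a \<Rightarrow> real" assume "smooth_fun \<A> \<Omega>1 \<and> smooth_fun \<A> \<Omega>2"
    then show "\<exists>a b. smooth_positive X \<A> a \<and> smooth_positive X \<A> b \<and>
      (\<forall>x\<in>topspace X. toda_unknowns (a x) (b x) = (\<Omega>1 x, \<Omega>2 x))"
      using toda_unknowns_surjective[of \<Omega>1 \<Omega>2] by blast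
  qed (rule smooth_positive_alpha riem flat_rescaled_metric angle_system_alpha
      bij_betw_toda_unknowns gauss_curvature_g_hor; assumption)+
qed

end
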